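(* Let $\mathcal{M}=([n],\mathcal{I})$ be a matroid with collection of independent sets $\mathcal{I}$ and rank $r$. (1) Let $q\in(0,1]$ and $\lambda>0$, and let $\mu_{\mathcal{M},q,\lambda}$ be the random cluster distribution. The Glauber dynamics for $\mu_{\mathcal{M},q,\lambda}$ satisfies the modified log-Sobolev inequality with constant $\frac{1}{n}\max\left\{\frac{1}{1+q^{-1}\lambda},\frac{1}{1+\lambda^{-1}}\right\}$, implying an $O_{q,\lambda}(n\log n)$ mixing time. (2) Let $\lambda>0$ and let $\mu_{\mathcal{I},\lambda}$ be the distribution of $\lambda$-weighted independent sets. The Glauber dynamics for $\mu_{\mathcal{I},\lambda}$ satisfies the modified log-Sobolev inequality with constant $\frac{1}{n(1+\lambda)}$, implying an $O_\lambda(n(\log r+\log\log n))$ mixing time.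
   Context: Let $\mathrm{rk}:2^{[n]}\to\mathbb{Z}$ be the rank function of $\mathcal{M}$. The random cluster distribution is $\mu_{\mathcal{M},q,\lambda}(S)\propto q^{-\mathrm{rk}(S)}\lambda^{|S|}$ for $S\subseteq[n]$; the $\lambda$-weighted independent set distribution is $\mu_{\mathcal{I},\lambda}(I)\propto\lambda^{|I|}$ for $I\in\mathcal{I}$. For a distribution $\mu$ fully supported on a downward closed family $\mathcal{X}$ of subsets of $[n]$, the Glauber dynamics $P$ picks $i\in[n]$ uniformly, lets $S'=S\setminus\{i\}$; if $S'\cup\{i\}\notin\mathcal{X}$ moves to $S'$, else moves to $S'\cup\{i\}$ with probability $\frac{\mu(S'\cup\{i\})}{\mu(S')+\mu(S'\cup\{i\})}$ and to $S'$ otherwise. The modified log-Sobolev inequality with constant $\rho_0$ means $\rho_0\,\mathrm{Ent}_\mu[f]\le\mathcal{E}_P(f,\log f)$ for all $f>0$, where $\mathcal{E}_P(f,g)=\sum_x\mu(x)f(x)((I-P)g)(x)$ and $\mathrm{Ent}_\mu[f]=\mathbb{E}_\mu[f\log f]-\mathbb{E}_\mu[f]\log\mathbb{E}_\mu[f]$. The mixing time is $\max_x\min\{t:d_{\mathrm{TV}}(P^t(x,\cdot),\mu)\le1/4\}$. *)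

theory Defs
  imports "HOL-Probability.Probability"
begin

locale matroid =
  fixes E :: "'a set" and \<I> :: "'a set set"
  assumes finite_ground: "finite E"
    and indep_subset: "\<And>A. A \<in> \<I> \<Longrightarrow> A \<subseteq> E"
    and empty_indep: "{} \<in> \<I>"
    and indep_down: "\<And>A B. B \<in> \<I> \<Longrightarrow> A \<subseteq> B \<Longrightarrow> A \<in> \<I>"
    and augmentation: "\<And>A B. A \<in> \<I> \<Longrightarrow> B \<in> \<I> \<Longrightarrow> card A < card B \<Longrightarrow> \<exists>x \<in> B - A. insert x A \<in> \<I>"

definition matroid_rank :: "'a set set \<Rightarrow> 'a set \<Rightarrow> nat" where
  "matroid_rank \<I> S = Max {card A | A. A \<in> \<I> \<and> A \<subseteq> S}"

text \<open>The distribution on the finite set \<open>X\<close> proportional to the positive weight \<open>w\<close>.\<close>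

definition weighted_pmf :: "'b set \<Rightarrow> ('b \<Rightarrow> real) \<Rightarrow> 'b pmf" where
  "weighted_pmf X w = embed_pmf (\<lambda>x. if x \<in> X then w x / sum w X else 0)"

lemma pmf_weighted_pmf:
  assumes fin: "finite X" and ne: "X \<noteq> {}" and pos: "\<And>x. x \<in> X \<Longrightarrow> 0 < w x"
  shows "pmf (weighted_pmf X w) x = (if x \<in> X then w x / sum w X else 0)"
proof -
  let ?g = "\<lambda>x. if x \<in> X then w x / sum w X else 0"
  have Z: "0 < sum w X"
    using fin ne pos by (rule sum_pos)
  have nonneg: "0 \<le> ?g y" for y
    using Z pos[of y] by (simp add: less_imp_le)
  have "(\<integral>\<^sup>+ y. ennreal (?g y) \<partial>count_space UNIV) = (\<Sum>y\<in>X. ennreal (?g y))"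
    using fin by (intro nn_integral_count_space') (auto split: if_splits)
  also have "\<dots> = ennreal (\<Sum>y\<in>X. ?g y)"
    by (rule sum_ennreal) (rule nonneg)
  also have "(\<Sum>y\<in>X. ?g y) = 1"
    using Z by (simp flip: sum_divide_distrib)
  finally have one: "(\<integral>\<^sup>+ y. ennreal (?g y) \<partial>count_space UNIV) = 1"
    by simp
  show ?thesis
    unfolding weighted_pmf_def by (rule pmf_embed_pmf[OF nonneg one])
qed

lemma set_pmf_weighted_pmf:
  assumes "finite X" and "X \<noteq> {}" and "\<And>x. x \<in> X \<Longrightarrow> 0 < w x"
  shows "set_pmf (weighted_pmf X w) = X"
proof -
  have "0 < sum w X"
    using assms by (rule sum_pos)
  then show ?thesis
    using assms by (auto simp: set_pmf_eq pmf_weighted_pmf dest: assms(3))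
qed

definition random_cluster :: "'a set \<Rightarrow> 'a set set \<Rightarrow> real \<Rightarrow> real \<Rightarrow> 'a set pmf" where
  "random_cluster E \<I> q lam =
     weighted_pmf (Pow E) (\<lambda>S. q powi (- int (matroid_rank \<I> S)) * lam ^ card S)"

definition weighted_indep :: "'a set set \<Rightarrow> real \<Rightarrow> 'a set pmf" where
  "weighted_indep \<I> lam = weighted_pmf \<I> (\<lambda>S. lam ^ card S)"

text \<open>One step of the Glauber dynamics from the state \<open>S\<close>; the downward closed family on which
  \<open>\<mu>\<close> is fully supported is \<open>set_pmf \<mu>\<close>.\<close>

definition glauber :: "'a set \<Rightarrow> 'a set pmf \<Rightarrow> 'a set \<Rightarrow> 'a set pmf" where
  "glauber E \<mu> S =
     bind_pmf (pmf_of_set E) (\<lambda>i.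
       let S' = S - {i} in
       if S' \<union> {i} \<notin> set_pmf \<mu> then return_pmf S'
       else bind_pmf (bernoulli_pmf (pmf \<mu> (S' \<union> {i}) / (pmf \<mu> S' + pmf \<mu> (S' \<union> {i}))))
              (\<lambda>b. return_pmf (if b then S' \<union> {i} else S')))"

definition dirichlet_form ::
    "'s pmf \<Rightarrow> ('s \<Rightarrow> 's pmf) \<Rightarrow> ('s \<Rightarrow> real) \<Rightarrow> ('s \<Rightarrow> real) \<Rightarrow> real" where
  "dirichlet_form \<mu> P f g =
     (\<Sum>x\<in>set_pmf \<mu>. pmf \<mu> x * f x * (g x - measure_pmf.expectation (P x) g))"

definition Ent :: "'s pmf \<Rightarrow> ('s \<Rightarrow> real) \<Rightarrow> real" where
  "Ent \<mu> f = measure_pmf.expectation \<mu> (\<lambda>x. f x * ln (f x))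
            - measure_pmf.expectation \<mu> f * ln (measure_pmf.expectation \<mu> f)"

definition modified_log_sobolev :: "'s pmf \<Rightarrow> ('s \<Rightarrow> 's pmf) \<Rightarrow> real \<Rightarrow> bool" where
  "modified_log_sobolev \<mu> P \<rho> \<longleftrightarrow>
     (\<forall>f. (\<forall>x\<in>set_pmf \<mu>. 0 < f x) \<longrightarrow> \<rho> * Ent \<mu> f \<le> dirichlet_form \<mu> P f (\<lambda>x. ln (f x)))"

definition chain_power :: "('s \<Rightarrow> 's pmf) \<Rightarrow> nat \<Rightarrow> 's \<Rightarrow> 's pmf" where
  "chain_power P t x = ((\<lambda>\<nu>. bind_pmf \<nu> P) ^^ t) (return_pmf x)"

definition tv_dist :: "'s pmf \<Rightarrow> 's pmf \<Rightarrow> real" where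
  "tv_dist \<mu> \<nu> = (SUP A. \<bar>measure_pmf.prob \<mu> A - measure_pmf.prob \<nu> A\<bar>)"

text \<open>Valued in \<open>enat\<close> so that the infimum is \<open>\<infinity>\<close> if the chain never gets close to \<open>\<mu>\<close>.\<close>

definition mixing_time :: "'s pmf \<Rightarrow> ('s \<Rightarrow> 's pmf) \<Rightarrow> enat" where
  "mixing_time \<mu> P =
     (SUP x\<in>set_pmf \<mu>. INF t\<in>{t. tv_dist (chain_power P t x) \<mu> \<le> 1 / 4}. enat t)"

end

(* Entropy on subsets of E is controlled along a uniformly random partial revelation of the set.  The
   random cluster weights (q <= 1) are the coefficients of a homogeneous polynomial whose second
   derivatives, at every stage of the revelation, have at most one positive eigenvalue: at the last
   stage by Cauchy-Schwarz over the parallel classes of a contraction, at earlier stages by the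
   trickle-down argument.  That signature makes the revealed relative entropy convex in time, so the
   total entropy is at most the number of stages times its last increment, which gives
     Ent f <= sum_S sum_(i in S) mu(S) (f(S) ln (f(S) / f(S - i)) - f(S) + f(S - i)),
   which is dominated by the Dirichlet form.  Matroid duality gives the second constant, and the limit
   q -> 0 with lam * q in place of lam gives the independent sets.

   One step of the Glauber dynamics need not contract entropy at the rate given by the modified
   log-Sobolev inequality.  It does so for (1 - d) I + d P with d small; a binomial number of steps of P
   with mean s is then compared in total variation with a fixed number, since for a chain with holding
   probability c one more step after n steps changes the law by only 1 / sqrt (c n). *)

theory Submission
  imports Defs
begin

section \<open>Sums of Lorentzian slices\<close>

text \<open>Words rather than sets are revealed: an idle letter \<open>None\<close> pads every
  subset to a word of the fixed length \<open>card E + 2\<close>. The same letter supplies the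
  connectivity that excludes a second positive eigenvalue in the trickle-down. The factor
  \<open>N\<close> lost by bounding every increment by the last one is absorbed by the count of
  words, since \<open>N * fact (N - 1) = fact N\<close>. The last increment compares
  \<open>f\<close> after one more letter with its conditional mean; a Bregman divergence is smallest
  at the mean, so the value of \<open>f\<close> at the idle continuation may stand in for it, and
  this produces terms along single insertions. For mixing, \<open>d\<close> must be small in terms
  of the mass of the starting state, but the number of steps of \<open>P\<close> does not depend on
  \<open>d\<close>. The smoothing costs only a constant factor in time because every Glauber update
  keeps the current state with probability at least \<open>1 / (1 + k)\<close>, where
  \<open>k\<close> bounds the ratios of neighbouring weights and is independent of
  \<open>n\<close>.\<close>

text \<open>The hypothesis \<open>sq\<close> says \<open>K \<le> K^2\<close> for the random walk
  \<open>K = D^-1 M\<close>, so each eigenvalue of \<open>K\<close> is at most 0 or at least 1. The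
  common neighbour \<open>o'\<close> makes 1 a simple eigenvalue, so only the first kind is left on
  the complement of the constants. Iterated Rayleigh bounds replace a diagonalisation.\<close>

lemma quadratic_form_nonpos_of_square:
  fixes M :: "'v \<Rightarrow> 'v \<Rightarrow> real"
  assumes fin: "finite V" and nn: "\<And>u v. u \<in> V \<Longrightarrow> v \<in> V \<Longrightarrow> 0 \<le> M u v"
    and sym: "\<And>u v. u \<in> V \<Longrightarrow> v \<in> V \<Longrightarrow> M u v = M v u"
    and o: "o' \<in> V" "\<And>u. u \<in> V \<Longrightarrow> 0 < (\<Sum>v\<in>V. M u v) \<Longrightarrow> 0 < M u o'"
    and sq: "\<And>x. (\<Sum>u\<in>V. \<Sum>v\<in>V. M u v * x u * x v)
                \<le> (\<Sum>u\<in>V. (\<Sum>v\<in>V. M u v * x v)\<^sup>2 / (\<Sum>v\<in>V. M u v))"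
    and orth: "(\<Sum>u\<in>V. (\<Sum>v\<in>V. M u v) * x u) = 0"
  shows "(\<Sum>u\<in>V. \<Sum>v\<in>V. M u v * x u * x v) \<le> 0"
proof -
  define D where "D u = (\<Sum>v\<in>V. M u v)" for u
  define K where "K x u = (\<Sum>v\<in>V. M u v * x v) / D u" for x :: "'v \<Rightarrow> real" and u
  define Q where "Q x = (\<Sum>u\<in>V. \<Sum>v\<in>V. M u v * x u * x v)" for x :: "'v \<Rightarrow> real"
  define N where "N x = (\<Sum>u\<in>V. D u * (x u)\<^sup>2)" for x :: "'v \<Rightarrow> real"
  have D0: "0 \<le> D u" if "u \<in> V" for u
    unfolding D_def using nn that by (intro sum_nonneg) auto
  have DK: "D u * K x u = (\<Sum>v\<in>V. M u v * x v)" if u: "u \<in> V" for x u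
  proof (cases "D u = 0")
    case True
    then have "M u v = 0" if "v \<in> V" for v
      using that u nn fin unfolding D_def by (subst (asm) sum_nonneg_eq_0_iff) auto
    then show ?thesis using True by simp
  qed (simp add: K_def)
  have QK: "Q x = (\<Sum>u\<in>V. D u * x u * K x u)" for x
    unfolding Q_def
  proof (rule sum.cong[OF refl])
    fix u assume "u \<in> V"
    then have "x u * (D u * K x u) = (\<Sum>v\<in>V. M u v * x u * x v)"
      by (simp add: DK sum_distrib_left mult_ac)
    then show "(\<Sum>v\<in>V. M u v * x u * x v) = D u * x u * K x u"
      by (simp add: mult_ac)
  qed
  have KN: "Q x \<le> N (K x)" for x
  proof -
    have "(\<Sum>v\<in>V. M u v * x v)\<^sup>2 / (\<Sum>v\<in>V. M u v) = D u * (K x u)\<^sup>2" if "u \<in> V" for u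
      using DK[OF that, of x] by (cases "D u = 0") (auto simp: K_def D_def[symmetric] power2_eq_square)
    then show ?thesis using sq[of x] unfolding Q_def N_def by simp
  qed
  have Msym: "(\<Sum>u\<in>V. \<Sum>v\<in>V. M u v * (x v)\<^sup>2) = N x" for x
  proof -
    have "(\<Sum>u\<in>V. \<Sum>v\<in>V. M u v * (x v)\<^sup>2) = (\<Sum>v\<in>V. \<Sum>u\<in>V. M u v * (x v)\<^sup>2)"
      by (rule sum.swap)
    also have "\<dots> = (\<Sum>v\<in>V. \<Sum>u\<in>V. M v u * (x v)\<^sup>2)"
      by (intro sum.cong refl) (simp add: sym)
    finally show ?thesis unfolding N_def D_def by (simp add: sum_distrib_right)
  qed
  have Mrow: "(\<Sum>u\<in>V. \<Sum>v\<in>V. M u v * (x u)\<^sup>2) = N x" for x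
    unfolding N_def D_def by (simp add: sum_distrib_right)
  have minus: "(\<Sum>u\<in>V. \<Sum>v\<in>V. M u v * (x u - x v)\<^sup>2) = 2 * N x - 2 * Q x" for x
  proof -
    have "(\<Sum>u\<in>V. \<Sum>v\<in>V. M u v * (x u - x v)\<^sup>2) =
      (\<Sum>u\<in>V. \<Sum>v\<in>V. M u v * (x u)\<^sup>2 + M u v * (x v)\<^sup>2 - 2 * (M u v * x u * x v))"
      by (intro sum.cong refl) (simp add: power2_eq_square algebra_simps)
    also have "\<dots> = N x + N x - 2 * Q x"
      by (simp add: sum.distrib sum_subtractf Msym Mrow sum_distrib_left[symmetric] Q_def)
    finally show ?thesis by simp
  qed
  have plus: "(\<Sum>u\<in>V. \<Sum>v\<in>V. M u v * (x u + x v)\<^sup>2) = 2 * N x + 2 * Q x" for x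
  proof -
    have "(\<Sum>u\<in>V. \<Sum>v\<in>V. M u v * (x u + x v)\<^sup>2) =
      (\<Sum>u\<in>V. \<Sum>v\<in>V. M u v * (x u)\<^sup>2 + M u v * (x v)\<^sup>2 + 2 * (M u v * x u * x v))"
      by (intro sum.cong refl) (simp add: power2_eq_square algebra_simps)
    also have "\<dots> = N x + N x + 2 * Q x"
      by (simp add: sum.distrib sum_subtractf Msym Mrow sum_distrib_left[symmetric] Q_def)
    finally show ?thesis by simp
  qed
  have low: "- Q x \<le> N x" for x
  proof -
    have "0 \<le> (\<Sum>u\<in>V. \<Sum>v\<in>V. M u v * (x u + x v)\<^sup>2)"
      using nn by (intro sum_nonneg mult_nonneg_nonneg) auto
    then show ?thesis unfolding plus by simp
  qed
  have N0: "0 \<le> N x" for x unfolding N_def using D0 by (intro sum_nonneg) auto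
  \<comment> \<open>A Doeblin constant: every vertex of positive degree jumps to \<open>o'\<close>
    with probability at least \<open>2 * d\<close>. It gives the initial spectral gap
    \<open>d\<close>.\<close>
  obtain d where d: "0 < d" "d \<le> 1" "\<And>u. u \<in> V \<Longrightarrow> 2 * d * D u \<le> M u o'"
  proof -
    have "\<exists>d>0. d \<le> 1 \<and> (\<forall>u\<in>W. 2 * d * D u \<le> M u o')" if "finite W" "W \<subseteq> V" for W
      using that
    proof (induction W)
      case empty
      then show ?case by (intro exI[of _ 1]) auto
    next
      case (insert u W)
      then obtain d where d: "0 < d" "d \<le> 1" "\<forall>u\<in>W. 2 * d * D u \<le> M u o'" by auto
      have u: "u \<in> V" using insert by auto
      define e where "e = (if D u = 0 then 1 else M u o' / (2 * D u))"
      have e: "0 < e" using D0[OF u] o(2)[OF u] unfolding e_def D_def[symmetric] by auto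
      have eu: "2 * e * D u \<le> M u o'" using nn[OF u o(1)] by (auto simp: e_def)
      show ?case
      proof (intro exI[of _ "min d e"] conjI ballI)
        fix v assume "v \<in> insert u W"
        then have v: "v \<in> V" using insert by auto
        show "2 * min d e * D v \<le> M v o'"
        proof (cases "v = u")
          case True
          have "2 * min d e * D v \<le> 2 * e * D v" using D0[OF v] by (intro mult_right_mono) auto
          then show ?thesis using eu True by simp
        next
          case False
          have "2 * min d e * D v \<le> 2 * d * D v" using D0[OF v] by (intro mult_right_mono) auto
          then show ?thesis using d False \<open>v \<in> insert u W\<close> by fastforce
        qed
      qed (use d e in auto)
    qed
    from this[OF fin] show ?thesis using that by auto
  qed
  define S where "S = {x. (\<Sum>u\<in>V. D u * x u) = 0}"
  have gap: "Q x \<le> (1 - d) * N x" if x: "x \<in> S" for x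
  proof -
    \<comment> \<open>The \<open>D\<close>-weighted mean of \<open>x\<close> is 0, and the second
      moment about any other point, here \<open>x o'\<close>, is no smaller than the one about the
      mean.\<close>
    have "d * N x \<le> (\<Sum>u\<in>V. d * D u * (x u - x o')\<^sup>2)"
    proof -
      have "(\<Sum>u\<in>V. d * D u * (x u - x o')\<^sup>2)
        = (\<Sum>u\<in>V. d * (D u * (x u)\<^sup>2) + d * (x o')\<^sup>2 * D u - 2 * d * x o' * (D u * x u))"
        by (intro sum.cong refl) (simp add: power2_eq_square algebra_simps)
      also have "\<dots> = d * N x + d * (x o')\<^sup>2 * sum D V - 2 * d * x o' * (\<Sum>u\<in>V. D u * x u)"
        by (simp add: sum.distrib sum_subtractf sum_distrib_left[symmetric] N_def)
      finally show ?thesis using x d D0 by (simp add: S_def sum_nonneg)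
    qed
    also have "\<dots> \<le> (\<Sum>u\<in>V. M u o' * (x u - x o')\<^sup>2 / 2)"
    proof (rule sum_mono)
      fix u assume "u \<in> V"
      then have "d * D u \<le> M u o' / 2" using d(3) by fastforce
      then have "d * D u * (x u - x o')\<^sup>2 \<le> M u o' / 2 * (x u - x o')\<^sup>2"
        by (rule mult_right_mono) simp
      then show "d * D u * (x u - x o')\<^sup>2 \<le> M u o' * (x u - x o')\<^sup>2 / 2" by simp
    qed
    also have "\<dots> \<le> (\<Sum>u\<in>V. (\<Sum>v\<in>V. M u v * (x u - x v)\<^sup>2) / 2)"
    proof (intro sum_mono divide_right_mono)
      fix u assume u: "u \<in> V"
      show "M u o' * (x u - x o')\<^sup>2 \<le> (\<Sum>v\<in>V. M u v * (x u - x v)\<^sup>2)"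
        using fin o(1) nn u by (intro member_le_sum) auto
    qed simp
    also have "\<dots> = N x - Q x" using minus[of x] by (simp add: sum_divide_distrib[symmetric])
    finally show ?thesis by (simp add: algebra_simps)
  qed
  have KS: "(\<lambda>u. t * x u - K x u) \<in> S" if x: "x \<in> S" for x t
  proof -
    have "(\<Sum>u\<in>V. D u * (t * x u - K x u)) = (\<Sum>u\<in>V. t * (D u * x u) - D u * K x u)"
      by (intro sum.cong refl) (simp add: algebra_simps)
    also have "\<dots> = t * (\<Sum>u\<in>V. D u * x u) - (\<Sum>u\<in>V. \<Sum>v\<in>V. M u v * x v)"
      by (simp add: sum_subtractf DK sum_distrib_left[symmetric])
    also have "(\<Sum>u\<in>V. \<Sum>v\<in>V. M u v * x v) = (\<Sum>v\<in>V. \<Sum>u\<in>V. M u v * x v)" by (rule sum.swap)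
    also have "\<dots> = (\<Sum>v\<in>V. D v * x v)"
      unfolding D_def sum_distrib_right by (intro sum.cong refl) (simp add: sym)
    finally show ?thesis using x by (simp add: S_def)
  qed
  \<comment> \<open>If \<open>t\<close> bounds the Rayleigh quotient, then \<open>t - K\<close> is positive semidefinite, so testing it at
    \<open>x - (t - K) x / 2\<close> bounds the norm of \<open>(t - K) x\<close>; combined with \<open>K \<le> K\<^sup>2\<close> this lowers \<open>t\<close>.\<close>
  have improve: "(3 - 2 * t) * Q x \<le> t * (2 - t) * N x"
    if t: "0 \<le> t" "t \<le> 1" "\<And>x. x \<in> S \<Longrightarrow> Q x \<le> t * N x" and x: "x \<in> S" for t x
  proof -
    define y where "y = (\<lambda>u. t * x u - K x u)"
    have y: "y \<in> S" unfolding y_def by (rule KS[OF x])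
    have Ny: "N y = t\<^sup>2 * N x - 2 * t * Q x + N (K x)"
    proof -
      have "N y = (\<Sum>u\<in>V. t\<^sup>2 * (D u * (x u)\<^sup>2) - 2 * t * (D u * x u * K x u) + D u * (K x u)\<^sup>2)"
        unfolding N_def y_def by (intro sum.cong refl) (simp add: power2_eq_square algebra_simps)
      then show ?thesis
        by (simp add: sum.distrib sum_subtractf sum_distrib_left[symmetric] N_def QK)
    qed
    \<comment> \<open>The step length 1/2 is admissible because \<open>low\<close> and
      \<open>t \<le> 1\<close> bound \<open>t - K\<close> above by 2.\<close>
    define z where "z = (\<lambda>u. x u - y u / 2)"
    have z: "z \<in> S"
    proof -
      have "(\<Sum>u\<in>V. D u * z u) = (\<Sum>u\<in>V. D u * x u) - (\<Sum>u\<in>V. D u * y u) / 2"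
        by (simp add: z_def right_diff_distrib sum_subtractf sum_divide_distrib)
      then show ?thesis using x y by (simp add: S_def)
    qed
    have Nz: "N z = N x - (\<Sum>u\<in>V. D u * x u * y u) + N y / 4"
    proof -
      have "N z = (\<Sum>u\<in>V. D u * (x u)\<^sup>2 - D u * x u * y u + D u * (y u)\<^sup>2 / 4)"
        unfolding N_def z_def by (intro sum.cong refl) (simp add: power2_eq_square algebra_simps)
      then show ?thesis
        by (simp add: sum.distrib sum_subtractf sum_divide_distrib[symmetric] N_def)
    qed
    have Qz: "Q z = Q x - (\<Sum>u\<in>V. D u * K x u * y u) + Q y / 4"
    proof -
      have s1: "(\<Sum>u\<in>V. \<Sum>v\<in>V. M u v * x u * y v) = (\<Sum>u\<in>V. \<Sum>v\<in>V. M u v * y u * x v)"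
        by (subst sum.swap) (intro sum.cong refl, simp add: sym mult_ac)
      have s2: "(\<Sum>u\<in>V. \<Sum>v\<in>V. M u v * y u * x v) = (\<Sum>u\<in>V. D u * K x u * y u)"
        by (intro sum.cong refl) (simp add: DK sum_distrib_left mult_ac)
      have "Q z = (\<Sum>u\<in>V. \<Sum>v\<in>V. M u v * x u * x v - M u v * x u * y v / 2
            - M u v * y u * x v / 2 + M u v * y u * y v / 4)"
        unfolding Q_def z_def by (intro sum.cong refl) (simp add: field_simps)
      then show ?thesis
        using s1 s2
        by (simp add: sum.distrib sum_subtractf sum_divide_distrib[symmetric] Q_def)
    qed
    have ty: "t * (\<Sum>u\<in>V. D u * x u * y u) - (\<Sum>u\<in>V. D u * K x u * y u) = N y"
    proof -
      have "N y = (\<Sum>u\<in>V. t * (D u * x u * y u) - D u * K x u * y u)"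
        unfolding N_def by (intro sum.cong refl) (simp add: y_def power2_eq_square algebra_simps)
      then show ?thesis by (simp add: sum_subtractf sum_distrib_left)
    qed
    have "Q z \<le> t * N z" using t(3)[OF z] .
    then have "Q x + Q y / 4 \<le> t * N x - N y + t * N y / 4"
      unfolding Qz Nz using ty by (simp add: algebra_simps)
    moreover have "t * N y \<le> N y" using t(2) N0[of y] by (simp add: mult_left_le_one_le t(1))
    ultimately have "N y \<le> 2 * (t * N x - Q x)" using low[of y] by argo
    moreover have "Q x \<le> N (K x)" by (rule KN)
    ultimately show ?thesis using Ny by (simp add: algebra_simps power2_eq_square)
  qed
  \<comment> \<open>The map \<open>t\<close> to \<open>t (2 - t) / (3 - 2 t)\<close> given by
    \<open>improve\<close> has the fixed points 0 and 1. Below \<open>1 - d\<close> it shrinks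
    \<open>t\<close> at least by the factor \<open>1 - d / 3\<close>, so the bound tends to
    0.\<close>
  have iter: "x \<in> S \<Longrightarrow> Q x \<le> (1 - d) * (1 - d / 3) ^ k * N x" for k x
  proof (induction k arbitrary: x)
    case 0
    then show ?case using gap by simp
  next
    case (Suc k)
    define t where "t = (1 - d) * (1 - d / 3) ^ k"
    have p: "(1 - d / 3) ^ k \<le> 1" "0 \<le> (1 - d / 3) ^ k" using d by (auto intro: power_le_one)
    have t0: "0 \<le> t" using p d by (simp add: t_def)
    have t1: "t \<le> 1 - d" unfolding t_def using mult_left_mono[OF p(1), of "1 - d"] d by simp
    have t2: "t \<le> 1" using t1 d by simp
    have "Q x \<le> t * N x" if "x \<in> S" for x using Suc.IH[OF that] by (simp add: t_def)
    from improve[OF t0 t2 this Suc.prems]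
    have "(3 - 2 * t) * Q x \<le> t * (2 - t) * N x" .
    also have "\<dots> \<le> (3 - 2 * t) * (t * (1 - d / 3) * N x)"
    proof -
      have "2 - t \<le> (3 - 2 * t) * (1 - d / 3)"
      proof -
        have "(3 - 2 * t) * (d / 3) \<le> 3 * (d / 3)" using t0 d by (intro mult_right_mono) auto
        then have "(3 - 2 * t) * (d / 3) \<le> d" by simp
        then show ?thesis using t1 by (simp add: right_diff_distrib)
      qed
      then have "t * N x * (2 - t) \<le> t * N x * ((3 - 2 * t) * (1 - d / 3))"
        using t0 N0 by (intro mult_left_mono) auto
      then show ?thesis by (simp add: mult_ac)
    qed
    finally have "Q x \<le> t * (1 - d / 3) * N x" using t2 by (subst (asm) mult_le_cancel_left_pos) auto
    then show ?case by (simp add: t_def mult_ac)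
  qed
  have x: "x \<in> S" using orth by (simp add: S_def D_def)
  have "(\<lambda>k. (1 - d) * (1 - d / 3) ^ k * N x) \<longlonglongrightarrow> (1 - d) * 0 * N x"
    using d by (intro tendsto_intros LIMSEQ_realpow_zero) auto
  then have "Q x \<le> (1 - d) * 0 * N x"
    by (rule LIMSEQ_le_const) (use iter[OF x] in auto)
  then show ?thesis by (simp add: Q_def)
qed

text \<open>Reverse Cauchy-Schwarz against the all-ones vector; for a nonnegative matrix this says that there
  is at most one positive eigenvalue.\<close>

definition lorentzian :: "'v set \<Rightarrow> ('v \<Rightarrow> 'v \<Rightarrow> real) \<Rightarrow> bool" where
  "lorentzian V M \<longleftrightarrow> (\<forall>x. (\<Sum>u\<in>V. \<Sum>v\<in>V. M u v * x u * x v) * (\<Sum>u\<in>V. \<Sum>v\<in>V. M u v)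
      \<le> (\<Sum>u\<in>V. \<Sum>v\<in>V. M u v * x u)\<^sup>2)"

lemma quadratic_form_shift:
  fixes M :: "'v \<Rightarrow> 'v \<Rightarrow> real"
  assumes sym: "\<And>u v. u \<in> V \<Longrightarrow> v \<in> V \<Longrightarrow> M u v = M v u"
  shows "(\<Sum>u\<in>V. \<Sum>v\<in>V. M u v * (x u - s) * (x v - s)) =
    (\<Sum>u\<in>V. \<Sum>v\<in>V. M u v * x u * x v) - 2 * s * (\<Sum>u\<in>V. \<Sum>v\<in>V. M u v * x u)
      + s\<^sup>2 * (\<Sum>u\<in>V. \<Sum>v\<in>V. M u v)"
proof -
  have s: "(\<Sum>u\<in>V. \<Sum>v\<in>V. M u v * x v) = (\<Sum>u\<in>V. \<Sum>v\<in>V. M u v * x u)"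
    by (subst sum.swap) (intro sum.cong refl, simp add: sym)
  have "(\<Sum>u\<in>V. \<Sum>v\<in>V. M u v * (x u - s) * (x v - s)) =
    (\<Sum>u\<in>V. \<Sum>v\<in>V. M u v * x u * x v - s * (M u v * x u) - s * (M u v * x v) + s\<^sup>2 * M u v)"
    by (intro sum.cong refl) (simp add: algebra_simps power2_eq_square)
  then show ?thesis
    by (simp add: sum.distrib sum_subtractf sum_distrib_left[symmetric] s)
qed

text \<open>Here the shift \<open>s\<close> moves \<open>x\<close> along the all-ones vector into a hyperplane on which the form is
  negative semidefinite.\<close>

lemma lorentzianI:
  fixes M :: "'v \<Rightarrow> 'v \<Rightarrow> real"
  assumes sym: "\<And>u v. u \<in> V \<Longrightarrow> v \<in> V \<Longrightarrow> M u v = M v u"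
    and nn: "0 \<le> (\<Sum>u\<in>V. \<Sum>v\<in>V. M u v)"
    and l: "\<And>x. \<exists>s. (\<Sum>u\<in>V. \<Sum>v\<in>V. M u v * (x u - s) * (x v - s)) \<le> 0"
  shows "lorentzian V M"
  unfolding lorentzian_def
proof
  fix x :: "'v \<Rightarrow> real"
  define A where "A = (\<Sum>u\<in>V. \<Sum>v\<in>V. M u v)"
  define B where "B = (\<Sum>u\<in>V. \<Sum>v\<in>V. M u v * x u)"
  define Q where "Q = (\<Sum>u\<in>V. \<Sum>v\<in>V. M u v * x u * x v)"
  from l[of x] obtain s where "(\<Sum>u\<in>V. \<Sum>v\<in>V. M u v * (x u - s) * (x v - s)) \<le> 0" ..
  then have "Q - 2 * s * B + s\<^sup>2 * A \<le> 0"
    using quadratic_form_shift[of V M x s] sym by (simp add: A_def B_def Q_def)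
  then have "A * (Q - 2 * s * B + s\<^sup>2 * A) \<le> 0" using nn
    by (simp add: A_def mult_nonneg_nonpos)
  moreover have "0 \<le> (B - s * A)\<^sup>2" by simp
  ultimately show "Q * A \<le> B\<^sup>2" by (simp add: power2_eq_square algebra_simps)
qed

text \<open>Since \<open>T\<close> is a symmetric tensor, the row sums of slice \<open>w\<close>
  form row \<open>w\<close> of \<open>M\<close>, and its total is the degree of \<open>w\<close>.
  Reverse Cauchy-Schwarz in each slice, summed over \<open>w\<close>, is therefore the hypothesis
  \<open>sq\<close> of \<open>quadratic_form_nonpos_of_square\<close>. The condition on
  \<open>o'\<close> makes it a neighbour in \<open>M\<close> of every vertex of positive
  degree.\<close>

lemma lorentzian_sum:
  fixes T :: "'v \<Rightarrow> 'v \<Rightarrow> 'v \<Rightarrow> real"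
  assumes fin: "finite V"
    and nn: "\<And>u v w. u \<in> V \<Longrightarrow> v \<in> V \<Longrightarrow> w \<in> V \<Longrightarrow> 0 \<le> T u v w"
    and sym: "\<And>u v w. u \<in> V \<Longrightarrow> v \<in> V \<Longrightarrow> w \<in> V \<Longrightarrow> T u v w = T v u w"
      "\<And>u v w. u \<in> V \<Longrightarrow> v \<in> V \<Longrightarrow> w \<in> V \<Longrightarrow> T u v w = T u w v"
    and o: "o' \<in> V" "\<And>u v w. u \<in> V \<Longrightarrow> v \<in> V \<Longrightarrow> w \<in> V \<Longrightarrow> 0 < T u v w \<Longrightarrow> \<exists>w\<in>V. 0 < T w u o'"
    and slice: "\<And>w. w \<in> V \<Longrightarrow> lorentzian V (T w)"
  shows "lorentzian V (\<lambda>u v. \<Sum>w\<in>V. T w u v)"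
proof -
  define M where "M u v = (\<Sum>w\<in>V. T w u v)" for u v
  have Mnn: "0 \<le> M u v" if "u \<in> V" "v \<in> V" for u v
    unfolding M_def using nn that by (intro sum_nonneg) auto
  have Msym: "M u v = M v u" if "u \<in> V" "v \<in> V" for u v
    unfolding M_def using that sym(2) by (intro sum.cong refl) auto
  define D where "D u = (\<Sum>v\<in>V. M u v)" for u
  have D0: "0 \<le> D u" if "u \<in> V" for u
    unfolding D_def using Mnn that by (intro sum_nonneg) auto
  have MT: "M u v = (\<Sum>w\<in>V. T u v w)" if "u \<in> V" "v \<in> V" for u v
    unfolding M_def using that sym by (intro sum.cong refl) metis
  have Drow: "(\<Sum>u\<in>V. \<Sum>v\<in>V. T w u v) = D w" if "w \<in> V" for w
    unfolding D_def using that by (intro sum.cong refl) (simp add: MT)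
  have Mrow: "(\<Sum>u\<in>V. \<Sum>v\<in>V. T w u v * x u) = (\<Sum>v\<in>V. M w v * x v)" if "w \<in> V" for w x
    using that by (intro sum.cong refl) (simp add: MT sum_distrib_right)
  have pos: "0 < M u o'" if u: "u \<in> V" and D: "0 < (\<Sum>v\<in>V. M u v)" for u
  proof -
    have "\<exists>v\<in>V. 0 < M u v"
      using D by (meson not_less sum_nonpos)
    then obtain v where v: "v \<in> V" "0 < M u v" by blast
    then have "\<exists>w\<in>V. 0 < T u v w"
      unfolding MT[OF u v(1)] by (meson not_less sum_nonpos)
    then obtain w where "w \<in> V" "0 < T w u o'" using o(2) u v by blast
    then show ?thesis
      unfolding M_def using nn u o(1) fin by (intro sum_pos2[of V w]) auto
  qed
  have sq: "(\<Sum>u\<in>V. \<Sum>v\<in>V. M u v * x u * x v)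
      \<le> (\<Sum>u\<in>V. (\<Sum>v\<in>V. M u v * x v)\<^sup>2 / (\<Sum>v\<in>V. M u v))" for x
  proof -
    have "(\<Sum>u\<in>V. \<Sum>v\<in>V. M u v * x u * x v) = (\<Sum>u\<in>V. \<Sum>v\<in>V. \<Sum>w\<in>V. T w u v * x u * x v)"
      by (simp add: M_def sum_distrib_right)
    also have "\<dots> = (\<Sum>u\<in>V. \<Sum>w\<in>V. \<Sum>v\<in>V. T w u v * x u * x v)"
      by (intro sum.cong refl sum.swap)
    also have "\<dots> = (\<Sum>w\<in>V. \<Sum>u\<in>V. \<Sum>v\<in>V. T w u v * x u * x v)"
      by (rule sum.swap)
    also have "\<dots> \<le> (\<Sum>w\<in>V. (\<Sum>v\<in>V. M w v * x v)\<^sup>2 / D w)"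
    proof (rule sum_mono)
      fix w assume w: "w \<in> V"
      show "(\<Sum>u\<in>V. \<Sum>v\<in>V. T w u v * x u * x v) \<le> (\<Sum>v\<in>V. M w v * x v)\<^sup>2 / D w"
      proof (cases "D w = 0")
        case True
        have "T w u v = 0" if "u \<in> V" "v \<in> V" for u v
        proof -
          have "M w u = 0"
            using True w that fin Mnn unfolding D_def by (subst (asm) sum_nonneg_eq_0_iff) auto
          then show ?thesis
            using w that fin nn unfolding MT[OF w that(1)]
            by (subst (asm) sum_nonneg_eq_0_iff) auto
        qed
        then show ?thesis using True by simp
      next
        case False
        then have "0 < D w" using D0[OF w] by simp
        moreover have "(\<Sum>u\<in>V. \<Sum>v\<in>V. T w u v * x u * x v) * D w \<le> (\<Sum>v\<in>V. M w v * x v)\<^sup>2"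
          using slice[OF w] w unfolding lorentzian_def by (simp add: Drow Mrow)
        ultimately show ?thesis by (simp add: pos_le_divide_eq)
      qed
    qed
    finally show ?thesis by (simp add: D_def)
  qed
  have "lorentzian V M"
  proof (rule lorentzianI[OF Msym])
    show "0 \<le> (\<Sum>u\<in>V. \<Sum>v\<in>V. M u v)" using Mnn by (intro sum_nonneg) auto
    fix x :: "'v \<Rightarrow> real"
    \<comment> \<open>The \<open>D\<close>-weighted mean of \<open>x\<close>. If the total weight is
      0, the division yields \<open>s = 0\<close>, and then every \<open>D u\<close>
      vanishes.\<close>
    define s where "s = (\<Sum>u\<in>V. D u * x u) / (\<Sum>u\<in>V. D u)"
    have "(\<Sum>u\<in>V. D u * (x u - s)) = 0"
    proof -
      have e: "(\<Sum>u\<in>V. D u * (x u - s)) = (\<Sum>u\<in>V. D u * x u) - s * (\<Sum>u\<in>V. D u)"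
        by (simp add: right_diff_distrib sum_subtractf sum_distrib_left mult.commute)
      show ?thesis
      proof (cases "(\<Sum>u\<in>V. D u) = 0")
        case True
        then have "\<And>u. u \<in> V \<Longrightarrow> D u = 0"
          using fin D0 by (subst (asm) sum_nonneg_eq_0_iff) auto
        then show ?thesis by simp
      next
        case False
        then show ?thesis by (subst e) (simp add: s_def)
      qed
    qed
    then have "(\<Sum>u\<in>V. \<Sum>v\<in>V. M u v * (x u - s) * (x v - s)) \<le> 0"
      using quadratic_form_nonpos_of_square[of V M o' "\<lambda>u. x u - s"] fin Mnn Msym o(1) pos sq
      by (simp add: D_def)
    then show "\<exists>s. (\<Sum>u\<in>V. \<Sum>v\<in>V. M u v * (x u - s) * (x v - s)) \<le> 0" by blast
  qed simp
  then show ?thesis by (simp add: M_def[abs_def])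
qed

section \<open>Convexity of the revealed entropy\<close>

lemma one_minus_inverse_le_ln: "0 < t \<Longrightarrow> 1 - 1 / t \<le> ln (t :: real)"
  using ln_le_minus_one[of "1 / t"] by (simp add: ln_div)

text \<open>A second difference in time of the relative entropy of \<open>B\<close> against
  \<open>M\<close>, with two, one and no letters known. Let \<open>t\<close> be the two-letter
  density over the product of the one-letter densities, suitably normalised. The bound
  \<open>ln t \<ge> 1 - 1 / t\<close> leaves \<open>B'\<close> minus \<open>A' / B'\<close> times
  the form at the one-letter density \<open>x = b / a\<close>, which is nonnegative by the
  Lorentzian inequality at this \<open>x\<close>.\<close>

lemma lorentzian_entropy:
  fixes M B :: "'v \<Rightarrow> 'v \<Rightarrow> real"
  assumes fin: "finite V"
    and M: "\<And>u v. u \<in> V \<Longrightarrow> v \<in> V \<Longrightarrow> 0 \<le> M u v" "\<And>u v. u \<in> V \<Longrightarrow> v \<in> V \<Longrightarrow> M u v = M v u"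
    and B: "\<And>u v. u \<in> V \<Longrightarrow> v \<in> V \<Longrightarrow> M u v = 0 \<Longrightarrow> B u v = 0"
      "\<And>u v. u \<in> V \<Longrightarrow> v \<in> V \<Longrightarrow> 0 < M u v \<Longrightarrow> 0 < B u v"
      "\<And>u v. u \<in> V \<Longrightarrow> v \<in> V \<Longrightarrow> B u v = B v u"
    and L: "lorentzian V M"
    and a: "\<And>u. u \<in> V \<Longrightarrow> a u = (\<Sum>v\<in>V. M u v)" and b: "\<And>u. u \<in> V \<Longrightarrow> b u = (\<Sum>v\<in>V. B u v)"
    and A': "A' = (\<Sum>u\<in>V. a u)" and B': "B' = (\<Sum>u\<in>V. b u)"
  shows "0 \<le> (\<Sum>u\<in>V. \<Sum>v\<in>V. B u v * ln (B u v / M u v)) - 2 * (\<Sum>u\<in>V. b u * ln (b u / a u))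
      + B' * ln (B' / A')"
proof -
  have B0: "0 \<le> B u v" if "u \<in> V" "v \<in> V" for u v
    using B(1,2)[OF that] M(1)[OF that] by fastforce
  have a0: "0 \<le> a u" if "u \<in> V" for u using M a that by (simp add: sum_nonneg)
  have b0: "0 \<le> b u" if "u \<in> V" for u using B0 b that by (simp add: sum_nonneg)
  have A0: "0 \<le> A'" and B'0: "0 \<le> B'" using a0 b0 A' B' by (auto intro: sum_nonneg)
  have le: "B u v \<le> b u" "b u \<le> B'" "M u v \<le> a u" "a u \<le> A'" if "u \<in> V" "v \<in> V" for u v
  proof -
    show "B u v \<le> b u" unfolding b[OF that(1)] using that fin B0 by (intro member_le_sum) auto
    show "M u v \<le> a u" unfolding a[OF that(1)] using that fin M(1) by (intro member_le_sum) auto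
    show "b u \<le> B'" unfolding B' using that fin b0 by (intro member_le_sum) auto
    show "a u \<le> A'" unfolding A' using that fin a0 by (intro member_le_sum) auto
  qed
  define x where "x u = b u / a u" for u
  have ax: "a u * x u = b u" if "u \<in> V" for u
  proof (cases "a u = 0")
    case True
    then have "M u v = 0" if "v \<in> V" for v
      using that \<open>u \<in> V\<close> M a[OF \<open>u \<in> V\<close>] fin by (metis sum_nonneg_eq_0_iff)
    then show ?thesis using True B b \<open>u \<in> V\<close> by simp
  qed (simp add: x_def)
  have term': "B u v - A' / B' * (M u v * x u * x v) \<le>
      B u v * ln (B u v / M u v) - B u v * ln (b u / a u) - B u v * ln (b v / a v)
      + B u v * ln (B' / A')" if uv: "u \<in> V" "v \<in> V" for u v
  proof (cases "M u v = 0")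
    case True
    then show ?thesis using B(1)[OF uv] by simp
  next
    case False
    then have p: "0 < M u v" "0 < B u v" using M(1) B(2) uv by fastforce+
    have q: "0 < b u" "0 < a u" "0 < b v" "0 < a v" "0 < B'" "0 < A'"
      using le[of u v] le[of v u] p uv M(2)[of u v] B(3)[of u v] by auto
    define t where "t = (B u v / M u v) * (B' / A') / ((b u / a u) * (b v / a v))"
    have lnt: "ln t = ln (B u v / M u v) - ln (b u / a u) - ln (b v / a v) + ln (B' / A')"
      using p q unfolding t_def by (simp add: ln_div ln_mult_pos)
    have "0 < t" using p q by (simp add: t_def)
    then have "B u v * (1 - 1 / t) \<le> B u v * ln t"
      using p one_minus_inverse_le_ln by (intro mult_left_mono) auto
    moreover have "B u v * (1 - 1 / t) = B u v - A' / B' * (M u v * x u * x v)"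
      using p q by (simp add: t_def x_def field_simps)
    ultimately show ?thesis unfolding lnt by (simp add: algebra_simps)
  qed
  have "B' - A' / B' * (\<Sum>u\<in>V. \<Sum>v\<in>V. M u v * x u * x v)
    = (\<Sum>u\<in>V. \<Sum>v\<in>V. B u v - A' / B' * (M u v * x u * x v))"
    by (simp add: sum_subtractf sum_distrib_left B' b)
  also have "\<dots> \<le> (\<Sum>u\<in>V. \<Sum>v\<in>V. B u v * ln (B u v / M u v) - B u v * ln (b u / a u)
      - B u v * ln (b v / a v) + B u v * ln (B' / A'))"
    by (intro sum_mono term')
  also have "\<dots> = (\<Sum>u\<in>V. \<Sum>v\<in>V. B u v * ln (B u v / M u v)) - (\<Sum>u\<in>V. b u * ln (b u / a u))
      - (\<Sum>u\<in>V. \<Sum>v\<in>V. B u v * ln (b v / a v)) + B' * ln (B' / A')"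
    by (simp add: sum_subtractf sum.distrib sum_distrib_right B' b)
  also have "(\<Sum>u\<in>V. \<Sum>v\<in>V. B u v * ln (b v / a v)) = (\<Sum>u\<in>V. b u * ln (b u / a u))"
    by (subst sum.swap) (simp add: sum_distrib_right b B(3) cong: sum.cong)
  finally have *: "B' - A' / B' * (\<Sum>u\<in>V. \<Sum>v\<in>V. M u v * x u * x v) \<le>
    (\<Sum>u\<in>V. \<Sum>v\<in>V. B u v * ln (B u v / M u v)) - 2 * (\<Sum>u\<in>V. b u * ln (b u / a u))
      + B' * ln (B' / A')" by simp
  have r: "(\<Sum>u\<in>V. \<Sum>v\<in>V. M u v * x u) = B'"
    using a ax by (simp add: sum_distrib_right[symmetric] B')
  have s: "(\<Sum>u\<in>V. \<Sum>v\<in>V. M u v) = A'" using a by (simp add: A')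
  have "(\<Sum>u\<in>V. \<Sum>v\<in>V. M u v * x u * x v) * A' \<le> B'\<^sup>2"
    using L[unfolded lorentzian_def, rule_format, of x] unfolding r s .
  then have "A' / B' * (\<Sum>u\<in>V. \<Sum>v\<in>V. M u v * x u * x v) \<le> B'"
    using B'0 by (cases "B' = 0") (auto simp: field_simps power2_eq_square)
  then show ?thesis using * by linarith
qed

text \<open>Summing \<open>g\<close> over all words of length \<open>r\<close>; if \<open>g\<close> is the weight of full words, this is the
  marginal weight of a prefix with \<open>r\<close> letters to come.\<close>

primrec lev :: "'v set \<Rightarrow> ('v \<Rightarrow> 'x \<Rightarrow> 'x) \<Rightarrow> ('x \<Rightarrow> real) \<Rightarrow> nat \<Rightarrow> 'x \<Rightarrow> real" where
  "lev V st g 0 x = g x"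
| "lev V st g (Suc r) x = (\<Sum>v\<in>V. lev V st g r (st v x))"

lemma lev_lev: "lev V st (lev V st g s) r x = lev V st g (r + s) x"
  by (induction r arbitrary: x) simp_all

lemma lev_sum: "lev V st (\<lambda>y. \<Sum>v\<in>V. g (st v y)) r x = lev V st g (Suc r) x"
proof -
  have "(\<lambda>y. \<Sum>v\<in>V. g (st v y)) = lev V st g 1" by (simp add: fun_eq_iff)
  then show ?thesis using lev_lev[of V st g 1 r x] by simp
qed

lemma lev_add_fun: "lev V st (\<lambda>y. g y + h y) r x = lev V st g r x + lev V st h r x"
  by (induction r arbitrary: x) (simp_all add: sum.distrib)

lemma lev_cmult: "lev V st (\<lambda>y. c * g y) r x = c * lev V st g r x"
  by (induction r arbitrary: x) (simp_all add: sum_distrib_left)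

lemma lev_diff: "lev V st (\<lambda>y. g y - h y) r x = lev V st g r x - lev V st h r x"
  by (induction r arbitrary: x) (simp_all add: sum_subtractf)

lemma lev_mono:
  assumes "\<And>v x. v \<in> V \<Longrightarrow> x \<in> X \<Longrightarrow> st v x \<in> X" and "\<And>x. x \<in> X \<Longrightarrow> g x \<le> h x" and "x \<in> X"
  shows "lev V st g r x \<le> lev V st h r x"
  using assms(3) by (induction r arbitrary: x) (auto intro!: sum_mono simp: assms(1,2))

lemma convex_sequence_diff_le:
  fixes G :: "nat \<Rightarrow> real"
  assumes conv: "\<And>j. j + 2 \<le> N \<Longrightarrow> 0 \<le> G (j + 2) - 2 * G (j + 1) + G j" and N: "N = Suc k"
  shows "G N - G 0 \<le> N * (G N - G k)"
proof -
  have step: "G (Suc j) - G j \<le> G N - G k" if "j \<le> k" for j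
    using that
  proof (induction rule: inc_induct)
    case base
    then show ?case by (simp add: N)
  next
    case (step j)
    then show ?case using conv[of j] N by simp
  qed
  have "G N - G 0 = (\<Sum>j<N. G (Suc j) - G j)"
    by (simp add: sum_lessThan_telescope)
  also have "\<dots> \<le> (\<Sum>j<N. G N - G k)" using step N by (intro sum_mono) auto
  finally show ?thesis by simp
qed

text \<open>The Bregman divergence of \<open>x ln x\<close>.\<close>

definition phi_div :: "real \<Rightarrow> real \<Rightarrow> real" where
  "phi_div a b = a * ln (a / b) - a + b"

text \<open>Commuting letters make the weights of three-letter continuations symmetric tensors.
  Weight 0 marks a dead state; the letter \<open>o'\<close> never kills a live one and plays the
  common neighbour of \<open>lorentzian_sum\<close>. The Lorentzian condition is assumed in
  \<open>top\<close> for the last stage only.\<close>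

locale commuting_steps =
  fixes V :: "'v set" and st :: "'v \<Rightarrow> 'x \<Rightarrow> 'x" and X :: "'x set" and w :: "'x \<Rightarrow> real" and o' :: 'v
  assumes fin: "finite V"
    and closed: "\<And>v x. v \<in> V \<Longrightarrow> x \<in> X \<Longrightarrow> st v x \<in> X"
    and comm: "\<And>u v x. u \<in> V \<Longrightarrow> v \<in> V \<Longrightarrow> st u (st v x) = st v (st u x)"
    and w_nonneg: "\<And>x. 0 \<le> w x"
    and w_dead: "\<And>v x. v \<in> V \<Longrightarrow> w x = 0 \<Longrightarrow> w (st v x) = 0"
    and o_in: "o' \<in> V"
    and w_o: "\<And>x. 0 < w x \<Longrightarrow> 0 < w (st o' x)"
    and top: "\<And>x. x \<in> X \<Longrightarrow> lorentzian V (\<lambda>u v. w (st u (st v x)))"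
begin

lemma lev_pos:
  assumes "\<And>x. 0 < w x \<Longrightarrow> 0 < g x" "\<And>x. w x = 0 \<Longrightarrow> g x = 0"
  shows "(0 < w x \<longrightarrow> 0 < lev V st g r x) \<and> (w x = 0 \<longrightarrow> lev V st g r x = 0)"
proof (induction r arbitrary: x)
  case 0
  then show ?case using assms by simp
next
  case (Suc r)
  have "0 \<le> lev V st g r (st v x)" for v
    using Suc[of "st v x"] w_nonneg[of "st v x"] by fastforce
  then have "0 < lev V st g (Suc r) x" if "0 < w x"
    using Suc[of "st o' x"] w_o[OF that] fin o_in by (auto intro!: sum_pos2[of V o'])
  moreover have "lev V st g (Suc r) x = 0" if "w x = 0"
    using Suc w_dead that by (simp add: sum.neutral)
  ultimately show ?case by blast
qed

text \<open>Trickle-down by induction on the number of letters to come: the slice at letter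
  \<open>z\<close> is the corresponding matrix at the state \<open>st z x\<close>, which the
  induction hypothesis covers. A positive triple containing \<open>u\<close> makes
  \<open>st u x\<close> alive, and \<open>o'\<close> may then be appended repeatedly.\<close>

lemma lorentzian_lev: "x \<in> X \<Longrightarrow> lorentzian V (\<lambda>u v. lev V st w r (st u (st v x)))"
proof (induction r arbitrary: x)
  case 0
  then show ?case using top by simp
next
  case (Suc r)
  have nn: "0 \<le> lev V st w r x" for x
    using lev_pos[of w x r] w_nonneg[of x] by fastforce
  have pos: "0 < w x \<longleftrightarrow> 0 < lev V st w r x" for x
    using lev_pos[of w x r] w_nonneg[of x] by fastforce
  have "lorentzian V (\<lambda>u v. \<Sum>z\<in>V. lev V st w r (st z (st u (st v x))))"
  proof (rule lorentzian_sum[OF fin nn _ _ o_in])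
    fix u v z assume uvz: "u \<in> V" "v \<in> V" "z \<in> V"
    show "lev V st w r (st u (st v (st z x))) = lev V st w r (st v (st u (st z x)))"
      using uvz comm by simp
    show "lev V st w r (st u (st v (st z x))) = lev V st w r (st u (st z (st v x)))"
      using uvz comm by simp
    assume "0 < lev V st w r (st u (st v (st z x)))"
    then have "0 < w (st u (st v (st z x)))" by (simp add: pos)
    then have "0 < w (st v (st z (st u x)))" using uvz comm by simp
    then have "0 < w (st u x)"
      using w_dead[OF uvz(2), of "st z (st u x)"] w_dead[OF uvz(3), of "st u x"] w_nonneg
      by (metis order_less_le)
    then have "0 < w (st o' (st u (st o' x)))" if "w (st o' x) \<noteq> 0"
      using w_o w_nonneg[of "st o' x"] that
      by (metis comm o_in uvz(1))
    moreover have "w (st o' (st u x)) = 0" if "w (st o' x) = 0"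
      using that w_dead[OF uvz(1), of "st o' x"] comm[OF o_in uvz(1), of x] by simp
    ultimately have "0 < w (st o' (st u (st o' x)))"
      using w_o[OF \<open>0 < w (st u x)\<close>] by fastforce
    then show "\<exists>z\<in>V. 0 < lev V st w r (st z (st u (st o' x)))"
      using o_in pos by blast
  next
    fix z assume z: "z \<in> V"
    have "lev V st w r (st z (st u (st v x))) = lev V st w r (st u (st v (st z x)))"
      if "u \<in> V" "v \<in> V" for u v
      using z that comm by metis
    then show "lorentzian V (\<lambda>u v. lev V st w r (st z (st u (st v x))))"
      using Suc.IH[OF closed[OF z Suc.prems]] unfolding lorentzian_def by simp
  qed
  then show ?case by simp
qed

context
  fixes f b :: "'x \<Rightarrow> real"
  assumes f_pos: "\<And>x. 0 < f x"
  defines "b \<equiv> \<lambda>x. w x * f x"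
begin

definition "H r x = lev V st b r x * ln (lev V st b r x / lev V st w r x)"

lemma b_lev_pos: "(0 < w x \<longrightarrow> 0 < lev V st b r x) \<and> (w x = 0 \<longrightarrow> lev V st b r x = 0)"
  by (rule lev_pos) (simp_all add: b_def f_pos)

lemma w_lev_pos: "(0 < w x \<longrightarrow> 0 < lev V st w r x) \<and> (w x = 0 \<longrightarrow> lev V st w r x = 0)"
  by (rule lev_pos) simp_all

text \<open>\<open>H r\<close> is the entropy density of a state with \<open>r\<close> letters to come.\<close>

lemma entropy_second_difference:
  assumes x: "x \<in> X"
  shows "0 \<le> (\<Sum>u\<in>V. \<Sum>v\<in>V. H r (st v (st u x))) - 2 * (\<Sum>u\<in>V. H (Suc r) (st u x)) + H (Suc (Suc r)) x"
proof -
  have dich: "w y = 0 \<or> 0 < w y" for y using w_nonneg[of y] by fastforce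
  show ?thesis
    unfolding H_def
  proof (rule lorentzian_entropy[OF fin])
    fix u v assume uv: "u \<in> V" "v \<in> V"
    show "0 \<le> lev V st w r (st v (st u x))"
      using w_lev_pos[of "st v (st u x)" r] dich[of "st v (st u x)"] by auto
    show "lev V st w r (st v (st u x)) = 0 \<Longrightarrow> lev V st b r (st v (st u x)) = 0"
      using w_lev_pos[of "st v (st u x)" r] b_lev_pos[of "st v (st u x)" r] dich[of "st v (st u x)"] by auto
    show "0 < lev V st w r (st v (st u x)) \<Longrightarrow> 0 < lev V st b r (st v (st u x))"
      using w_lev_pos[of "st v (st u x)" r] b_lev_pos[of "st v (st u x)" r] dich[of "st v (st u x)"] by auto
    show "lev V st w r (st v (st u x)) = lev V st w r (st u (st v x))"
      "lev V st b r (st v (st u x)) = lev V st b r (st u (st v x))"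
      using comm uv by simp_all
  next
    show "lorentzian V (\<lambda>u v. lev V st w r (st v (st u x)))"
      using lorentzian_lev[OF x, of r] comm unfolding lorentzian_def by (simp cong: sum.cong)
  qed simp_all
qed

text \<open>Convexity in time bounds the total entropy by \<open>Suc k\<close> times the last
  increment. That increment is a divergence from the conditional mean, which any other reference
  value can only increase; \<open>f (st o' y)\<close> is the one taken.\<close>

lemma entropy_le_last_level:
  assumes x: "x \<in> X"
  shows "lev V st (\<lambda>y. b y * ln (f y)) (Suc k) x
      - lev V st b (Suc k) x * ln (lev V st b (Suc k) x / lev V st w (Suc k) x)
    \<le> real (Suc k) * lev V st (\<lambda>y. \<Sum>v\<in>V. w (st v y) * phi_div (f (st v y)) (f (st o' y))) k x"
proof -
  \<comment> \<open>\<open>G j\<close> is the entropy visible after \<open>j\<close> of the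
    \<open>Suc k\<close> letters: \<open>G 0\<close> sees only the total mean,
    \<open>G (Suc k)\<close> all of \<open>f\<close>.\<close>
  define G where "G j = lev V st (H (Suc k - j)) j x" for j
  have "0 \<le> G (j + 2) - 2 * G (j + 1) + G j" if j: "j + 2 \<le> Suc k" for j
  proof -
    define r where "r = Suc k - (j + 2)"
    have r: "Suc k - (j + 2) = r" "Suc k - (j + 1) = Suc r" "Suc k - j = Suc (Suc r)"
      using j by (auto simp: r_def)
    have "G (j + 2) - 2 * G (j + 1) + G j = lev V st (\<lambda>x. (\<Sum>u\<in>V. \<Sum>v\<in>V. H r (st v (st u x)))
        - 2 * (\<Sum>u\<in>V. H (Suc r) (st u x)) + H (Suc (Suc r)) x) j x"
      unfolding G_def r lev_add_fun lev_diff lev_cmult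
      by (simp add: lev_sum[of V st "\<lambda>y. \<Sum>v\<in>V. H r (st v y)"] lev_sum[of V st "H (Suc r)"]
          lev_sum[of V st "H r"])
    also have "\<dots> \<ge> lev V st (\<lambda>x. 0) j x"
      using closed entropy_second_difference x by (intro lev_mono[of V X]) auto
    also have "lev V st (\<lambda>x. 0) j x = 0" using lev_cmult[of V st 0 "\<lambda>x. 0" j x] by simp
    finally show ?thesis .
  qed
  then have "G (Suc k) - G 0 \<le> Suc k * (G (Suc k) - G k)"
    by (rule convex_sequence_diff_le) auto
  moreover have "G 0 = lev V st b (Suc k) x * ln (lev V st b (Suc k) x / lev V st w (Suc k) x)"
    by (simp add: G_def H_def)
  moreover have H0: "H 0 = (\<lambda>y. b y * ln (f y))"
    unfolding H_def fun_eq_iff b_def by simp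
  moreover have "G (Suc k) = lev V st (\<lambda>y. b y * ln (f y)) (Suc k) x"
    unfolding G_def H0[symmetric] by simp
  moreover have "G (Suc k) - G k \<le> lev V st (\<lambda>y. \<Sum>v\<in>V. w (st v y) * phi_div (f (st v y)) (f (st o' y))) k x"
  proof -
    have "G (Suc k) - G k = lev V st (\<lambda>y. (\<Sum>v\<in>V. H 0 (st v y)) - H (Suc 0) y) k x"
      unfolding lev_diff lev_sum by (simp add: G_def)
    also have "\<dots> \<le> lev V st (\<lambda>y. \<Sum>v\<in>V. w (st v y) * phi_div (f (st v y)) (f (st o' y))) k x"
    proof (rule lev_mono[where X = UNIV])
      fix y
      define c where "c = f (st o' y)"
      have c: "0 < c" by (simp add: c_def f_pos)
      define P where "P = (\<Sum>v\<in>V. w (st v y))"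
      define B where "B = (\<Sum>v\<in>V. b (st v y))"
      have "(\<Sum>v\<in>V. w (st v y) * phi_div (f (st v y)) c)
        = (\<Sum>v\<in>V. b (st v y) * ln (f (st v y)) - ln c * b (st v y) - b (st v y) + c * w (st v y))"
        using c f_pos by (intro sum.cong refl) (simp add: phi_div_def b_def ln_div algebra_simps)
      also have "\<dots> = (\<Sum>v\<in>V. H 0 (st v y)) - ln c * B - B + c * P"
        unfolding H0 B_def P_def by (simp add: sum.distrib sum_subtractf sum_distrib_left[symmetric])
      finally have e: "(\<Sum>v\<in>V. w (st v y) * phi_div (f (st v y)) c)
        = (\<Sum>v\<in>V. H 0 (st v y)) - ln c * B - B + c * P" .
      \<comment> \<open>As a function of \<open>c\<close> the left side is largest at the mean
        \<open>c = B / P\<close>, where equality holds.\<close>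
      have "ln c * B + B - c * P \<le> B * ln (B / P)"
      proof (cases "w y = 0")
        case True
        then have "B = 0" "P = 0" using w_dead by (auto simp: B_def P_def b_def)
        then show ?thesis by simp
      next
        case False
        then have y: "0 < w y" using w_nonneg[of y] by simp
        then have BP: "0 < B" "0 < P"
          using b_lev_pos[of y 1] w_lev_pos[of y 1] by (simp_all add: B_def P_def)
        have "B * (1 - 1 / (B / P / c)) \<le> B * ln (B / P / c)"
          using BP c one_minus_inverse_le_ln[of "B / P / c"] by (intro mult_left_mono) auto
        moreover have "B * ln (B / P / c) = B * ln (B / P) - B * ln c"
          using BP c by (simp add: ln_div ln_mult_pos algebra_simps)
        moreover have "B * (1 - 1 / (B / P / c)) = B - c * P" using BP c by (simp add: field_simps)
        ultimately show ?thesis by (simp only: mult.commute)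
      qed
      moreover have "H (Suc 0) y = B * ln (B / P)" by (simp add: H_def B_def P_def)
      ultimately show "(\<Sum>v\<in>V. H 0 (st v y)) - H (Suc 0) y
          \<le> (\<Sum>v\<in>V. w (st v y) * phi_div (f (st v y)) (f (st o' y)))"
        using e unfolding c_def by linarith
    qed auto
    finally show ?thesis .
  qed
  ultimately show ?thesis
    by (smt (verit) mult_left_mono of_nat_0_le_iff)
qed

end

end

section \<open>Random cluster weights of a rank function\<close>

locale rank_function =
  fixes E :: "'a set" and rk :: "'a set \<Rightarrow> int"
  assumes fin_E: "finite E"
    and unit: "\<And>A i. A \<subseteq> E \<Longrightarrow> i \<in> E - A \<Longrightarrow> rk (insert i A) = rk A \<or> rk (insert i A) = rk A + 1"
    and submod: "\<And>A i j. A \<subseteq> E \<Longrightarrow> i \<in> E - A \<Longrightarrow> j \<in> E - A \<Longrightarrow> i \<noteq> j \<Longrightarrow>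
      rk (insert i (insert j A)) + rk A \<le> rk (insert i A) + rk (insert j A)"
begin

text \<open>The rank function of the dual matroid without its additive constant
  \<open>- rk E\<close>, which would only rescale the weights. The locale fixes no value at the
  empty set, so it is closed under this form of duality.\<close>

lemma dual: "rank_function E (\<lambda>A. int (card A) + rk (E - A))"
proof
  fix A i assume A: "A \<subseteq> E" and i: "i \<in> E - A"
  have e: "insert i (E - insert i A) = E - A" using i by auto
  have "E - insert i A \<subseteq> E" "i \<in> E - (E - insert i A)" using i by auto
  from unit[OF this, unfolded e]
  have "rk (E - A) = rk (E - insert i A) \<or> rk (E - A) = rk (E - insert i A) + 1" .
  moreover have "card (insert i A) = Suc (card A)"
    using A i fin_E by (simp add: finite_subset)
  ultimately show "int (card (insert i A)) + rk (E - insert i A) = int (card A) + rk (E - A)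
      \<or> int (card (insert i A)) + rk (E - insert i A) = int (card A) + rk (E - A) + 1"
    by linarith
next
  fix A i j assume A: "A \<subseteq> E" and i: "i \<in> E - A" and j: "j \<in> E - A" and ij: "i \<noteq> j"
  define B where "B = E - insert i (insert j A)"
  have e: "insert i (E - insert i A) = E - A" "insert i B = E - insert j A" "insert j B = E - insert i A"
    using i j ij by (auto simp: B_def)
  have c: "card (insert i A) = Suc (card A)" "card (insert j A) = Suc (card A)"
    "card (insert i (insert j A)) = Suc (Suc (card A))"
    using A i j ij fin_E by (simp_all add: finite_subset)
  have "B \<subseteq> E" "i \<in> E - B" "j \<in> E - B" using i j by (auto simp: B_def)
  from submod[OF this ij, unfolded e]
  show "int (card (insert i (insert j A))) + rk (E - insert i (insert j A)) + (int (card A) + rk (E - A))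
    \<le> int (card (insert i A)) + rk (E - insert i A) + (int (card (insert j A)) + rk (E - insert j A))"
    unfolding c B_def by linarith
qed (rule fin_E)

text \<open>Parallelism of non-loops in the contraction by \<open>A\<close>. The disjunct
  \<open>i = j\<close> makes it reflexive on loops too, so that each loop is a class of its
  own.\<close>

definition parallel :: "'a set \<Rightarrow> 'a \<Rightarrow> 'a \<Rightarrow> bool" where
  "parallel A i j \<longleftrightarrow> i = j \<or> rk (insert i A) = rk A + 1 \<and> rk (insert j A) = rk A + 1
     \<and> rk (insert i (insert j A)) = rk A + 1"

lemma parallel_sym: "parallel A i j \<Longrightarrow> parallel A j i"
  by (auto simp: parallel_def insert_commute)

text \<open>Submodularity over \<open>insert j A\<close> keeps the rank of all three elements over
  \<open>A\<close> at 1; monotonicity passes this down to \<open>i\<close> and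
  \<open>k\<close>.\<close>

lemma parallel_trans:
  assumes A: "A \<subseteq> E" and ijk: "i \<in> E - A" "j \<in> E - A" "k \<in> E - A"
    and p: "parallel A i j" "parallel A j k"
  shows "parallel A i k"
proof (cases "i = j \<or> j = k \<or> i = k")
  case True
  then show ?thesis using p by (auto simp: parallel_def)
next
  case False
  then have r: "rk (insert i A) = rk A + 1" "rk (insert j A) = rk A + 1" "rk (insert k A) = rk A + 1"
    "rk (insert i (insert j A)) = rk A + 1" "rk (insert j (insert k A)) = rk A + 1"
    using p by (auto simp: parallel_def)
  have "rk (insert i (insert k (insert j A))) + rk (insert j A)
      \<le> rk (insert i (insert j A)) + rk (insert k (insert j A))"
    using False A ijk by (intro submod) auto
  moreover have "rk (insert i (insert k A)) \<le> rk (insert j (insert i (insert k A)))"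
    using unit[of "insert i (insert k A)" j] False A ijk by auto
  moreover have "rk (insert k A) \<le> rk (insert i (insert k A))"
    using unit[of "insert k A" i] False A ijk by auto
  ultimately show ?thesis
    using r by (simp add: parallel_def insert_commute)
qed

text \<open>A pair with a loop and a jointly independent pair are both modular over
  \<open>A\<close>; the only failure of modularity is a parallel pair, with defect 1. This is the
  source of the factor \<open>q\<close> between weights.\<close>

lemma rk_insert_insert:
  assumes A: "A \<subseteq> E" and ij: "i \<in> E - A" "j \<in> E - A" "i \<noteq> j"
  shows "rk (insert i (insert j A)) + rk A
    = rk (insert i A) + rk (insert j A) - (if parallel A i j then 1 else 0)"
proof -
  have "rk (insert i (insert j A)) = rk (insert j A) \<or> rk (insert i (insert j A)) = rk (insert j A) + 1"
    using A ij by (intro unit) auto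
  moreover have "rk (insert i (insert j A)) = rk (insert i A) \<or> rk (insert i (insert j A)) = rk (insert i A) + 1"
    using A ij by (subst (1 2) insert_commute, intro unit) auto
  ultimately show ?thesis
    using unit[OF A ij(1)] unit[OF A ij(2)] submod[OF A ij] ij(3) by (auto simp: parallel_def)
qed

end

section \<open>Lorentzian property and entropy bound for the random cluster weights\<close>

definition rc_weight :: "real \<Rightarrow> real \<Rightarrow> ('a set \<Rightarrow> int) \<Rightarrow> 'a set \<Rightarrow> real" where
  "rc_weight q lam rk S = q powi (- rk S) * lam ^ card S"

lemma rc_weight_pos: "0 < q \<Longrightarrow> 0 < lam \<Longrightarrow> 0 < rc_weight q lam rk S"
  by (simp add: rc_weight_def)

text \<open>The double sum equals the sum of the squared class sums, so this is Cauchy-Schwarz over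
  the classes, of which there are at most \<open>card F\<close>.\<close>

lemma square_sum_le_card_times_sum_over_classes:
  fixes z :: "'a \<Rightarrow> real"
  assumes fin: "finite F" and refl: "\<And>i. i \<in> F \<Longrightarrow> R i i"
    and sym: "\<And>i j. i \<in> F \<Longrightarrow> j \<in> F \<Longrightarrow> R i j \<Longrightarrow> R j i"
    and trans: "\<And>i j k. i \<in> F \<Longrightarrow> j \<in> F \<Longrightarrow> k \<in> F \<Longrightarrow> R i j \<Longrightarrow> R j k \<Longrightarrow> R i k"
  shows "(\<Sum>i\<in>F. z i)\<^sup>2 \<le> card F * (\<Sum>i\<in>F. \<Sum>j\<in>F. if R i j then z i * z j else 0)"
proof -
  define c where "c i = {j \<in> F. R i j}" for i
  have R: "R i j \<longleftrightarrow> c j = c i" if "i \<in> F" "j \<in> F" for i j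
    using that refl sym trans unfolding c_def by blast
  define y where "y k = (\<Sum>i\<in>{i \<in> F. c i = k}. z i)" for k
  have s: "(\<Sum>i\<in>F. g i) = (\<Sum>k\<in>c ` F. \<Sum>i\<in>{i \<in> F. c i = k}. g i)" for g :: "'a \<Rightarrow> real"
    using fin by (rule sum.image_gen)
  have "(\<Sum>i\<in>F. z i)\<^sup>2 = (\<Sum>k\<in>c ` F. y k)\<^sup>2" by (simp add: s[of z] y_def)
  also have "\<dots> \<le> card (c ` F) * (\<Sum>k\<in>c ` F. (y k)\<^sup>2)"
    using sum_squared_le_sum_of_squares[of y "c ` F"] by (simp add: mult.commute)
  also have "\<dots> \<le> card F * (\<Sum>k\<in>c ` F. (y k)\<^sup>2)"
    using fin by (intro mult_right_mono sum_nonneg) (auto simp: card_image_le)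
  also have "(\<Sum>k\<in>c ` F. (y k)\<^sup>2) = (\<Sum>i\<in>F. \<Sum>j\<in>F. if R i j then z i * z j else 0)"
  proof -
    have "(\<Sum>j\<in>F. if R i j then z i * z j else 0) = z i * y (c i)" if "i \<in> F" for i
    proof -
      have "(\<Sum>j\<in>F. if R i j then z i * z j else 0) = (\<Sum>j\<in>F. if c j = c i then z i * z j else 0)"
        using that R by (intro sum.cong) auto
      also have "\<dots> = (\<Sum>j\<in>{j \<in> F. c j = c i}. z i * z j)"
        using fin by (simp add: sum.inter_filter)
      finally show ?thesis by (simp add: y_def sum_distrib_left)
    qed
    then have "(\<Sum>i\<in>F. \<Sum>j\<in>F. if R i j then z i * z j else 0) = (\<Sum>i\<in>F. z i * y (c i))" by simp
    also have "\<dots> = (\<Sum>k\<in>c ` F. \<Sum>i\<in>{i \<in> F. c i = k}. z i * y (c i))" by (rule s)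
    also have "\<dots> = (\<Sum>k\<in>c ` F. \<Sum>i\<in>{i \<in> F. c i = k}. z i * y k)" by (intro sum.cong) auto
    also have "\<dots> = (\<Sum>k\<in>c ` F. (y k)\<^sup>2)"
      by (simp add: sum_distrib_right[symmetric] y_def power2_eq_square)
    finally show ?thesis ..
  qed
  finally show ?thesis .
qed

text \<open>The state \<open>None\<close> is reached when an element is repeated and has weight \<open>0\<close>; the letter \<open>None\<close>
  reveals nothing.\<close>

primrec add_elem :: "'a option \<Rightarrow> 'a set option \<Rightarrow> 'a set option" where
  "add_elem None y = y"
| "add_elem (Some i) y = (case y of None \<Rightarrow> None | Some A \<Rightarrow> if i \<in> A then None else Some (insert i A))"

lemma sum_option:
  "finite E \<Longrightarrow> (\<Sum>v\<in>insert None (Some ` E). g v) = g None + (\<Sum>i\<in>E. g (Some i) :: real)"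
  by (simp add: sum.reindex)

lemma lev_add_elem_None: "g None = 0 \<Longrightarrow> lev V add_elem g r None = 0"
proof (induction r)
  case (Suc r)
  have "add_elem v None = None" for v :: "'a option" by (cases v) auto
  then show ?case using Suc by simp
qed simp

text \<open>A word of length \<open>r\<close> leads from \<open>A\<close> to \<open>S\<close> when
  \<open>card (S - A)\<close> of its positions spell the new elements in some order and all others
  are \<open>None\<close>. The factor counts these words.\<close>

lemma lev_add_elem:
  fixes g :: "'a set option \<Rightarrow> real"
  assumes fin: "finite E" and g: "g None = 0" and A: "A \<subseteq> E"
  shows "lev (insert None (Some ` E)) add_elem g r (Some A) =
    (\<Sum>S\<in>{S. A \<subseteq> S \<and> S \<subseteq> E}. g (Some S) * (fact (card (S - A)) * real (r choose card (S - A))))"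
  using A
proof (induction r arbitrary: A)
  case 0
  have f: "finite {S. A \<subseteq> S \<and> S \<subseteq> E}" using fin by auto
  have "(\<Sum>S\<in>{S. A \<subseteq> S \<and> S \<subseteq> E}. g (Some S) * (fact (card (S - A)) * real (0 choose card (S - A))))
    = (\<Sum>S\<in>{A}. g (Some S) * (fact (card (S - A)) * real (0 choose card (S - A))))"
  proof (rule sum.mono_neutral_right[OF f])
    show "\<forall>S\<in>{S. A \<subseteq> S \<and> S \<subseteq> E} - {A}. g (Some S) * (fact (card (S - A)) * real (0 choose card (S - A))) = 0"
    proof
      fix S assume S: "S \<in> {S. A \<subseteq> S \<and> S \<subseteq> E} - {A}"
      then have "finite (S - A)" "S - A \<noteq> {}" using finite_subset[OF _ fin, of S] by auto
      then have "0 < card (S - A)" by (simp add: card_gt_0_iff)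
      then show "g (Some S) * (fact (card (S - A)) * real (0 choose card (S - A))) = 0"
        by (simp add: binomial_eq_0)
    qed
  qed (use 0 in auto)
  then show ?case by simp
next
  case (Suc r)
  let ?I = "\<lambda>A. {S. A \<subseteq> S \<and> S \<subseteq> E}"
  let ?c = "\<lambda>r d. fact d * real (r choose d)"
  have fI: "finite (?I A)" using fin by auto
  have "(\<Sum>i\<in>E. lev (insert None (Some ` E)) add_elem g r (add_elem (Some i) (Some A)))
    = (\<Sum>i\<in>E. \<Sum>S\<in>?I A. if i \<in> S - A then g (Some S) * ?c r (card (S - A) - 1) else 0)"
  proof (rule sum.cong[OF refl])
    fix i assume i: "i \<in> E"
    show "lev (insert None (Some ` E)) add_elem g r (add_elem (Some i) (Some A))
      = (\<Sum>S\<in>?I A. if i \<in> S - A then g (Some S) * ?c r (card (S - A) - 1) else 0)"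
    proof (cases "i \<in> A")
      case True
      then show ?thesis by (simp add: lev_add_elem_None[of g, OF g])
    next
      case False
      have "lev (insert None (Some ` E)) add_elem g r (add_elem (Some i) (Some A))
        = (\<Sum>S\<in>?I (insert i A). g (Some S) * ?c r (card (S - insert i A)))"
        using Suc.IH[of "insert i A"] Suc.prems i False by simp
      also have "?I (insert i A) = {S \<in> ?I A. i \<in> S}" by auto
      also have "(\<Sum>S\<in>{S \<in> ?I A. i \<in> S}. g (Some S) * ?c r (card (S - insert i A)))
        = (\<Sum>S\<in>?I A. if i \<in> S then g (Some S) * ?c r (card (S - insert i A)) else 0)"
        by (rule sum.inter_filter[OF fI])
      also have "\<dots> = (\<Sum>S\<in>?I A. if i \<in> S - A then g (Some S) * ?c r (card (S - A) - 1) else 0)"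
      proof (rule sum.cong[OF refl])
        fix S assume "S \<in> ?I A"
        have "i \<in> S \<Longrightarrow> card (S - insert i A) = card (S - A) - 1"
          using False by (metis Diff_iff Diff_insert card_Diff_singleton)
        then show "(if i \<in> S then g (Some S) * ?c r (card (S - insert i A)) else 0)
          = (if i \<in> S - A then g (Some S) * ?c r (card (S - A) - 1) else 0)"
          using False by auto
      qed
      finally show ?thesis .
    qed
  qed
  also have "\<dots> = (\<Sum>S\<in>?I A. \<Sum>i\<in>E. if i \<in> S - A then g (Some S) * ?c r (card (S - A) - 1) else 0)"
    by (rule sum.swap)
  also have "\<dots> = (\<Sum>S\<in>?I A. card (S - A) * (g (Some S) * ?c r (card (S - A) - 1)))"
  proof (rule sum.cong[OF refl])
    fix S assume S: "S \<in> ?I A"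
    then have "{i \<in> E. i \<in> S - A} = S - A" by auto
    then show "(\<Sum>i\<in>E. if i \<in> S - A then g (Some S) * ?c r (card (S - A) - 1) else 0)
      = card (S - A) * (g (Some S) * ?c r (card (S - A) - 1))"
      using fin sum.inter_filter[OF fin, of "\<lambda>i. g (Some S) * ?c r (card (S - A) - 1)" "\<lambda>i. i \<in> S - A"]
      by simp
  qed
  finally have "lev (insert None (Some ` E)) add_elem g (Suc r) (Some A) =
     (\<Sum>S\<in>?I A. g (Some S) * ?c r (card (S - A)))
     + (\<Sum>S\<in>?I A. card (S - A) * (g (Some S) * ?c r (card (S - A) - 1)))"
    using Suc.IH[OF Suc.prems] by (simp only: lev.simps sum_option[OF fin] add_elem.simps(1))
  also have "\<dots> = (\<Sum>S\<in>?I A. g (Some S) * ?c (Suc r) (card (S - A)))"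
    unfolding sum.distrib[symmetric]
  proof (rule sum.cong[OF refl])
    fix S
    show "g (Some S) * ?c r (card (S - A)) + card (S - A) * (g (Some S) * ?c r (card (S - A) - 1))
      = g (Some S) * ?c (Suc r) (card (S - A))"
      by (cases "card (S - A)") (simp_all add: algebra_simps)
  qed
  finally show ?case .
qed

context rank_function
begin

context
  fixes q lam :: real
  assumes q: "0 < q" "q \<le> 1" and lam: "0 < lam"
begin

lemma rc_weight_insert_insert:
  assumes A: "A \<subseteq> E" and ij: "i \<in> E - A" "j \<in> E - A" "i \<noteq> j"
  shows "rc_weight q lam rk (insert i (insert j A)) * rc_weight q lam rk A
    = rc_weight q lam rk (insert i A) * rc_weight q lam rk (insert j A) * (if parallel A i j then q else 1)"
proof -
  have c: "card (insert i A) = Suc (card A)" "card (insert j A) = Suc (card A)"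
    "card (insert i (insert j A)) = Suc (Suc (card A))"
    using A ij fin_E by (simp_all add: finite_subset)
  have "q powi (- rk (insert i (insert j A))) * q powi (- rk A)
    = q powi (- rk (insert i A)) * q powi (- rk (insert j A)) * q powi (if parallel A i j then 1 else 0)"
  proof -
    have q0: "q \<noteq> 0" using q by simp
    have "- rk (insert i (insert j A)) + - rk A
      = - rk (insert i A) + - rk (insert j A) + (if parallel A i j then 1 else 0)"
      using rk_insert_insert[OF A ij] by simp
    then show ?thesis by (simp only: power_int_add[OF disjI1[OF q0], symmetric])
  qed
  then show ?thesis
    by (auto simp: rc_weight_def c)
qed

text \<open>The weights are the coefficients of a homogeneous polynomial of degree \<open>card E + 2\<close>, in which
  the \<open>None\<close> letter is the homogenising variable; this is the condition on its quadratic derivatives.\<close>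

lemma lorentzian_rc_weight:
  assumes A: "A \<subseteq> E" and N: "N = card E + 2"
  defines "t \<equiv> \<lambda>y. case y of None \<Rightarrow> 0 | Some A \<Rightarrow> rc_weight q lam rk A * fact (N - card A)"
  shows "lorentzian (insert None (Some ` E)) (\<lambda>u v. t (add_elem u (add_elem v (Some A))))"
    (is "lorentzian ?V ?M")
proof (rule lorentzianI)
  show "?M u v = ?M v u" for u v by (cases u; cases v) (auto simp: insert_commute)
  show "0 \<le> (\<Sum>u\<in>?V. \<Sum>v\<in>?V. ?M u v)"
    by (intro sum_nonneg) (auto simp: t_def less_imp_le[OF rc_weight_pos[OF q(1) lam]] split: option.split)
  fix x :: "'a option \<Rightarrow> real"
  define w where "w = rc_weight q lam rk"
  have w: "0 < w S" for S unfolding w_def by (rule rc_weight_pos[OF q(1) lam])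
  define F where "F = E - A"
  have F: "finite F" using fin_E by (simp add: F_def)
  \<comment> \<open>The number of letters still to come. The length \<open>card E + 2\<close> keeps
    it at least 2 even for \<open>A = E\<close>, so two letters can be drawn; it also dominates the
    number of parallel classes.\<close>
  define m where "m = N - card A"
  have cA: "card A \<le> card E" using A fin_E by (rule card_mono[rotated])
  then have m: "2 \<le> m" "card F \<le> m" using A fin_E by (auto simp: m_def F_def N card_Diff_subset finite_subset)
  \<comment> \<open>The shift puts \<open>y = x - s\<close> into the kernel of the row of
    \<open>None\<close>, which applied to \<open>y\<close> is \<open>m * y None + Z\<close> up to
    the factor \<open>w A * fact (m - 1)\<close>.\<close>
  define s where "s = (m * x None + (\<Sum>i\<in>F. w (insert i A) / w A * x (Some i)))
      / (m + (\<Sum>i\<in>F. w (insert i A) / w A))"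
  define y where "y = (\<lambda>u. x u - s)"
  define z where "z i = w (insert i A) / w A * y (Some i)" for i
  define Z where "Z = (\<Sum>i\<in>F. z i)"
  have l: "m * y None + Z = 0"
  proof -
    have "Z = (\<Sum>i\<in>F. w (insert i A) / w A * x (Some i)) - s * (\<Sum>i\<in>F. w (insert i A) / w A)"
      unfolding Z_def z_def y_def right_diff_distrib sum_subtractf sum_distrib_left
      by (simp add: mult_ac)
    then have "m * y None + Z = m * x None + (\<Sum>i\<in>F. w (insert i A) / w A * x (Some i))
        - s * (m + (\<Sum>i\<in>F. w (insert i A) / w A))"
      by (simp add: y_def algebra_simps)
    moreover have "0 < m + (\<Sum>i\<in>F. w (insert i A) / w A)"
      using m w by (intro add_pos_nonneg sum_nonneg) (auto simp: less_imp_le)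
    ultimately show ?thesis by (simp add: s_def)
  qed
  define W where "W = (\<Sum>i\<in>F. \<Sum>j\<in>F. if i = j then 0 else z i * z j * (if parallel A i j then q else 1))"
  \<comment> \<open>After eliminating \<open>y None = - Z / m\<close>, the terms involving
    \<open>None\<close> contribute exactly \<open>- (Z^2 - Z^2 / m)\<close>, so this bound is what
    is needed. \<open>W\<close> is \<open>Z^2\<close> minus a convex combination, with weights
    \<open>q\<close> and \<open>1 - q\<close>, of the sum over singletons and the sum over parallel
    classes; Cauchy-Schwarz bounds each below by \<open>Z^2 / m\<close>.\<close>
  have W: "W \<le> Z\<^sup>2 - Z\<^sup>2 / m"
  proof -
    have ZZ: "Z\<^sup>2 = (\<Sum>i\<in>F. \<Sum>j\<in>F. z i * z j)"
      by (simp add: Z_def power2_eq_square sum_product)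
    have d: "(\<Sum>i\<in>F. (z i)\<^sup>2) = (\<Sum>i\<in>F. \<Sum>j\<in>F. if i = j then z i * z j else 0)"
      using F by (simp add: power2_eq_square)
    define P where "P = (\<Sum>i\<in>F. \<Sum>j\<in>F. if parallel A i j then z i * z j else 0)"
    have "W = Z\<^sup>2 - q * (\<Sum>i\<in>F. (z i)\<^sup>2)
        - (1 - q) * P"
      unfolding W_def ZZ d P_def sum_distrib_left sum_subtractf[symmetric]
      by (intro sum.cong refl) (auto simp: algebra_simps parallel_def)
    moreover have "Z\<^sup>2 / m \<le> (\<Sum>i\<in>F. (z i)\<^sup>2)"
    proof -
      have "Z\<^sup>2 \<le> (\<Sum>i\<in>F. (z i)\<^sup>2) * card F"
        unfolding Z_def by (rule sum_squared_le_sum_of_squares)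
      also have "\<dots> \<le> (\<Sum>i\<in>F. (z i)\<^sup>2) * m"
        using m by (intro mult_left_mono sum_nonneg) auto
      finally show ?thesis using m by (simp add: pos_divide_le_eq)
    qed
    moreover have "Z\<^sup>2 / m \<le> P"
    proof -
      have ZP: "Z\<^sup>2 \<le> card F * P"
        unfolding Z_def P_def
      proof (rule square_sum_le_card_times_sum_over_classes[OF F])
        show "parallel A i i" for i by (simp add: parallel_def)
        show "parallel A i j \<Longrightarrow> parallel A j i" for i j by (rule parallel_sym)
        show "i \<in> F \<Longrightarrow> j \<in> F \<Longrightarrow> k \<in> F \<Longrightarrow> parallel A i j \<Longrightarrow> parallel A j k \<Longrightarrow> parallel A i k" for i j k
          unfolding F_def by (rule parallel_trans[OF A])
      qed
      then have "0 \<le> real (card F) * P" by (rule order_trans[rotated]) simp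
      then have "0 \<le> P" using F by (cases "F = {}") (auto simp: zero_le_mult_iff P_def card_gt_0_iff)
      then have "card F * P \<le> m * P" using m by (intro mult_right_mono) auto
      then show ?thesis using ZP m by (simp add: pos_divide_le_eq mult.commute)
    qed
    then have "(1 - q) * (Z\<^sup>2 / m) \<le> (1 - q) * P" using q by (intro mult_left_mono) auto
    moreover have "q * (Z\<^sup>2 / m) \<le> q * (\<Sum>i\<in>F. (z i)\<^sup>2)"
      using q calculation(2) by (intro mult_left_mono) auto
    moreover have "Z\<^sup>2 / m = (1 - q) * (Z\<^sup>2 / m) + q * (Z\<^sup>2 / m)"
      by (simp add: left_diff_distrib diff_divide_distrib)
    ultimately show ?thesis by linarith
  qed
  have cards: "card (insert i A) = Suc (card A)" "i \<noteq> j \<Longrightarrow> card (insert i (insert j A)) = Suc (Suc (card A))"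
    if "i \<in> F" "j \<in> F" for i j
    using that A fin_E by (simp_all add: F_def finite_subset)
  have s1: "(\<Sum>i\<in>E. ?M None (Some i) * y None * y (Some i)) = w A * fact (m - 1) * y None * Z"
  proof -
    have "(\<Sum>i\<in>E. ?M None (Some i) * y None * y (Some i)) = (\<Sum>i\<in>F. ?M None (Some i) * y None * y (Some i))"
      using fin_E by (intro sum.mono_neutral_right) (auto simp: F_def t_def)
    also have "\<dots> = (\<Sum>i\<in>F. w A * fact (m - 1) * y None * z i)"
      using w[of A] cards
      by (intro sum.cong refl) (auto simp: F_def t_def z_def w_def[symmetric] m_def field_simps)
    finally show ?thesis by (simp add: Z_def sum_distrib_left)
  qed
  have s2: "(\<Sum>i\<in>E. \<Sum>j\<in>E. ?M (Some i) (Some j) * y (Some i) * y (Some j)) = w A * fact (m - 2) * W"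
  proof -
    have "(\<Sum>i\<in>E. \<Sum>j\<in>E. ?M (Some i) (Some j) * y (Some i) * y (Some j))
      = (\<Sum>i\<in>F. \<Sum>j\<in>E. ?M (Some i) (Some j) * y (Some i) * y (Some j))"
      using fin_E by (intro sum.mono_neutral_right) (auto simp: F_def t_def intro!: sum.neutral split: if_splits)
    also have "\<dots> = (\<Sum>i\<in>F. \<Sum>j\<in>F. ?M (Some i) (Some j) * y (Some i) * y (Some j))"
      using fin_E by (intro sum.cong refl sum.mono_neutral_right) (auto simp: F_def t_def)
    also have "\<dots> = (\<Sum>i\<in>F. \<Sum>j\<in>F. w A * fact (m - 2) *
        (if i = j then 0 else z i * z j * (if parallel A i j then q else 1)))"
    proof (intro sum.cong refl)
      fix i j assume ij: "i \<in> F" "j \<in> F"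
      show "?M (Some i) (Some j) * y (Some i) * y (Some j) = w A * fact (m - 2) *
        (if i = j then 0 else z i * z j * (if parallel A i j then q else 1))"
      proof (cases "i = j")
        case True
        then show ?thesis by (auto simp: t_def)
      next
        case False
        define \<theta> where "\<theta> = (if parallel A i j then q else 1)"
        have "w (insert i (insert j A)) = w (insert i A) * w (insert j A) * \<theta> / w A"
          using rc_weight_insert_insert[OF A, of i j] ij False w[of A]
          by (simp add: F_def w_def \<theta>_def field_simps)
        then have "?M (Some i) (Some j) = w (insert i A) * w (insert j A) * \<theta> / w A * fact (m - 2)"
          using ij False cards[OF ij] by (auto simp: t_def F_def w_def m_def)
        then show ?thesis
          using False w[of A] unfolding \<theta>_def[symmetric] by (simp add: z_def field_simps)
      qed
    qed
    finally show ?thesis by (simp add: W_def sum_distrib_left)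
  qed
  have sm: "(\<Sum>i\<in>E. ?M (Some i) None * y (Some i) * y None) = (\<Sum>i\<in>E. ?M None (Some i) * y None * y (Some i))"
    by (intro sum.cong refl) simp
  have m0: "?M None None = w A * fact m" by (simp add: t_def w_def m_def)
  obtain k where k: "m = Suc (Suc k)" using m by (metis add_2_eq_Suc le_Suc_ex)
  have "(\<Sum>u\<in>?V. \<Sum>v\<in>?V. ?M u v * y u * y v) =
     w A * fact m * (y None)\<^sup>2 + 2 * (w A * fact (m - 1) * y None * Z) + w A * fact (m - 2) * W"
    unfolding sum_option[OF fin_E] sum.distrib sm s1 s2 m0 by (simp add: power2_eq_square)
  also have "\<dots> = w A * fact (m - 2) * (m * (m - 1) * (y None)\<^sup>2 + 2 * (m - 1) * y None * Z + W)"
    unfolding k by (simp add: algebra_simps)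
  also have "\<dots> \<le> 0"
  proof -
    have yN: "y None = - Z / m" using l m by (simp add: field_simps)
    have "m * (m - 1) * (y None)\<^sup>2 + 2 * (m - 1) * y None * Z = - (Z\<^sup>2 - Z\<^sup>2 / m)"
      unfolding yN using m by (simp add: field_simps power2_eq_square of_nat_diff)
    then show ?thesis using W w[of A] by (simp add: mult_nonneg_nonpos less_imp_le)
  qed
  finally show "\<exists>s. (\<Sum>u\<in>?V. \<Sum>v\<in>?V. ?M u v * (x u - s) * (x v - s)) \<le> 0"
    unfolding y_def by blast
qed

text \<open>The factor \<open>fact (N - card A)\<close> in the weight cancels the count of words:
  \<open>N\<close>-letter words reaching \<open>S\<close> number
  \<open>fact (card S) * (N choose card S)\<close>, so every set gets total weight
  \<open>fact N * w S\<close>. At level \<open>k = N - 1\<close> the same identity gives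
  \<open>fact k\<close>, and the factor \<open>Suc k\<close> from convexity restores
  \<open>fact N\<close> on the right.\<close>

lemma random_cluster_entropy:
  fixes f :: "'a set \<Rightarrow> real"
  assumes f: "\<And>S. S \<subseteq> E \<Longrightarrow> 0 < f S"
  defines "w \<equiv> rc_weight q lam rk"
  shows "(\<Sum>S\<in>Pow E. w S * (f S * ln (f S)))
      - (\<Sum>S\<in>Pow E. w S * f S) * ln ((\<Sum>S\<in>Pow E. w S * f S) / (\<Sum>S\<in>Pow E. w S))
    \<le> (\<Sum>S\<in>Pow E. \<Sum>i\<in>E - S. w (insert i S) * phi_div (f (insert i S)) (f S))"
proof -
  define N where "N = card E + 2"
  define k where "k = card E + 1"
  have N: "N = Suc k" by (simp add: N_def k_def)
  define t where "t = (\<lambda>y. case y of None \<Rightarrow> 0 | Some A \<Rightarrow> w A * fact (N - card A))"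
  \<comment> \<open>\<open>f\<close> is known to be positive only on subsets of \<open>E\<close>;
    the default 1 makes \<open>h\<close> positive everywhere.\<close>
  define h where "h = (\<lambda>y. case y of None \<Rightarrow> 1 | Some A \<Rightarrow> if A \<subseteq> E then f A else 1)"
  let ?V = "insert None (Some ` E)"
  have w: "0 < w S" for S unfolding w_def by (rule rc_weight_pos[OF q(1) lam])
  interpret commuting_steps ?V add_elem "insert None (Some ` Pow E)" t None
  proof
    show "finite ?V" using fin_E by simp
    show "v \<in> ?V \<Longrightarrow> x \<in> insert None (Some ` Pow E) \<Longrightarrow> add_elem v x \<in> insert None (Some ` Pow E)" for v x
      by (fastforce split: if_splits)
    show "add_elem u (add_elem v x) = add_elem v (add_elem u x)" for u v and x :: "'a set option"
      by (cases u; cases v; cases x) auto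
    show "0 \<le> t x" for x using w by (auto simp: t_def less_imp_le split: option.split)
    have t0: "t x = 0 \<longleftrightarrow> x = None" for x using w by (auto simp: t_def less_le split: option.split)
    show "t x = 0 \<Longrightarrow> t (add_elem v x) = 0" for v x by (cases v) (auto simp: t0)
    show "lorentzian ?V (\<lambda>u v. t (add_elem u (add_elem v x)))" if "x \<in> insert None (Some ` Pow E)" for x
    proof (cases x)
      case None
      have "add_elem v None = None" for v :: "'a option" by (cases v) auto
      then show ?thesis using None by (simp add: lorentzian_def t_def)
    next
      case (Some A)
      then show ?thesis
        using that lorentzian_rc_weight[of A N] unfolding t_def w_def by (auto simp: N_def)
    qed
  qed auto
  have h: "0 < h y" for y using f by (auto simp: h_def split: option.split)
  have top: "lev ?V add_elem (\<lambda>y. t y * g y) (Suc k) (Some {}) = fact N * (\<Sum>S\<in>Pow E. w S * g (Some S))"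
    for g
  proof -
    have "lev ?V add_elem (\<lambda>y. t y * g y) (Suc k) (Some {})
      = (\<Sum>S\<in>Pow E. t (Some S) * g (Some S) * (fact (card S) * real (N choose card S)))"
      by (subst lev_add_elem[OF fin_E]) (simp_all add: t_def Pow_def N)
    also have "\<dots> = (\<Sum>S\<in>Pow E. fact N * (w S * g (Some S)))"
    proof (rule sum.cong[OF refl])
      fix S assume "S \<in> Pow E"
      then have "card S \<le> N" using fin_E card_mono[of E S] by (simp add: N_def)
      from binomial_fact_lemma[OF this]
      have "real (fact (card S) * fact (N - card S) * (N choose card S)) = fact N" by simp
      then have "fact (card S) * fact (N - card S) * real (N choose card S) = fact N" by simp
      then show "t (Some S) * g (Some S) * (fact (card S) * real (N choose card S)) = fact N * (w S * g (Some S))"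
        by (simp add: t_def mult_ac)
    qed
    finally show ?thesis by (simp add: sum_distrib_left)
  qed
  have *: "lev ?V add_elem (\<lambda>y. t y * h y * ln (h y)) (Suc k) (Some {})
      - lev ?V add_elem (\<lambda>y. t y * h y) (Suc k) (Some {})
        * ln (lev ?V add_elem (\<lambda>y. t y * h y) (Suc k) (Some {}) / lev ?V add_elem t (Suc k) (Some {}))
    \<le> real (Suc k) * lev ?V add_elem (\<lambda>y. \<Sum>v\<in>?V. t (add_elem v y)
          * phi_div (h (add_elem v y)) (h (add_elem None y))) k (Some {})"
    by (rule entropy_le_last_level[OF h]) auto
  have R: "real (Suc k) * lev ?V add_elem (\<lambda>y. \<Sum>v\<in>?V. t (add_elem v y)
          * phi_div (h (add_elem v y)) (h (add_elem None y))) k (Some {})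
      = fact N * (\<Sum>S\<in>Pow E. \<Sum>i\<in>E - S. w (insert i S) * phi_div (f (insert i S)) (f S))"
  proof -
    define g where "g = (\<lambda>y. \<Sum>v\<in>?V. t (add_elem v y) * phi_div (h (add_elem v y)) (h (add_elem None y)))"
    have "add_elem v None = None" for v :: "'a option" by (cases v) auto
    then have g0: "g None = 0" by (simp add: g_def t_def)
    have "lev ?V add_elem g k (Some {}) = (\<Sum>S\<in>Pow E. g (Some S) * (fact (card S) * real (k choose card S)))"
      using lev_add_elem[of E g "{}" k, OF fin_E g0] by (simp add: Pow_def)
    also have "\<dots> = (\<Sum>S\<in>Pow E. fact k * (\<Sum>i\<in>E - S. w (insert i S) * phi_div (f (insert i S)) (f S)))"
    proof (rule sum.cong[OF refl])
      fix S assume S: "S \<in> Pow E"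
      then have c: "card S \<le> k" using fin_E card_mono[of E S] by (simp add: k_def)
      \<comment> \<open>The letter \<open>None\<close> leaves the state fixed, so its term is a
        divergence between equal values and vanishes.\<close>
      have "g (Some S) = (\<Sum>i\<in>E. t (add_elem (Some i) (Some S))
          * phi_div (h (add_elem (Some i) (Some S))) (h (Some S)))"
        unfolding g_def sum_option[OF fin_E] using h[of "Some S"] by (simp add: phi_div_def)
      also have "\<dots> = (\<Sum>i\<in>E - S. t (add_elem (Some i) (Some S))
          * phi_div (h (add_elem (Some i) (Some S))) (h (Some S)))"
        using fin_E by (intro sum.mono_neutral_right) (auto simp: t_def)
      also have "\<dots> = (\<Sum>i\<in>E - S. fact (k - card S) * (w (insert i S) * phi_div (f (insert i S)) (f S)))"
      proof (rule sum.cong[OF refl])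
        fix i assume i: "i \<in> E - S"
        then have "card (insert i S) = Suc (card S)" using S fin_E by (simp add: finite_subset)
        then show "t (add_elem (Some i) (Some S)) * phi_div (h (add_elem (Some i) (Some S))) (h (Some S))
          = fact (k - card S) * (w (insert i S) * phi_div (f (insert i S)) (f S))"
          using i S by (simp add: t_def h_def N)
      qed
      finally have "g (Some S) = fact (k - card S) * (\<Sum>i\<in>E - S. w (insert i S) * phi_div (f (insert i S)) (f S))"
        by (simp add: sum_distrib_left)
      moreover from binomial_fact_lemma[OF c]
      have "real (fact (card S) * fact (k - card S) * (k choose card S)) = fact k" by simp
      then have "fact (card S) * fact (k - card S) * real (k choose card S) = fact k" by simp
      ultimately show "g (Some S) * (fact (card S) * real (k choose card S))
          = fact k * (\<Sum>i\<in>E - S. w (insert i S) * phi_div (f (insert i S)) (f S))"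
        by (simp add: mult_ac)
    qed
    finally show ?thesis unfolding g_def[symmetric] by (simp add: sum_distrib_left[symmetric] N)
  qed
  have hf: "(\<Sum>S\<in>Pow E. w S * g S (h (Some S))) = (\<Sum>S\<in>Pow E. w S * g S (f S))" for g :: "'a set \<Rightarrow> real \<Rightarrow> real"
    by (intro sum.cong) (auto simp: h_def)
  have l1: "lev ?V add_elem (\<lambda>y. t y * h y * ln (h y)) (Suc k) (Some {})
      = fact N * (\<Sum>S\<in>Pow E. w S * (f S * ln (f S)))"
    using top[of "\<lambda>y. h y * ln (h y)"] hf[of "\<lambda>S x. x * ln x"] by (simp only: mult.assoc)
  have l2: "lev ?V add_elem (\<lambda>y. t y * h y) (Suc k) (Some {}) = fact N * (\<Sum>S\<in>Pow E. w S * f S)"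
    using top[of h] hf[of "\<lambda>S x. x"] by simp
  have l3: "lev ?V add_elem t (Suc k) (Some {}) = fact N * (\<Sum>S\<in>Pow E. w S)"
    using top[of "\<lambda>_. 1"] by simp
  have "fact N * ((\<Sum>S\<in>Pow E. w S * (f S * ln (f S)))
      - (\<Sum>S\<in>Pow E. w S * f S) * ln ((\<Sum>S\<in>Pow E. w S * f S) / (\<Sum>S\<in>Pow E. w S)))
    \<le> fact N * (\<Sum>S\<in>Pow E. \<Sum>i\<in>E - S. w (insert i S) * phi_div (f (insert i S)) (f S))"
    using * unfolding l1 l2 l3 R by (simp add: right_diff_distrib mult.assoc)
  then show ?thesis by simp
qed

end

end

section \<open>Matroid rank and Glauber dynamics\<close>

context matroid
begin

lemma finite_indep_family: "finite \<I>"
proof -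
  have "\<I> \<subseteq> Pow E" using indep_subset by auto
  then show ?thesis using finite_ground by (meson finite_Pow_iff finite_subset)
qed

lemma finite_rank_set: "finite {card A | A. A \<in> \<I> \<and> A \<subseteq> S}"
  using finite_indep_family by simp

lemma card_le_rank: "A \<in> \<I> \<Longrightarrow> A \<subseteq> S \<Longrightarrow> card A \<le> matroid_rank \<I> S"
  unfolding matroid_rank_def by (rule Max_ge[OF finite_rank_set]) auto

lemma rank_attained: obtains A where "A \<in> \<I>" "A \<subseteq> S" "card A = matroid_rank \<I> S"
proof -
  have "matroid_rank \<I> S \<in> {card A | A. A \<in> \<I> \<and> A \<subseteq> S}"
    unfolding matroid_rank_def using empty_indep by (intro Max_in[OF finite_rank_set]) auto
  then show ?thesis using that by auto
qed

lemma finite_indep: "A \<in> \<I> \<Longrightarrow> finite A"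
  using indep_subset finite_ground finite_subset by blast

lemma rank_mono: "S \<subseteq> T \<Longrightarrow> matroid_rank \<I> S \<le> matroid_rank \<I> T"
  by (metis card_le_rank order_trans rank_attained)

lemma rank_insert_le: "matroid_rank \<I> (insert i S) \<le> Suc (matroid_rank \<I> S)"
proof -
  obtain A where A: "A \<in> \<I>" "A \<subseteq> insert i S" "card A = matroid_rank \<I> (insert i S)"
    by (rule rank_attained)
  have "A - {i} \<in> \<I>" using A indep_down by blast
  then have "card (A - {i}) \<le> matroid_rank \<I> S" using A by (intro card_le_rank) auto
  moreover have "card A \<le> Suc (card (A - {i}))"
    using card_Suc_Diff1[OF finite_indep[OF A(1)], of i] by (cases "i \<in> A") auto
  ultimately show ?thesis using A by simp
qed

lemma indep_extends_to_rank:
  assumes A: "A \<in> \<I>" "A \<subseteq> S"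
  obtains B where "B \<in> \<I>" "A \<subseteq> B" "B \<subseteq> S" "card B = matroid_rank \<I> S"
proof -
  define P where "P B \<longleftrightarrow> B \<in> \<I> \<and> A \<subseteq> B \<and> B \<subseteq> S" for B
  have "P A" using A by (simp add: P_def)
  moreover have "\<forall>B. P B \<longrightarrow> card B < Suc (matroid_rank \<I> S)"
    using card_le_rank by (auto simp: P_def less_Suc_eq_le)
  ultimately have "\<exists>B. P B \<and> (\<forall>C. P C \<longrightarrow> card C \<le> card B)" by (rule ex_has_greatest_nat)
  then obtain B where B: "P B" "\<And>C. P C \<Longrightarrow> card C \<le> card B" by blast
  obtain C where C: "C \<in> \<I>" "C \<subseteq> S" "card C = matroid_rank \<I> S" by (rule rank_attained)
  have "card B = matroid_rank \<I> S"
  proof (rule ccontr)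
    assume "card B \<noteq> matroid_rank \<I> S"
    then have "card B < card C" using B(1) C card_le_rank[of B S] by (auto simp: P_def)
    then obtain x where x: "x \<in> C - B" "insert x B \<in> \<I>"
      using augmentation B(1) C(1) unfolding P_def by blast
    then have "P (insert x B)" using B(1) C by (auto simp: P_def)
    from B(2)[OF this] show False using x B(1) finite_indep by (auto simp: P_def)
  qed
  then show ?thesis using that B(1) by (auto simp: P_def)
qed

text \<open>Extend a maximal independent \<open>A\<close> in \<open>S\<close> to a maximal
  independent \<open>B\<close> in \<open>T\<close>. If \<open>i\<close> raised the rank of
  \<open>T\<close>, augmenting \<open>B\<close> would have to add \<open>i\<close>, making
  \<open>insert i A\<close> independent and raising the rank of \<open>S\<close> as well.\<close>

lemma rank_insert_eq_mono:
  assumes eq: "matroid_rank \<I> (insert i S) = matroid_rank \<I> S" and "S \<subseteq> T"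
  shows "matroid_rank \<I> (insert i T) = matroid_rank \<I> T"
proof (rule ccontr)
  assume neq: "matroid_rank \<I> (insert i T) \<noteq> matroid_rank \<I> T"
  obtain A where A: "A \<in> \<I>" "A \<subseteq> S" "card A = matroid_rank \<I> S" by (rule rank_attained)
  obtain B where B: "B \<in> \<I>" "A \<subseteq> B" "B \<subseteq> T" "card B = matroid_rank \<I> T"
    using indep_extends_to_rank[of A T] A assms(2) by blast
  obtain C where C: "C \<in> \<I>" "C \<subseteq> insert i T" "card C = matroid_rank \<I> (insert i T)"
    by (rule rank_attained)
  have "card B < card C" using B C neq rank_mono[OF subset_insertI[of T i]] by auto
  then obtain x where x: "x \<in> C - B" "insert x B \<in> \<I>" using augmentation B C by blast
  have "x = i"
  proof (rule ccontr)
    assume "x \<noteq> i"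
    then have "card (insert x B) \<le> matroid_rank \<I> T" using x B C by (intro card_le_rank) auto
    then show False using x B finite_indep by auto
  qed
  then have "insert i A \<in> \<I>" using x B indep_down by blast
  then have "card (insert i A) \<le> matroid_rank \<I> (insert i S)" using A by (intro card_le_rank) auto
  moreover have "i \<notin> A" using x B \<open>x = i\<close> by auto
  ultimately show False using A finite_indep eq by auto
qed

lemma rank_function: "rank_function E (\<lambda>S. int (matroid_rank \<I> S))"
proof
  show "finite E" by (rule finite_ground)
  fix A i
  show "int (matroid_rank \<I> (insert i A)) = int (matroid_rank \<I> A) \<or>
      int (matroid_rank \<I> (insert i A)) = int (matroid_rank \<I> A) + 1"
    using rank_insert_le[of i A] rank_mono[OF subset_insertI[of A i]] by auto
next
  fix A i j
  show "int (matroid_rank \<I> (insert i (insert j A))) + int (matroid_rank \<I> A)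
      \<le> int (matroid_rank \<I> (insert i A)) + int (matroid_rank \<I> (insert j A))"
  proof (cases "matroid_rank \<I> (insert i A) = matroid_rank \<I> A")
    case True
    then have "matroid_rank \<I> (insert i (insert j A)) = matroid_rank \<I> (insert j A)"
      by (rule rank_insert_eq_mono) auto
    then show ?thesis using True by simp
  next
    case False
    then show ?thesis
      using rank_insert_le[of i "insert j A"] rank_insert_le[of i A] rank_mono[OF subset_insertI[of A i]] by auto
  qed
qed

end

section \<open>Glauber dynamics on a downward closed family\<close>

lemma expectation_eq_sum:
  "finite (set_pmf p) \<Longrightarrow> measure_pmf.expectation p f = (\<Sum>x\<in>set_pmf p. pmf p x * f x)" for f :: "_ \<Rightarrow> real"
  by (subst integral_measure_pmf_real[of "set_pmf p"]) (auto simp: mult.commute)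

lemma Ent_weighted_pmf:
  assumes X: "finite X" "X \<noteq> {}" "\<And>x. x \<in> X \<Longrightarrow> 0 < w x"
  shows "Ent (weighted_pmf X w) f = ((\<Sum>x\<in>X. w x * (f x * ln (f x)))
      - (\<Sum>x\<in>X. w x * f x) * ln ((\<Sum>x\<in>X. w x * f x) / (\<Sum>x\<in>X. w x))) / (\<Sum>x\<in>X. w x)"
proof -
  have e: "measure_pmf.expectation (weighted_pmf X w) g = (\<Sum>x\<in>X. w x * g x) / sum w X" for g :: "_ \<Rightarrow> real"
    using X by (subst expectation_eq_sum)
      (auto simp: set_pmf_weighted_pmf pmf_weighted_pmf sum_divide_distrib cong: sum.cong)
  show ?thesis by (simp add: Ent_def e diff_divide_distrib)
qed

locale glauber_dynamics =
  fixes E :: "'a set" and \<mu> :: "'a set pmf" and X :: "'a set set"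
  assumes E: "finite E" "E \<noteq> {}" and X: "set_pmf \<mu> = X" "X \<subseteq> Pow E"
    and down: "\<And>S i. S \<in> X \<Longrightarrow> S - {i} \<in> X"
begin

text \<open>Edges in direction \<open>i\<close>, each represented by its lower end.\<close>

definition up :: "'a \<Rightarrow> 'a set set" where
  "up i = {R \<in> X. i \<notin> R \<and> insert i R \<in> X}"

text \<open>The conditional expectation of \<open>g\<close> given all coordinates except
  \<open>i\<close>. In the first branch a state \<open>S\<close> of \<open>X\<close> cannot contain
  \<open>i\<close>, so the update leaves it in place.\<close>

definition resample :: "'a \<Rightarrow> ('a set \<Rightarrow> real) \<Rightarrow> 'a set \<Rightarrow> real" where
  "resample i g S = (if insert i S \<notin> X then g S else
     (pmf \<mu> (S - {i}) * g (S - {i}) + pmf \<mu> (insert i S) * g (insert i S))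
       / (pmf \<mu> (S - {i}) + pmf \<mu> (insert i S)))"

definition conductance :: "'a \<Rightarrow> 'a set \<Rightarrow> real" where
  "conductance i R = pmf \<mu> R * pmf \<mu> (insert i R) / (pmf \<mu> R + pmf \<mu> (insert i R))"

lemma finite_X: "finite X"
  using E X by (meson finite_Pow_iff finite_subset)

lemma pmf_pos: "S \<in> X \<Longrightarrow> 0 < pmf \<mu> S"
  using X by (simp add: pmf_positive)

lemma expectation_glauber:
  assumes S: "S \<in> X"
  shows "measure_pmf.expectation (glauber E \<mu> S) g = (\<Sum>i\<in>E. resample i g S) / card E"
proof -
  define K where "K i = (let S' = S - {i} in
       if S' \<union> {i} \<notin> set_pmf \<mu> then return_pmf S'
       else bind_pmf (bernoulli_pmf (pmf \<mu> (S' \<union> {i}) / (pmf \<mu> S' + pmf \<mu> (S' \<union> {i}))))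
              (\<lambda>b. return_pmf (if b then S' \<union> {i} else S')))" for i
  have fK: "finite (set_pmf (K i))" for i
    by (auto simp: K_def Let_def)
  have K: "measure_pmf.expectation (K i) g = resample i g S" if i: "i \<in> E" for i
  proof (cases "insert i S \<in> X")
    case False
    then have "i \<notin> S" using S by (metis insert_absorb)
    then show ?thesis using False X by (simp add: K_def resample_def)
  next
    case True
    define a b where "a = pmf \<mu> (S - {i})" and "b = pmf \<mu> (insert i S)"
    have ab: "0 < a" "0 < b" using pmf_pos[OF True] pmf_pos[OF down[OF S]] by (auto simp: a_def b_def)
    have "K i = map_pmf (\<lambda>b. if b then insert i S else S - {i}) (bernoulli_pmf (b / (a + b)))"
      using True X by (simp add: K_def map_pmf_def a_def b_def Let_def insert_absorb2 cong: if_cong)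
    then have "measure_pmf.expectation (K i) g = g (insert i S) * (b / (a + b)) + g (S - {i}) * (1 - b / (a + b))"
      using ab by simp
    also have "1 - b / (a + b) = a / (a + b)" using ab by (simp add: field_simps)
    finally show ?thesis using True by (simp add: resample_def a_def b_def add_divide_distrib mult.commute)
  qed
  have "glauber E \<mu> S = bind_pmf (pmf_of_set E) K" by (simp add: glauber_def K_def[abs_def])
  then have "measure_pmf.expectation (glauber E \<mu> S) g
      = (\<Sum>i\<in>E. pmf (pmf_of_set E) i *\<^sub>R measure_pmf.expectation (K i) g)"
    using E fK by (simp add: pmf_expectation_bind)
  then show ?thesis using E K by (simp add: sum_divide_distrib)
qed

text \<open>Sets are matched along direction \<open>i\<close>; the unmatched ones do not contain
  \<open>i\<close>, and \<open>resample i\<close> leaves the values there unchanged.\<close>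

lemma X_decomp:
  assumes i: "i \<in> E"
  shows "(\<Sum>S\<in>X. h S) = (\<Sum>R\<in>up i. h R + h (insert i R)) + (\<Sum>S\<in>{S \<in> X. insert i S \<notin> X}. h S :: real)"
proof -
  have d: "X = up i \<union> insert i ` up i \<union> {S \<in> X. insert i S \<notin> X}"
  proof (intro equalityI subsetI)
    fix S assume S: "S \<in> X"
    show "S \<in> up i \<union> insert i ` up i \<union> {S \<in> X. insert i S \<notin> X}"
    proof (cases "i \<in> S")
      case True
      then have "S - {i} \<in> up i" using down[OF S] S by (simp add: up_def insert_absorb)
      then have "insert i (S - {i}) \<in> insert i ` up i" by (rule imageI)
      then show ?thesis using True by (simp add: insert_absorb)
    qed (use S in \<open>auto simp: up_def\<close>)
  qed (auto simp: up_def)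
  have f: "finite (up i)" using finite_X by (simp add: up_def)
  have inj: "inj_on (insert i) (up i)" by (auto simp: inj_on_def up_def)
  have "sum h X = sum h (up i \<union> insert i ` up i) + sum h {S \<in> X. insert i S \<notin> X}"
    using f finite_X by (subst d, subst sum.union_disjoint) (auto simp: up_def)
  also have "sum h (up i \<union> insert i ` up i) = sum h (up i) + sum h (insert i ` up i)"
    using f by (subst sum.union_disjoint) (auto simp: up_def)
  finally show ?thesis by (simp add: sum.reindex[OF inj] sum.distrib)
qed

lemma dirichlet_form_glauber:
  "dirichlet_form \<mu> (glauber E \<mu>) f g
    = (\<Sum>i\<in>E. \<Sum>R\<in>up i. conductance i R * (f (insert i R) - f R) * (g (insert i R) - g R)) / card E"
proof -
  have cE: "0 < card E" using E by (simp add: card_gt_0_iff)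
  have "dirichlet_form \<mu> (glauber E \<mu>) f g
    = (\<Sum>S\<in>X. \<Sum>i\<in>E. pmf \<mu> S * f S * (g S - resample i g S) / card E)"
    unfolding dirichlet_form_def X(1)
  proof (rule sum.cong[OF refl])
    fix S assume "S \<in> X"
    then show "pmf \<mu> S * f S * (g S - measure_pmf.expectation (glauber E \<mu> S) g)
      = (\<Sum>i\<in>E. pmf \<mu> S * f S * (g S - resample i g S) / card E)"
      using cE by (simp add: expectation_glauber sum_divide_distrib[symmetric]
          sum_distrib_left[symmetric] sum_subtractf field_simps)
  qed
  also have "\<dots> = (\<Sum>i\<in>E. (\<Sum>S\<in>X. pmf \<mu> S * f S * (g S - resample i g S))) / card E"
    by (subst sum.swap) (simp add: sum_divide_distrib)
  also have "(\<Sum>i\<in>E. (\<Sum>S\<in>X. pmf \<mu> S * f S * (g S - resample i g S)))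
    = (\<Sum>i\<in>E. \<Sum>R\<in>up i. conductance i R * (f (insert i R) - f R) * (g (insert i R) - g R))"
  proof (rule sum.cong[OF refl])
    fix i assume i: "i \<in> E"
    have z: "(\<Sum>S\<in>{S \<in> X. insert i S \<notin> X}. pmf \<mu> S * f S * (g S - resample i g S)) = 0"
      by (intro sum.neutral) (auto simp: resample_def)
    have "pmf \<mu> R * f R * (g R - resample i g R)
        + pmf \<mu> (insert i R) * f (insert i R) * (g (insert i R) - resample i g (insert i R))
      = conductance i R * (f (insert i R) - f R) * (g (insert i R) - g R)" if R: "R \<in> up i" for R
    proof -
      have p: "0 < pmf \<mu> R" "0 < pmf \<mu> (insert i R)" using R pmf_pos by (auto simp: up_def)
      have e: "R - {i} = R" "insert i R - {i} = R" "insert i R \<in> X" using R by (auto simp: up_def)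
      show ?thesis
        using p by (simp add: resample_def conductance_def e divide_simps) (simp add: algebra_simps)
    qed
    then show "(\<Sum>S\<in>X. pmf \<mu> S * f S * (g S - resample i g S))
      = (\<Sum>R\<in>up i. conductance i R * (f (insert i R) - f R) * (g (insert i R) - g R))"
      unfolding X_decomp[OF i, of "\<lambda>S. pmf \<mu> S * f S * (g S - resample i g S)"] z by simp
  qed
  finally show ?thesis .
qed

text \<open>Reduces the inequality to single edges: the entropy is charged to edges through
  \<open>d\<close>, and each charge is compared with the matching term of the Dirichlet
  form.\<close>

lemma modified_log_sobolevI:
  assumes k: "0 < k" "\<And>f. (\<And>S. S \<in> X \<Longrightarrow> 0 < f S) \<Longrightarrow> Ent \<mu> f \<le> (\<Sum>i\<in>E. \<Sum>R\<in>up i. d f i R)"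
    and d: "\<And>f i R. (\<And>S. S \<in> X \<Longrightarrow> 0 < f S) \<Longrightarrow> i \<in> E \<Longrightarrow> R \<in> up i \<Longrightarrow>
      k * d f i R \<le> conductance i R * ((f (insert i R) - f R) * (ln (f (insert i R)) - ln (f R)))"
  shows "modified_log_sobolev \<mu> (glauber E \<mu>) (1 / card E * k)"
  unfolding modified_log_sobolev_def
proof (intro allI impI)
  fix f :: "'a set \<Rightarrow> real"
  assume "\<forall>x\<in>set_pmf \<mu>. 0 < f x"
  then have f: "\<And>S. S \<in> X \<Longrightarrow> 0 < f S" by (simp add: X)
  have "k * Ent \<mu> f \<le> k * (\<Sum>i\<in>E. \<Sum>R\<in>up i. d f i R)" using k(1) k(2)[OF f] by simp
  also have "\<dots> = (\<Sum>i\<in>E. \<Sum>R\<in>up i. k * d f i R)" by (simp add: sum_distrib_left)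
  also have "\<dots> \<le> (\<Sum>i\<in>E. \<Sum>R\<in>up i. conductance i R * (f (insert i R) - f R) * (ln (f (insert i R)) - ln (f R)))"
    using d[OF f] by (intro sum_mono) (auto simp: mult.assoc)
  finally show "1 / card E * k * Ent \<mu> f \<le> dirichlet_form \<mu> (glauber E \<mu>) f (\<lambda>x. ln (f x))"
    unfolding dirichlet_form_glauber by (simp add: divide_right_mono)
qed

end

lemma phi_div_le:
  assumes "0 < a" "0 < b" shows "phi_div a b \<le> (a - b) * (ln a - ln b)"
proof -
  have "b * ln (a / b) \<le> b * (a / b - 1)"
    using assms ln_le_minus_one[of "a / b"] by (intro mult_left_mono) auto
  moreover have "b * (a / b - 1) = a - b" using assms by (simp add: field_simps)
  ultimately show ?thesis using assms by (simp add: phi_div_def ln_div left_diff_distrib)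
qed

lemma phi_div_nonneg:
  assumes "0 < a" "0 < b" shows "0 \<le> phi_div a b"
proof -
  have "a * (1 - 1 / (a / b)) \<le> a * ln (a / b)"
    using assms one_minus_inverse_le_ln[of "a / b"] by (intro mult_left_mono) auto
  moreover have "a * (1 - 1 / (a / b)) = a - b" using assms by (simp add: field_simps)
  ultimately show ?thesis by (simp add: phi_div_def)
qed

lemma harmonic_ge:
  assumes "0 < a" "0 < b" "0 < k" "b \<le> k * a"
  shows "1 / (1 + k) * b \<le> a * b / (a + b :: real)"
proof -
  have "b * (a + b) \<le> a * b * (1 + k)"
    using mult_left_mono[OF assms(4), of b] assms by (simp add: algebra_simps)
  then show ?thesis using assms by (simp add: divide_simps)
qed

context glauber_dynamics
begin

lemma sum_up: "(\<Sum>S\<in>X. \<Sum>i\<in>{i \<in> E - S. insert i S \<in> X}. h i S) = (\<Sum>i\<in>E. \<Sum>R\<in>up i. h i R :: real)"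
proof -
  have "{i \<in> E - S. insert i S \<in> X} = {i \<in> E. i \<notin> S \<and> insert i S \<in> X}" for S by auto
  then show ?thesis
    unfolding up_def using sum.swap_restrict[OF finite_X E(1), of "\<lambda>S i. h i S" "\<lambda>S i. i \<notin> S \<and> insert i S \<in> X"]
    by simp
qed

text \<open>On each edge the conductance is at least \<open>1 / (1 + k)\<close> times the mass of
  the upper end, and \<open>phi_div\<close> is at most its symmetrised form
  \<open>(a - b) * (ln a - ln b)\<close>.\<close>

lemma modified_log_sobolev_up:
  assumes Ent: "\<And>f. (\<And>S. S \<in> X \<Longrightarrow> 0 < f S) \<Longrightarrow>
      Ent \<mu> f \<le> (\<Sum>S\<in>X. \<Sum>i\<in>{i \<in> E - S. insert i S \<in> X}. pmf \<mu> (insert i S) * phi_div (f (insert i S)) (f S))"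
    and k: "0 < k" "\<And>S i. S \<in> X \<Longrightarrow> i \<in> E - S \<Longrightarrow> insert i S \<in> X \<Longrightarrow> pmf \<mu> (insert i S) \<le> k * pmf \<mu> S"
  shows "modified_log_sobolev \<mu> (glauber E \<mu>) (1 / card E * (1 / (1 + k)))"
proof (rule modified_log_sobolevI)
  show "0 < 1 / (1 + k)" using k by simp
  fix f :: "'a set \<Rightarrow> real"
  assume f: "\<And>S. S \<in> X \<Longrightarrow> 0 < f S"
  show "Ent \<mu> f \<le> (\<Sum>i\<in>E. \<Sum>R\<in>up i. pmf \<mu> (insert i R) * phi_div (f (insert i R)) (f R))"
    using Ent[OF f] unfolding sum_up .
  fix i R assume i: "i \<in> E" and R: "R \<in> up i"
  then have X: "R \<in> X" "insert i R \<in> X" "i \<notin> R" by (auto simp: up_def)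
  have p: "0 < pmf \<mu> R" "0 < pmf \<mu> (insert i R)" using X pmf_pos by auto
  have "1 / (1 + k) * pmf \<mu> (insert i R) * phi_div (f (insert i R)) (f R)
    \<le> conductance i R * ((f (insert i R) - f R) * (ln (f (insert i R)) - ln (f R)))"
    unfolding conductance_def
    using X f k i p phi_div_le phi_div_nonneg by (intro mult_mono harmonic_ge) auto
  then show "1 / (1 + k) * (pmf \<mu> (insert i R) * phi_div (f (insert i R)) (f R))
    \<le> conductance i R * ((f (insert i R) - f R) * (ln (f (insert i R)) - ln (f R)))"
    by (simp add: mult.assoc)
qed

lemma modified_log_sobolev_down:
  assumes Ent: "\<And>f. (\<And>S. S \<in> X \<Longrightarrow> 0 < f S) \<Longrightarrow>
      Ent \<mu> f \<le> (\<Sum>S\<in>X. \<Sum>i\<in>{i \<in> E - S. insert i S \<in> X}. pmf \<mu> S * phi_div (f S) (f (insert i S)))"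
    and k: "0 < k" "\<And>S i. S \<in> X \<Longrightarrow> i \<in> E - S \<Longrightarrow> insert i S \<in> X \<Longrightarrow> pmf \<mu> S \<le> k * pmf \<mu> (insert i S)"
  shows "modified_log_sobolev \<mu> (glauber E \<mu>) (1 / card E * (1 / (1 + k)))"
proof (rule modified_log_sobolevI)
  show "0 < 1 / (1 + k)" using k by simp
  fix f :: "'a set \<Rightarrow> real"
  assume f: "\<And>S. S \<in> X \<Longrightarrow> 0 < f S"
  show "Ent \<mu> f \<le> (\<Sum>i\<in>E. \<Sum>R\<in>up i. pmf \<mu> R * phi_div (f R) (f (insert i R)))"
    using Ent[OF f] unfolding sum_up .
  fix i R assume i: "i \<in> E" and R: "R \<in> up i"
  then have X: "R \<in> X" "insert i R \<in> X" "i \<notin> R" by (auto simp: up_def)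
  have p: "0 < pmf \<mu> R" "0 < pmf \<mu> (insert i R)" using X pmf_pos by auto
  have "1 / (1 + k) * pmf \<mu> R * phi_div (f R) (f (insert i R))
    \<le> pmf \<mu> (insert i R) * pmf \<mu> R / (pmf \<mu> (insert i R) + pmf \<mu> R)
      * ((f R - f (insert i R)) * (ln (f R) - ln (f (insert i R))))"
    using X f k i p phi_div_le phi_div_nonneg by (intro mult_mono harmonic_ge) auto
  also have "\<dots> = conductance i R * ((f (insert i R) - f R) * (ln (f (insert i R)) - ln (f R)))"
    unfolding conductance_def by (simp add: add.commute mult.commute algebra_simps)
  finally show "1 / (1 + k) * (pmf \<mu> R * phi_div (f R) (f (insert i R)))
    \<le> conductance i R * ((f (insert i R) - f R) * (ln (f (insert i R)) - ln (f R)))"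
    by (simp add: mult.assoc)
qed

end

section \<open>Modified log-Sobolev inequalities\<close>

lemma (in rank_function) rc_weight_insert:
  assumes q: "0 < q" "q \<le> 1" and lam: "0 < lam" and S: "S \<subseteq> E" "i \<in> E - S"
  shows "rc_weight q lam rk (insert i S) \<le> inverse q * lam * rc_weight q lam rk S"
    and "rc_weight q lam rk S \<le> inverse lam * rc_weight q lam rk (insert i S)"
proof -
  have c: "card (insert i S) = Suc (card S)" using S fin_E by (simp add: finite_subset)
  have "q powi (- rk (insert i S)) = q powi (- rk S) \<or> q powi (- rk (insert i S)) = inverse q * q powi (- rk S)"
    using unit[OF S] q by (auto simp: power_int_minus power_int_add)
  moreover have "q powi (- rk S) \<le> inverse q * q powi (- rk S)"
    using q by (simp add: field_simps)
  ultimately have le: "q powi (- rk (insert i S)) \<le> inverse q * q powi (- rk S)"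
    "q powi (- rk S) \<le> q powi (- rk (insert i S))" by auto
  then show "rc_weight q lam rk (insert i S) \<le> inverse q * lam * rc_weight q lam rk S"
    using lam mult_right_mono[of _ _ "lam * lam ^ card S"] by (simp add: rc_weight_def c mult_ac)
  have "inverse lam * rc_weight q lam rk (insert i S) = q powi (- rk (insert i S)) * lam ^ card S"
    using lam by (simp add: rc_weight_def c)
  then show "rc_weight q lam rk S \<le> inverse lam * rc_weight q lam rk (insert i S)"
    using le(2) lam by (simp only:) (simp add: rc_weight_def mult_right_mono)
qed

text \<open>Complementation carries the weights with parameters \<open>q\<close>, \<open>lam\<close>
  to those of the dual rank with \<open>q\<close>, \<open>q / lam\<close>, up to the factor
  \<open>lam ^ card E\<close>. Insertions become deletions, so each edge is now charged to its lower
  end.\<close>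

lemma (in rank_function) random_cluster_entropy_dual:
  fixes f :: "'a set \<Rightarrow> real"
  assumes q: "0 < q" "q \<le> 1" and lam: "0 < lam"
    and f: "\<And>S. S \<subseteq> E \<Longrightarrow> 0 < f S"
  defines "w \<equiv> rc_weight q lam rk"
  shows "(\<Sum>S\<in>Pow E. w S * (f S * ln (f S)))
      - (\<Sum>S\<in>Pow E. w S * f S) * ln ((\<Sum>S\<in>Pow E. w S * f S) / (\<Sum>S\<in>Pow E. w S))
    \<le> (\<Sum>S\<in>Pow E. \<Sum>i\<in>E - S. w S * phi_div (f S) (f (insert i S)))"
proof -
  define rk' where "rk' A = int (card A) + rk (E - A)" for A
  interpret d: rank_function E rk' unfolding rk'_def by (rule dual)
  define w' where "w' = rc_weight q (q / lam) rk'"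
  define c where "c = 1 / lam ^ card E"
  have c: "0 < c" using lam by (simp add: c_def)
  have w': "w' T = c * w (E - T)" if "T \<subseteq> E" for T
  proof -
    have "finite T" using that fin_E finite_subset by blast
    then have k: "card (E - T) + card T = card E"
      using that fin_E by (simp add: card_Diff_subset card_mono)
    have "- (int (card T) + rk (E - T)) = - rk (E - T) - int (card T)" by simp
    then have "q powi (- (int (card T) + rk (E - T))) = q powi (- rk (E - T)) / q ^ card T"
      using q by (simp only:) (simp add: power_int_diff)
    moreover have "lam ^ card E = lam ^ card (E - T) * lam ^ card T"
      using k by (simp flip: power_add)
    moreover have "P / Q * (Q / L) = 1 / (L' * L) * (P * L')" if "Q \<noteq> 0" "L' \<noteq> 0" for P Q L L' :: real
      using that by simp
    ultimately show ?thesis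
      using lam q by (simp add: w'_def w_def rc_weight_def rk'_def c_def power_divide)
  qed
  have reindex: "(\<Sum>T\<in>Pow E. w' T * g (E - T)) = c * (\<Sum>S\<in>Pow E. w S * g S)" for g
    unfolding sum_distrib_left
    by (rule sum.reindex_bij_witness[of _ "\<lambda>S. E - S" "\<lambda>S. E - S"]) (auto simp: w' double_diff)
  have R: "(\<Sum>T\<in>Pow E. \<Sum>i\<in>E - T. w' (insert i T) * phi_div (f (E - insert i T)) (f (E - T)))
    = c * (\<Sum>S\<in>Pow E. \<Sum>i\<in>E - S. w S * phi_div (f S) (f (insert i S)))"
  proof -
    have sw: "(\<Sum>T\<in>Pow E. \<Sum>i\<in>E - T. F i T) = (\<Sum>i\<in>E. \<Sum>T\<in>{T \<in> Pow E. i \<notin> T}. F i T)"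
      for F :: "'a \<Rightarrow> 'a set \<Rightarrow> real"
    proof -
      have "E - T = {i \<in> E. i \<notin> T}" for T by auto
      then show ?thesis
        using sum.swap_restrict[of "Pow E" E "\<lambda>T i. F i T" "\<lambda>T i. i \<notin> T"] fin_E by simp
    qed
    have "(\<Sum>T\<in>{T \<in> Pow E. i \<notin> T}. w' (insert i T) * phi_div (f (E - insert i T)) (f (E - T)))
      = (\<Sum>S\<in>{S \<in> Pow E. i \<notin> S}. c * (w S * phi_div (f S) (f (insert i S))))" if i: "i \<in> E" for i
    proof (rule sum.reindex_bij_witness[of _ "\<lambda>S. E - insert i S" "\<lambda>S. E - insert i S"])
      fix T assume T: "T \<in> {T \<in> Pow E. i \<notin> T}"
      show "E - insert i (E - insert i T) = T" using T by auto
      show "E - insert i T \<in> {S \<in> Pow E. i \<notin> S}" by auto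
      have "insert i (E - insert i T) = E - T" using T i by auto
      then show "c * (w (E - insert i T) * phi_div (f (E - insert i T)) (f (insert i (E - insert i T))))
        = w' (insert i T) * phi_div (f (E - insert i T)) (f (E - T))"
        using T i by (simp add: w')
    qed auto
    then show ?thesis unfolding sw by (simp add: sum_distrib_left)
  qed
  have "(\<Sum>T\<in>Pow E. w' T * (f (E - T) * ln (f (E - T))))
      - (\<Sum>T\<in>Pow E. w' T * f (E - T)) * ln ((\<Sum>T\<in>Pow E. w' T * f (E - T)) / (\<Sum>T\<in>Pow E. w' T))
    \<le> (\<Sum>T\<in>Pow E. \<Sum>i\<in>E - T. w' (insert i T) * phi_div (f (E - insert i T)) (f (E - T)))"
    unfolding w'_def using q lam f by (intro d.random_cluster_entropy) auto
  also note R
  also have "(\<Sum>T\<in>Pow E. w' T) = c * (\<Sum>S\<in>Pow E. w S)" using reindex[of "\<lambda>_. 1"] by simp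
  finally have "c * ((\<Sum>S\<in>Pow E. w S * (f S * ln (f S)))
      - (\<Sum>S\<in>Pow E. w S * f S) * ln ((\<Sum>S\<in>Pow E. w S * f S) / (\<Sum>S\<in>Pow E. w S)))
    \<le> c * (\<Sum>S\<in>Pow E. \<Sum>i\<in>E - S. w S * phi_div (f S) (f (insert i S)))"
    unfolding reindex[of f] reindex[of "\<lambda>S. f S * ln (f S)"] using c
    by (simp add: right_diff_distrib mult.assoc)
  then show ?thesis using c by simp
qed

lemma (in rank_function) modified_log_sobolev_random_cluster:
  assumes q: "0 < q" "q \<le> 1" and lam: "0 < lam" and E: "E \<noteq> {}"
  defines "\<mu> \<equiv> weighted_pmf (Pow E) (rc_weight q lam rk)"
  shows "modified_log_sobolev \<mu> (glauber E \<mu>)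
    (1 / card E * max (1 / (1 + inverse q * lam)) (1 / (1 + inverse lam)))"
proof -
  define w where "w = rc_weight q lam rk"
  have w: "0 < w S" for S unfolding w_def by (rule rc_weight_pos[OF q(1) lam])
  have fin: "finite (Pow E)" "Pow E \<noteq> {}" using fin_E by auto
  define Z where "Z = sum w (Pow E)"
  have Z: "0 < Z" unfolding Z_def using fin w by (intro sum_pos) auto
  have pmf: "pmf \<mu> S = w S / Z" if "S \<subseteq> E" for S
    using that w pmf_weighted_pmf[OF fin, of w S] by (simp add: \<mu>_def w_def Z_def)
  interpret glauber_dynamics E \<mu> "Pow E"
  proof
    show "set_pmf \<mu> = Pow E"
      unfolding \<mu>_def using w fin by (intro set_pmf_weighted_pmf) (auto simp: w_def)
  qed (use fin_E E in auto)
  have I: "{i \<in> E - S. insert i S \<in> Pow E} = E - S" if "S \<in> Pow E" for S using that by auto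
  have Ent: "Ent \<mu> f = ((\<Sum>x\<in>Pow E. w x * (f x * ln (f x)))
      - (\<Sum>x\<in>Pow E. w x * f x) * ln ((\<Sum>x\<in>Pow E. w x * f x) / (\<Sum>x\<in>Pow E. w x))) / Z" for f
    unfolding \<mu>_def Z_def w_def using w fin by (intro Ent_weighted_pmf) (auto simp: w_def)
  have up: "modified_log_sobolev \<mu> (glauber E \<mu>) (1 / card E * (1 / (1 + inverse q * lam)))"
  proof (rule modified_log_sobolev_up)
    show "0 < inverse q * lam" using q lam by simp
    show "pmf \<mu> (insert i S) \<le> inverse q * lam * pmf \<mu> S"
      if "S \<in> Pow E" "i \<in> E - S" "insert i S \<in> Pow E" for S i
      using that Z rc_weight_insert(1)[OF q lam, of S i]
      by (simp add: pmf w_def[symmetric] divide_right_mono)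
    fix f :: "'a set \<Rightarrow> real"
    assume f: "\<And>S. S \<in> Pow E \<Longrightarrow> 0 < f S"
    have "Ent \<mu> f \<le> (\<Sum>S\<in>Pow E. \<Sum>i\<in>E - S. w (insert i S) * phi_div (f (insert i S)) (f S)) / Z"
      unfolding Ent using random_cluster_entropy[OF q lam, of f] f Z by (simp add: w_def divide_right_mono)
    also have "\<dots> = (\<Sum>S\<in>Pow E. \<Sum>i\<in>{i \<in> E - S. insert i S \<in> Pow E}.
        pmf \<mu> (insert i S) * phi_div (f (insert i S)) (f S))"
      unfolding sum_divide_distrib by (intro sum.cong) (auto simp: pmf)
    finally show "Ent \<mu> f \<le> \<dots>" .
  qed
  have down: "modified_log_sobolev \<mu> (glauber E \<mu>) (1 / card E * (1 / (1 + inverse lam)))"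
  proof (rule modified_log_sobolev_down)
    show "0 < inverse lam" using lam by simp
    show "pmf \<mu> S \<le> inverse lam * pmf \<mu> (insert i S)"
      if "S \<in> Pow E" "i \<in> E - S" "insert i S \<in> Pow E" for S i
      using that Z rc_weight_insert(2)[OF q lam, of S i]
      by (simp add: pmf w_def[symmetric] divide_right_mono)
    fix f :: "'a set \<Rightarrow> real"
    assume f: "\<And>S. S \<in> Pow E \<Longrightarrow> 0 < f S"
    have "Ent \<mu> f \<le> (\<Sum>S\<in>Pow E. \<Sum>i\<in>E - S. w S * phi_div (f S) (f (insert i S))) / Z"
      unfolding Ent using random_cluster_entropy_dual[OF q lam, of f] f Z by (simp add: w_def divide_right_mono)
    also have "\<dots> = (\<Sum>S\<in>Pow E. \<Sum>i\<in>{i \<in> E - S. insert i S \<in> Pow E}.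
        pmf \<mu> S * phi_div (f S) (f (insert i S)))"
      unfolding sum_divide_distrib by (intro sum.cong) (auto simp: pmf)
    finally show "Ent \<mu> f \<le> \<dots>" .
  qed
  show ?thesis unfolding max_def using up down by (cases "1 / (1 + inverse q * lam) \<le> 1 / (1 + inverse lam)") (simp_all only: if_True if_False)
qed

section \<open>Independent sets as a limit of random clusters\<close>

context matroid
begin

lemma rank_eq_card_iff:
  assumes "S \<subseteq> E" shows "card S \<le> matroid_rank \<I> S \<longleftrightarrow> S \<in> \<I>"
proof
  assume c: "card S \<le> matroid_rank \<I> S"
  obtain A where A: "A \<in> \<I>" "A \<subseteq> S" "card A = matroid_rank \<I> S" by (rule rank_attained)
  have "A = S"
    using A c assms finite_ground by (intro card_seteq) (auto intro: finite_subset)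
  then show "S \<in> \<I>" using A by simp
qed (auto intro: card_le_rank)

text \<open>With \<open>lam * q\<close> in place of \<open>lam\<close>, the random cluster weights converge to the weights of the
  independent sets as \<open>q\<close> tends to \<open>0\<close>.\<close>

lemma independent_set_entropy:
  fixes f :: "'a set \<Rightarrow> real"
  assumes lam: "0 < lam" and f: "\<And>S. S \<in> \<I> \<Longrightarrow> 0 < f S"
  shows "(\<Sum>S\<in>\<I>. lam ^ card S * (f S * ln (f S)))
      - (\<Sum>S\<in>\<I>. lam ^ card S * f S) * ln ((\<Sum>S\<in>\<I>. lam ^ card S * f S) / (\<Sum>S\<in>\<I>. lam ^ card S))
    \<le> (\<Sum>S\<in>\<I>. \<Sum>i\<in>{i \<in> E - S. insert i S \<in> \<I>}. lam ^ card (insert i S) * phi_div (f (insert i S)) (f S))"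
proof -
  \<comment> \<open>The entropy bound for positive \<open>q\<close> sees all subsets of
    \<open>E\<close>; the default 1 keeps \<open>g\<close> positive on dependent ones.\<close>
  define g where "g S = (if S \<in> \<I> then f S else 1)" for S
  \<comment> \<open>The powers of \<open>q\<close> are collected into one natural exponent, the
    nullity of \<open>S\<close>. The weight is thus continuous at \<open>q = 0\<close>, where
    \<open>0 ^ 0 = 1\<close> selects precisely the independent sets.\<close>
  define v where "v q S = lam ^ card S * q ^ (card S - matroid_rank \<I> S)" for q S
  have v0: "v 0 S = (if S \<in> \<I> then lam ^ card S else 0)" if "S \<subseteq> E" for S
    using rank_eq_card_iff[OF that] by (auto simp: v_def)
  interpret rank_function E "\<lambda>S. int (matroid_rank \<I> S)" by (rule rank_function)
  have vq: "rc_weight q (lam * q) (\<lambda>S. int (matroid_rank \<I> S)) S = v q S" if q: "0 < q" and S: "S \<subseteq> E" for q S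
  proof -
    have "matroid_rank \<I> S \<le> card S"
      using rank_attained[of S] S finite_ground by (metis card_mono finite_subset)
    then have "card S = matroid_rank \<I> S + (card S - matroid_rank \<I> S)" by simp
    then have "q ^ card S = q ^ matroid_rank \<I> S * q ^ (card S - matroid_rank \<I> S)"
      by (metis power_add)
    then show ?thesis
      using q by (simp add: rc_weight_def v_def power_mult_distrib power_int_minus field_simps)
  qed
  define L where "L q = (\<Sum>S\<in>Pow E. v q S * (g S * ln (g S)))
      - (\<Sum>S\<in>Pow E. v q S * g S) * ln ((\<Sum>S\<in>Pow E. v q S * g S) / (\<Sum>S\<in>Pow E. v q S))" for q
  define R where "R q = (\<Sum>S\<in>Pow E. \<Sum>i\<in>E - S. v q (insert i S) * phi_div (g (insert i S)) (g S))" for q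
  have g: "0 < g S" for S using f by (simp add: g_def)
  have LR: "L q \<le> R q" if q: "0 < q" "q \<le> 1" for q
  proof -
    have e: "(\<Sum>S\<in>Pow E. rc_weight q (lam * q) (\<lambda>S. int (matroid_rank \<I> S)) S * h S)
      = (\<Sum>S\<in>Pow E. v q S * h S)" for h
      using q by (intro sum.cong) (auto simp: vq)
    have e1: "(\<Sum>S\<in>Pow E. rc_weight q (lam * q) (\<lambda>S. int (matroid_rank \<I> S)) S) = (\<Sum>S\<in>Pow E. v q S)"
      using e[of "\<lambda>_. 1"] by simp
    have R: "(\<Sum>S\<in>Pow E. \<Sum>i\<in>E - S. rc_weight q (lam * q) (\<lambda>S. int (matroid_rank \<I> S)) (insert i S)
        * phi_div (g (insert i S)) (g S)) = R q"
      unfolding R_def using q by (intro sum.cong) (auto simp: vq)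
    have "0 < lam * q" using lam q by simp
    from random_cluster_entropy[OF q this, of g] g show ?thesis
      unfolding e e1 R L_def by simp
  qed
  have tv: "((\<lambda>q. v q S) \<longlongrightarrow> v 0 S) (at_right 0)" for S
    unfolding v_def by (intro tendsto_intros)
  have v0_nonneg: "0 \<le> v 0 S" for S using lam by (simp add: v_def)
  have e: "0 < v 0 {}" using v0[of "{}"] empty_indep by simp
  \<comment> \<open>The empty set keeps both sums positive at \<open>q = 0\<close>, which the
    continuity of the quotient and of its logarithm requires.\<close>
  have A: "0 < (\<Sum>S\<in>Pow E. v 0 S)"
    using finite_ground v0_nonneg e by (intro sum_pos2[of _ "{}"]) auto
  have B: "0 < (\<Sum>S\<in>Pow E. v 0 S * g S)"
    using finite_ground v0_nonneg e g by (intro sum_pos2[of _ "{}"]) (auto simp: less_imp_le)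
  have "(L \<longlongrightarrow> L 0) (at_right 0)"
    unfolding L_def using A B by (intro tendsto_intros tv) auto
  moreover have "(R \<longlongrightarrow> R 0) (at_right 0)"
    unfolding R_def by (intro tendsto_intros tv)
  moreover have "\<forall>\<^sub>F q in at_right 0. L q \<le> R q"
    unfolding eventually_at_right_field by (intro exI[of _ 1]) (auto intro: LR)
  ultimately have "L 0 \<le> R 0" by (intro tendsto_le[of "at_right (0::real)"]) auto
  moreover have s: "(\<Sum>S\<in>Pow E. v 0 S * h S) = (\<Sum>S\<in>\<I>. lam ^ card S * h S)" for h
    using finite_ground indep_subset
    by (intro sum.mono_neutral_cong_right) (auto simp: v0)
  have s1: "(\<Sum>S\<in>Pow E. v 0 S) = (\<Sum>S\<in>\<I>. lam ^ card S)" using s[of "\<lambda>_. 1"] by simp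
  have "L 0 = (\<Sum>S\<in>\<I>. lam ^ card S * (f S * ln (f S)))
      - (\<Sum>S\<in>\<I>. lam ^ card S * f S) * ln ((\<Sum>S\<in>\<I>. lam ^ card S * f S) / (\<Sum>S\<in>\<I>. lam ^ card S))"
    unfolding L_def s s1 by (simp add: g_def)
  moreover have "R 0 = (\<Sum>S\<in>\<I>. \<Sum>i\<in>{i \<in> E - S. insert i S \<in> \<I>}. lam ^ card (insert i S) * phi_div (f (insert i S)) (f S))"
    unfolding R_def
  proof (rule sum.mono_neutral_cong_right)
    show "\<forall>S\<in>Pow E - \<I>. (\<Sum>i\<in>E - S. v 0 (insert i S) * phi_div (g (insert i S)) (g S)) = 0"
    proof
      fix S assume S: "S \<in> Pow E - \<I>"
      then have "insert i S \<notin> \<I>" for i using indep_down[of "insert i S" S] by auto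
      then show "(\<Sum>i\<in>E - S. v 0 (insert i S) * phi_div (g (insert i S)) (g S)) = 0"
        using S by (intro sum.neutral) (auto simp: v0)
    qed
    fix S assume S: "S \<in> \<I>"
    show "(\<Sum>i\<in>E - S. v 0 (insert i S) * phi_div (g (insert i S)) (g S))
      = (\<Sum>i\<in>{i \<in> E - S. insert i S \<in> \<I>}. lam ^ card (insert i S) * phi_div (f (insert i S)) (f S))"
      using finite_ground indep_subset[OF S] S
      by (intro sum.mono_neutral_cong_right) (auto simp: v0 g_def)
  qed (use finite_ground indep_subset in auto)
  ultimately show ?thesis by simp
qed

lemma modified_log_sobolev_weighted_indep:
  assumes lam: "0 < lam" and E: "E \<noteq> {}"
  shows "modified_log_sobolev (weighted_indep \<I> lam) (glauber E (weighted_indep \<I> lam))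
    (1 / card E * (1 / (1 + lam)))"
proof -
  define \<mu> where "\<mu> = weighted_indep \<I> lam"
  have ne: "\<I> \<noteq> {}" using empty_indep by auto
  define Z where "Z = (\<Sum>S\<in>\<I>. lam ^ card S)"
  have Z: "0 < Z" unfolding Z_def using finite_indep_family ne lam by (intro sum_pos) auto
  have pmf: "pmf \<mu> S = lam ^ card S / Z" if "S \<in> \<I>" for S
    using that lam pmf_weighted_pmf[OF finite_indep_family ne, of "\<lambda>S. lam ^ card S" S]
    by (simp add: \<mu>_def weighted_indep_def Z_def)
  interpret glauber_dynamics E \<mu> \<I>
  proof
    show "set_pmf \<mu> = \<I>"
      unfolding \<mu>_def weighted_indep_def using lam ne finite_indep_family
      by (intro set_pmf_weighted_pmf) auto
    show "S - {i} \<in> \<I>" if "S \<in> \<I>" for S i using indep_down[OF that] by auto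
  qed (use finite_ground indep_subset E in auto)
  show ?thesis unfolding \<mu>_def[symmetric]
  proof (rule modified_log_sobolev_up)
    show "pmf \<mu> (insert i S) \<le> lam * pmf \<mu> S" if "S \<in> \<I>" "i \<in> E - S" "insert i S \<in> \<I>" for S i
      using that finite_indep by (simp add: pmf)
    fix f :: "'a set \<Rightarrow> real"
    assume f: "\<And>S. S \<in> \<I> \<Longrightarrow> 0 < f S"
    have "Ent \<mu> f = ((\<Sum>S\<in>\<I>. lam ^ card S * (f S * ln (f S)))
      - (\<Sum>S\<in>\<I>. lam ^ card S * f S) * ln ((\<Sum>S\<in>\<I>. lam ^ card S * f S) / (\<Sum>S\<in>\<I>. lam ^ card S))) / Z"
      unfolding \<mu>_def Z_def weighted_indep_def using lam ne finite_indep_family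
      by (intro Ent_weighted_pmf) auto
    also have "\<dots> \<le> (\<Sum>S\<in>\<I>. \<Sum>i\<in>{i \<in> E - S. insert i S \<in> \<I>}.
        lam ^ card (insert i S) * phi_div (f (insert i S)) (f S)) / Z"
      using independent_set_entropy[OF lam f] Z by (intro divide_right_mono) auto
    also have "\<dots> = (\<Sum>S\<in>\<I>. \<Sum>i\<in>{i \<in> E - S. insert i S \<in> \<I>}.
        pmf \<mu> (insert i S) * phi_div (f (insert i S)) (f S))"
      unfolding sum_divide_distrib by (intro sum.cong) (auto simp: pmf)
    finally show "Ent \<mu> f \<le> \<dots>" .
  qed (rule lam)
qed

end

section \<open>Smoothing by a lazy reversible chain\<close>

text \<open>The expectation of \<open>g\<close> at a binomial variable with parameters
  \<open>n\<close> and \<open>p\<close>, whose point masses are the \<open>Bernstein\<close>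
  polynomials.\<close>

definition bernstein_sum :: "nat \<Rightarrow> real \<Rightarrow> (nat \<Rightarrow> real) \<Rightarrow> real" where
  "bernstein_sum n p g = (\<Sum>k\<le>n. Bernstein n k p * g k)"

lemma bernstein_sum_Suc:
  "bernstein_sum (Suc n) p g = (1 - p) * bernstein_sum n p g + p * bernstein_sum n p (\<lambda>k. g (Suc k))"
proof -
  have "bernstein_sum (Suc n) p g = (1 - p) ^ Suc n * g 0
      + (\<Sum>k\<le>n. real (Suc n choose Suc k) * p ^ Suc k * (1 - p) ^ (n - k) * g (Suc k))"
    by (simp add: bernstein_sum_def Bernstein_def sum.atMost_Suc_shift del: sum.atMost_Suc binomial_Suc_Suc)
  also have "(\<Sum>k\<le>n. real (Suc n choose Suc k) * p ^ Suc k * (1 - p) ^ (n - k) * g (Suc k))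
    = (\<Sum>k\<le>n. real (n choose Suc k) * p ^ Suc k * (1 - p) ^ (n - k) * g (Suc k))
      + p * bernstein_sum n p (\<lambda>k. g (Suc k))"
    unfolding bernstein_sum_def Bernstein_def sum_distrib_left sum.distrib[symmetric]
    by (intro sum.cong refl) (simp add: algebra_simps)
  also have "(\<Sum>k\<le>n. real (n choose Suc k) * p ^ Suc k * (1 - p) ^ (n - k) * g (Suc k))
    = (\<Sum>k<n. real (n choose Suc k) * p ^ Suc k * (1 - p) ^ (n - k) * g (Suc k))"
    by (intro sum.mono_neutral_right) (auto simp: binomial_eq_0)
  also have "\<dots> = (\<Sum>k<n. (1 - p) * (real (n choose Suc k) * p ^ Suc k * (1 - p) ^ (n - Suc k) * g (Suc k)))"
  proof (rule sum.cong[OF refl])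
    fix k assume "k \<in> {..<n}"
    then have "n - k = Suc (n - Suc k)" by auto
    then show "real (n choose Suc k) * p ^ Suc k * (1 - p) ^ (n - k) * g (Suc k)
      = (1 - p) * (real (n choose Suc k) * p ^ Suc k * (1 - p) ^ (n - Suc k) * g (Suc k))"
      by (simp add: mult_ac)
  qed
  also have "(1 - p) ^ Suc n * g 0 + (\<dots> + p * bernstein_sum n p (\<lambda>k. g (Suc k)))
    = (1 - p) * bernstein_sum n p g + p * bernstein_sum n p (\<lambda>k. g (Suc k))"
    unfolding bernstein_sum_def Bernstein_def lessThan_Suc_atMost[symmetric] sum.lessThan_Suc_shift
    by (simp add: sum_distrib_left algebra_simps)
  finally show ?thesis .
qed

lemma bernstein_sum_times_index:
  "bernstein_sum (Suc n) p (\<lambda>k. real k * g k) = real (Suc n) * p * bernstein_sum n p (\<lambda>k. g (Suc k))"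
proof -
  have "bernstein_sum (Suc n) p (\<lambda>k. real k * g k)
    = (\<Sum>k\<le>n. real (Suc k * (Suc n choose Suc k)) * p ^ Suc k * (1 - p) ^ (n - k) * g (Suc k))"
    by (simp add: bernstein_sum_def Bernstein_def sum.atMost_Suc_shift algebra_simps
        del: sum.atMost_Suc binomial_Suc_Suc)
  also have "\<dots> = real (Suc n) * p * bernstein_sum n p (\<lambda>k. g (Suc k))"
    unfolding Suc_times_binomial bernstein_sum_def Bernstein_def sum_distrib_left
    by (intro sum.cong refl) (simp add: algebra_simps)
  finally show ?thesis .
qed

lemma bernstein_sum_cong: "(\<And>k. k \<le> n \<Longrightarrow> g k = h k) \<Longrightarrow> bernstein_sum n p g = bernstein_sum n p h"
  by (simp add: bernstein_sum_def)

lemma bernstein_sum_linear: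
  "bernstein_sum n p (\<lambda>k. a * g k + b * h k) = a * bernstein_sum n p g + b * bernstein_sum n p h"
  by (simp add: bernstein_sum_def algebra_simps sum.distrib sum_distrib_left)

lemma bernstein_sum_cmult: "bernstein_sum n p (\<lambda>k. a * g k) = a * bernstein_sum n p g"
  by (simp add: bernstein_sum_def sum_distrib_left mult_ac)

lemma bernstein_sum_const: "bernstein_sum n p (\<lambda>k. a) = a"
  by (simp add: bernstein_sum_def sum_Bernstein flip: sum_distrib_right)

lemma bernstein_sum_mono:
  assumes "0 \<le> p" "p \<le> 1" "\<And>k. k \<le> n \<Longrightarrow> g k \<le> h k"
  shows "bernstein_sum n p g \<le> bernstein_sum n p h"
  unfolding bernstein_sum_def using assms by (intro sum_mono mult_left_mono Bernstein_nonneg) auto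

text \<open>Given \<open>k\<close> successes in \<open>n + 1\<close> trials, the last trial
  succeeded with conditional probability \<open>k / (n + 1)\<close>. A difference between its two
  outcomes thereby becomes a reweighting by the centred factor
  \<open>k / (n + 1) - p\<close>.\<close>

lemma bernstein_sum_diff:
  assumes "0 < p" "p < 1"
  shows "bernstein_sum n p (\<lambda>k. g (Suc k) - g k)
    = bernstein_sum (Suc n) p (\<lambda>k. (k / Suc n - p) * g k) / (p * (1 - p))"
proof -
  have "bernstein_sum (Suc n) p (\<lambda>k. (k / Suc n - p) * g k)
    = bernstein_sum (Suc n) p (\<lambda>k. 1 / Suc n * (k * g k) + (- p) * g k)"
    by (intro bernstein_sum_cong) (simp add: algebra_simps)
  also have "\<dots> = 1 / Suc n * (Suc n * p * bernstein_sum n p (\<lambda>k. g (Suc k))) + (- p) *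
      ((1 - p) * bernstein_sum n p g + p * bernstein_sum n p (\<lambda>k. g (Suc k)))"
    unfolding bernstein_sum_linear bernstein_sum_times_index bernstein_sum_Suc[of n p g] ..
  also have "1 / Suc n * (Suc n * p * bernstein_sum n p (\<lambda>k. g (Suc k))) = p * bernstein_sum n p (\<lambda>k. g (Suc k))"
    by (simp del: of_nat_Suc)
  also have "p * bernstein_sum n p (\<lambda>k. g (Suc k)) + (- p) *
      ((1 - p) * bernstein_sum n p g + p * bernstein_sum n p (\<lambda>k. g (Suc k)))
    = p * (1 - p) * (1 * bernstein_sum n p (\<lambda>k. g (Suc k)) + (-1) * bernstein_sum n p g)"
    by (simp add: algebra_simps)
  also have "1 * bernstein_sum n p (\<lambda>k. g (Suc k)) + (-1) * bernstein_sum n p g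
    = bernstein_sum n p (\<lambda>k. g (Suc k) - g k)"
    unfolding bernstein_sum_linear[symmetric] by simp
  finally show ?thesis using assms by simp
qed

lemma bernstein_sum_variance:
  "bernstein_sum n p (\<lambda>k. (real k - n * p)\<^sup>2) = n * p * (1 - p)"
proof -
  have "bernstein_sum n p (\<lambda>k. (real k - n * p)\<^sup>2)
    = (\<Sum>k\<le>n. real k * (real k - 1) * Bernstein n k p)
      + (1 - 2 * n * p) * (\<Sum>k\<le>n. real k * Bernstein n k p) + (n * p)\<^sup>2 * (\<Sum>k\<le>n. Bernstein n k p)"
    unfolding bernstein_sum_def sum_distrib_left sum.distrib[symmetric]
    by (intro sum.cong refl) (simp add: power2_eq_square algebra_simps)
  then show ?thesis
    unfolding sum_Bernstein sum_k_Bernstein sum_kk_Bernstein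
    by (simp add: power2_eq_square algebra_simps)
qed

lemma bernstein_sum_abs_deviation:
  assumes p: "0 \<le> p" "p \<le> 1"
  shows "bernstein_sum n p (\<lambda>k. \<bar>real k - n * p\<bar>) \<le> sqrt (n * p * (1 - p))"
proof (rule real_le_rsqrt)
  define A where "A = bernstein_sum n p (\<lambda>k. \<bar>real k - n * p\<bar>)"
  have "0 \<le> bernstein_sum n p (\<lambda>k. (\<bar>real k - n * p\<bar> - A)\<^sup>2)"
    using bernstein_sum_mono[OF p, of n "\<lambda>k. 0" "\<lambda>k. (\<bar>real k - n * p\<bar> - A)\<^sup>2"]
    by (simp add: bernstein_sum_const)
  also have "\<dots> = bernstein_sum n p (\<lambda>k. 1 * (1 * (real k - n * p)\<^sup>2 + (- 2 * A) * \<bar>real k - n * p\<bar>) + A\<^sup>2 * 1)"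
    by (intro bernstein_sum_cong) (simp add: power2_eq_square algebra_simps)
  also have "\<dots> = n * p * (1 - p) - A\<^sup>2"
    unfolding bernstein_sum_linear bernstein_sum_variance bernstein_sum_const A_def[symmetric]
    by (simp add: power2_eq_square)
  finally show "A\<^sup>2 \<le> n * p * (1 - p)" by simp
qed

text \<open>Expanding \<open>(1 - p) I + p Q\<close> to the power \<open>n\<close>: the number of
  genuine moves is binomial.\<close>

lemma funpow_lazy_eq_bernstein_sum:
  fixes Q T :: "('s \<Rightarrow> real) \<Rightarrow> 's \<Rightarrow> real"
  assumes lin: "\<And>a b f g. Q (\<lambda>x. a * f x + b * g x) = (\<lambda>x. a * Q f x + b * Q g x)"
    and T: "\<And>f. T f = (\<lambda>x. (1 - p) * f x + p * Q f x)"
  shows "(T ^^ n) f x = bernstein_sum n p (\<lambda>k. (Q ^^ k) f x)"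
proof (induction n arbitrary: f)
  case 0
  then show ?case by (simp add: bernstein_sum_def Bernstein_def)
next
  case (Suc n)
  have pow: "(Q ^^ k) (\<lambda>x. a * f x + b * g x) = (\<lambda>x. a * (Q ^^ k) f x + b * (Q ^^ k) g x)" for k a b f g
    by (induction k) (simp_all add: lin)
  have "(T ^^ Suc n) f x = (T ^^ n) (T f) x" by (simp add: funpow_swap1)
  also have "\<dots> = bernstein_sum n p (\<lambda>k. (1 - p) * (Q ^^ k) f x + p * (Q ^^ k) (Q f) x)"
    unfolding Suc.IH unfolding T pow ..
  also have "\<dots> = bernstein_sum (Suc n) p (\<lambda>k. (Q ^^ k) f x)"
    unfolding bernstein_sum_linear bernstein_sum_Suc by (simp add: funpow_swap1)
  finally show ?case .
qed

section \<open>A lazy reversible chain acting on densities\<close>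

locale lazy_reversible_chain =
  fixes \<mu> :: "'s pmf" and P :: "'s \<Rightarrow> 's pmf" and c :: real
  assumes fin: "finite (set_pmf \<mu>)"
    and closed: "\<And>x. x \<in> set_pmf \<mu> \<Longrightarrow> set_pmf (P x) \<subseteq> set_pmf \<mu>"
    and reversible: "\<And>x y. x \<in> set_pmf \<mu> \<Longrightarrow> y \<in> set_pmf \<mu> \<Longrightarrow>
      pmf \<mu> x * pmf (P x) y = pmf \<mu> y * pmf (P y) x"
    and lazy: "\<And>x. x \<in> set_pmf \<mu> \<Longrightarrow> c \<le> pmf (P x) x"
    and c: "0 < c" "c < 1"
begin

abbreviation X where "X \<equiv> set_pmf \<mu>"
abbreviation m where "m \<equiv> pmf \<mu>"

text \<open>By reversibility this averaging operator also evolves densities with respect to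
  \<open>\<mu>\<close>, so laws and test functions share one operator.\<close>

definition T :: "('s \<Rightarrow> real) \<Rightarrow> 's \<Rightarrow> real" where
  "T f x = (\<Sum>y\<in>X. pmf (P x) y * f y)"

definition norm1 :: "('s \<Rightarrow> real) \<Rightarrow> real" where
  "norm1 f = (\<Sum>x\<in>X. m x * \<bar>f x\<bar>)"

text \<open>The kernel after splitting off the guaranteed hold, \<open>T = c I + (1 - c) Q\<close>.
  The holding bound is what makes \<open>Q\<close> preserve positivity and hence contract
  \<open>norm1\<close>.\<close>

definition Q :: "('s \<Rightarrow> real) \<Rightarrow> 's \<Rightarrow> real" where
  "Q f x = (T f x - c * f x) / (1 - c)"

lemma m_pos: "x \<in> X \<Longrightarrow> 0 < m x" by (rule pmf_positive)

lemma sum_m: "(\<Sum>x\<in>X. m x) = 1" using fin by (rule sum_pmf_eq_1) simp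

lemma sum_P: "x \<in> X \<Longrightarrow> (\<Sum>y\<in>X. pmf (P x) y) = 1" using fin closed by (rule sum_pmf_eq_1)

lemma expectation_P: "x \<in> X \<Longrightarrow> measure_pmf.expectation (P x) g = T g x"
  unfolding T_def using fin closed[of x] by (subst integral_measure_pmf_real[of X]) (auto simp: mult.commute)

lemma T_linear: "T (\<lambda>x. a * f x + b * g x) = (\<lambda>x. a * T f x + b * T g x)"
  by (simp add: T_def fun_eq_iff algebra_simps sum.distrib sum_distrib_left)

lemma T_pow_linear: "(T ^^ k) (\<lambda>x. a * f x + b * g x) = (\<lambda>x. a * (T ^^ k) f x + b * (T ^^ k) g x)"
  by (induction k) (simp_all add: T_linear)

lemma Q_linear: "Q (\<lambda>x. a * f x + b * g x) = (\<lambda>x. a * Q f x + b * Q g x)"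
  by (simp add: Q_def T_linear fun_eq_iff algebra_simps add_divide_distrib diff_divide_distrib)

lemma T_self_adjoint: "(\<Sum>x\<in>X. m x * (T f x * g x)) = (\<Sum>x\<in>X. m x * (f x * T g x))"
proof -
  have "(\<Sum>x\<in>X. m x * (T f x * g x)) = (\<Sum>x\<in>X. \<Sum>y\<in>X. m x * pmf (P x) y * f y * g x)"
    by (simp add: T_def sum_distrib_left sum_distrib_right mult_ac)
  also have "\<dots> = (\<Sum>y\<in>X. \<Sum>x\<in>X. m y * pmf (P y) x * f y * g x)"
    by (subst sum.swap) (intro sum.cong refl, simp add: reversible)
  also have "\<dots> = (\<Sum>x\<in>X. m x * (f x * T g x))"
    by (simp add: T_def sum_distrib_left mult_ac)
  finally show ?thesis .
qed

lemma T_const: "x \<in> X \<Longrightarrow> T (\<lambda>_. a) x = a"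
  by (simp add: T_def sum_P flip: sum_distrib_right)

lemma T_mass: "(\<Sum>x\<in>X. m x * T f x) = (\<Sum>x\<in>X. m x * f x)"
  using T_self_adjoint[of f "\<lambda>_. 1"] by (simp add: T_const)

lemma T_mono: "(\<And>x. x \<in> X \<Longrightarrow> f x \<le> g x) \<Longrightarrow> T f x \<le> T g x"
  unfolding T_def by (intro sum_mono mult_left_mono) auto

lemma T_cong: "(\<And>x. x \<in> X \<Longrightarrow> f x = g x) \<Longrightarrow> T f x = T g x"
  unfolding T_def by (intro sum.cong) auto

lemma T_ge: assumes "x \<in> X" "\<And>x. x \<in> X \<Longrightarrow> 0 \<le> f x" shows "c * f x \<le> T f x"
proof -
  have "c * f x \<le> pmf (P x) x * f x" using assms lazy by (intro mult_right_mono) auto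
  also have "\<dots> \<le> T f x" unfolding T_def using assms fin by (intro member_le_sum) auto
  finally show ?thesis .
qed

lemma Q_abs: assumes x: "x \<in> X" shows "\<bar>Q f x\<bar> \<le> Q (\<lambda>y. \<bar>f y\<bar>) x"
proof -
  have "0 \<le> Q (\<lambda>y. \<bar>f y\<bar> - f y) x" "0 \<le> Q (\<lambda>y. \<bar>f y\<bar> + f y) x"
    unfolding Q_def using T_ge[OF x, of "\<lambda>y. \<bar>f y\<bar> - f y"] T_ge[OF x, of "\<lambda>y. \<bar>f y\<bar> + f y"] c by simp_all
  moreover have "Q (\<lambda>y. \<bar>f y\<bar> - f y) x = Q (\<lambda>y. \<bar>f y\<bar>) x - Q f x"
    "Q (\<lambda>y. \<bar>f y\<bar> + f y) x = Q (\<lambda>y. \<bar>f y\<bar>) x + Q f x"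
    using Q_linear[of 1 "\<lambda>y. \<bar>f y\<bar>" "-1" f] Q_linear[of 1 "\<lambda>y. \<bar>f y\<bar>" "1" f] by (simp_all add: fun_eq_iff)
  ultimately show ?thesis by linarith
qed

lemma Q_mass: "(\<Sum>x\<in>X. m x * Q f x) = (\<Sum>x\<in>X. m x * f x)"
proof -
  have "(\<Sum>x\<in>X. m x * Q f x) = (\<Sum>x\<in>X. (m x * T f x - c * (m x * f x)) / (1 - c))"
    by (intro sum.cong refl) (simp add: Q_def algebra_simps)
  also have "\<dots> = ((\<Sum>x\<in>X. m x * f x) - c * (\<Sum>x\<in>X. m x * f x)) / (1 - c)"
    by (simp add: sum_divide_distrib[symmetric] sum_subtractf T_mass sum_distrib_left)
  also have "\<dots> = (\<Sum>x\<in>X. m x * f x)" using c by (simp add: field_simps)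
  finally show ?thesis .
qed

lemma norm1_Q: "norm1 (Q f) \<le> norm1 f"
proof -
  have "norm1 (Q f) \<le> (\<Sum>x\<in>X. m x * Q (\<lambda>y. \<bar>f y\<bar>) x)"
    unfolding norm1_def by (intro sum_mono mult_left_mono Q_abs) auto
  then show ?thesis by (simp add: Q_mass norm1_def)
qed

lemma norm1_Q_pow: "norm1 ((Q ^^ k) f) \<le> norm1 f"
  by (induction k) (auto intro: order_trans[OF norm1_Q])

lemma norm1_triangle: "norm1 (\<lambda>x. f x - h x) \<le> norm1 (\<lambda>x. f x - g x) + norm1 (\<lambda>x. g x - h x)"
  unfolding norm1_def sum.distrib[symmetric] distrib_left[symmetric]
  by (intro sum_mono mult_left_mono) auto

lemma norm1_cong: "(\<And>x. x \<in> X \<Longrightarrow> f x = g x) \<Longrightarrow> norm1 f = norm1 g"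
  unfolding norm1_def by (intro sum.cong) auto

lemma norm1_nonneg: "0 \<le> norm1 f"
  unfolding norm1_def by (intro sum_nonneg) auto

lemma norm1_bernstein_sum:
  assumes p: "0 \<le> p" "p \<le> 1"
  shows "norm1 (\<lambda>x. bernstein_sum n p (\<lambda>k. g k x)) \<le> bernstein_sum n p (\<lambda>k. norm1 (g k))"
proof -
  have "norm1 (\<lambda>x. bernstein_sum n p (\<lambda>k. g k x)) \<le> (\<Sum>x\<in>X. m x * (\<Sum>k\<le>n. Bernstein n k p * \<bar>g k x\<bar>))"
    unfolding norm1_def bernstein_sum_def using Bernstein_nonneg[OF p]
    by (intro sum_mono mult_left_mono order_trans[OF sum_abs]) (auto simp: abs_mult)
  also have "\<dots> = bernstein_sum n p (\<lambda>k. norm1 (g k))"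
    unfolding bernstein_sum_def norm1_def sum_distrib_left
    by (subst sum.swap) (simp add: mult_ac)
  finally show ?thesis .
qed

lemma norm1_scale: "norm1 (\<lambda>x. a * f x) = \<bar>a\<bar> * norm1 f"
  by (simp add: norm1_def abs_mult sum_distrib_left mult_ac)

lemma norm1_T: "norm1 (T f) \<le> norm1 f"
proof -
  have "norm1 (T f) \<le> (\<Sum>x\<in>X. m x * T (\<lambda>y. \<bar>f y\<bar>) x)"
    unfolding norm1_def T_def
    by (intro sum_mono mult_left_mono order_trans[OF sum_abs]) (auto simp: abs_mult)
  then show ?thesis by (simp add: T_mass norm1_def)
qed

lemma norm1_T_pow: "norm1 ((T ^^ k) f) \<le> norm1 f"
  by (induction k) (auto intro: order_trans[OF norm1_T])

text \<open>In \<open>n + 1\<close> independent lazy steps, conditioning on whether the last one moves reweights the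
  binomial number of moves by a linear factor, so its effect is controlled by the standard deviation.\<close>

lemma norm1_T_pow_Suc_diff:
  "norm1 (\<lambda>x. (T ^^ Suc n) f x - (T ^^ n) f x) \<le> norm1 f / sqrt (c * Suc n)"
proof -
  define p where "p = 1 - c"
  have p: "0 < p" "p < 1" using c by (auto simp: p_def)
  have T: "T f = (\<lambda>x. (1 - p) * f x + p * Q f x)" for f
    using c by (simp add: p_def Q_def fun_eq_iff)
  have pow: "(T ^^ n) f x = bernstein_sum n p (\<lambda>k. (Q ^^ k) f x)" for n f x
    by (rule funpow_lazy_eq_bernstein_sum[OF Q_linear T])
  have "(T ^^ Suc n) f x - (T ^^ n) f x
    = bernstein_sum (Suc n) p (\<lambda>k. (k / Suc n - p) * (Q ^^ k) f x) / (1 - p)" for x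
  proof -
    have "(T ^^ Suc n) f x - (T ^^ n) f x = p * (1 * bernstein_sum n p (\<lambda>k. (Q ^^ Suc k) f x)
        + (-1) * bernstein_sum n p (\<lambda>k. (Q ^^ k) f x))"
      unfolding pow bernstein_sum_Suc by (simp add: algebra_simps)
    also have "\<dots> = p * bernstein_sum n p (\<lambda>k. (Q ^^ Suc k) f x - (Q ^^ k) f x)"
      unfolding bernstein_sum_linear[symmetric] by simp
    also have "\<dots> = bernstein_sum (Suc n) p (\<lambda>k. (k / Suc n - p) * (Q ^^ k) f x) / (1 - p)"
      using p bernstein_sum_diff[OF p, of n "\<lambda>k. (Q ^^ k) f x"] by simp
    finally show ?thesis .
  qed
  then have "norm1 (\<lambda>x. (T ^^ Suc n) f x - (T ^^ n) f x)
    = norm1 (\<lambda>x. 1 / (1 - p) * bernstein_sum (Suc n) p (\<lambda>k. (k / Suc n - p) * (Q ^^ k) f x))"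
    by (intro norm1_cong) simp
  also have "\<dots> \<le> 1 / (1 - p) * bernstein_sum (Suc n) p (\<lambda>k. norm1 (\<lambda>x. (k / Suc n - p) * (Q ^^ k) f x))"
    unfolding norm1_scale[of "1 / (1 - p)"]
    using p by (intro mult_mono norm1_bernstein_sum) (auto intro: norm1_nonneg)
  also have "\<dots> \<le> 1 / (1 - p) * bernstein_sum (Suc n) p (\<lambda>k. norm1 f / Suc n * \<bar>real k - Suc n * p\<bar>)"
  proof (intro mult_left_mono bernstein_sum_mono)
    fix k
    have "real k / Suc n - p = (real k - Suc n * p) / Suc n" by (simp add: field_simps)
    then have e: "\<bar>real k / Suc n - p\<bar> = \<bar>real k - Suc n * p\<bar> / Suc n" by simp
    have "\<bar>real k / Suc n - p\<bar> * norm1 ((Q ^^ k) f) \<le> \<bar>real k / Suc n - p\<bar> * norm1 f"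
      by (intro mult_left_mono norm1_Q_pow) auto
    then show "norm1 (\<lambda>x. (k / Suc n - p) * (Q ^^ k) f x) \<le> norm1 f / Suc n * \<bar>real k - Suc n * p\<bar>"
      unfolding norm1_scale e by (simp add: mult_ac)
  qed (use p in auto)
  also have "\<dots> = 1 / (1 - p) * (norm1 f / Suc n * bernstein_sum (Suc n) p (\<lambda>k. \<bar>real k - Suc n * p\<bar>))"
    unfolding bernstein_sum_cmult ..
  also have "\<dots> \<le> 1 / (1 - p) * (norm1 f / Suc n * sqrt (Suc n * p * (1 - p)))"
    using p norm1_nonneg by (intro mult_left_mono bernstein_sum_abs_deviation) auto
  also have "\<dots> \<le> 1 / (1 - p) * (norm1 f / Suc n * sqrt (Suc n * 1 * (1 - p)))"
    using p norm1_nonneg by (intro mult_left_mono real_sqrt_le_mono mult_right_mono) auto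
  also have "\<dots> = norm1 f / sqrt (c * Suc n)"
  proof -
    have "sqrt (c * Suc n) * sqrt (c * Suc n) = c * Suc n" using c by simp
    then have "sqrt (c * Suc n) / (c * Suc n) = 1 / sqrt (c * Suc n)"
      using c by (simp add: divide_simps)
    then have "norm1 f * (sqrt (c * Suc n) / (c * Suc n)) = norm1 f * (1 / sqrt (c * Suc n))" by simp
    then show ?thesis by (simp add: p_def mult_ac)
  qed
  finally show ?thesis .
qed

lemma norm1_T_pow_diff:
  assumes a: "0 < a"
  shows "norm1 (\<lambda>x. (T ^^ (a + i)) f x - (T ^^ (a + j)) f x) \<le> \<bar>real i - real j\<bar> * (norm1 f / sqrt (c * a))"
proof -
  have *: "norm1 (\<lambda>x. (T ^^ (a + (i + d))) f x - (T ^^ (a + i)) f x) \<le> d * (norm1 f / sqrt (c * a))" for d i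
  proof (induction d)
    case 0
    then show ?case by (simp add: norm1_def)
  next
    case (Suc d)
    have "norm1 (\<lambda>x. (T ^^ (a + (i + Suc d))) f x - (T ^^ (a + (i + d))) f x) \<le> norm1 f / sqrt (c * Suc (a + (i + d)))"
      using norm1_T_pow_Suc_diff[of "a + (i + d)" f] by simp
    also have "\<dots> \<le> norm1 f / sqrt (c * a)"
      using a c norm1_nonneg by (intro divide_left_mono) auto
    finally show ?case
      using Suc norm1_triangle[of "(T ^^ (a + (i + Suc d))) f" "(T ^^ (a + i)) f" "(T ^^ (a + (i + d))) f"]
      by (simp add: algebra_simps add_divide_distrib)
  qed
  have sym: "norm1 (\<lambda>x. f x - g x) = norm1 (\<lambda>x. g x - f x)" for f g
    by (simp add: norm1_def abs_minus_commute)
  show ?thesis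
  proof (cases "i \<le> j")
    case True
    then obtain d where "j = i + d" using le_Suc_ex by blast
    then show ?thesis using *[of i d] by (subst sym) simp
  next
    case False
    then obtain d where "i = j + d" using le_Suc_ex by (metis nat_le_linear)
    then show ?thesis using *[of j d] by simp
  qed
qed

definition U :: "real \<Rightarrow> ('s \<Rightarrow> real) \<Rightarrow> 's \<Rightarrow> real" where
  "U d f x = (1 - d) * f x + d * T f x"

lemma U_pow_eq: "(U d ^^ n) f x = bernstein_sum n d (\<lambda>k. (T ^^ k) f x)"
  by (rule funpow_lazy_eq_bernstein_sum[OF T_linear]) (simp add: U_def fun_eq_iff)

lemma T_pow_U_pow_eq: "(T ^^ a) ((U d ^^ n) f) x = bernstein_sum n d (\<lambda>k. (T ^^ (a + k)) f x)"
proof (induction a arbitrary: x)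
  case 0
  then show ?case by (simp add: U_pow_eq)
next
  case (Suc a)
  have "(T ^^ Suc a) ((U d ^^ n) f) x = T (\<lambda>x. bernstein_sum n d (\<lambda>k. (T ^^ (a + k)) f x)) x"
    by (simp, rule T_cong, rule Suc)
  also have "\<dots> = bernstein_sum n d (\<lambda>k. T ((T ^^ (a + k)) f) x)"
    unfolding T_def bernstein_sum_def sum_distrib_left
    by (subst sum.swap) (simp add: mult_ac)
  finally show ?case by simp
qed

text \<open>A binomial number of steps with mean \<open>s\<close> has standard deviation at most \<open>sqrt s\<close>, which the
  smoothing by \<open>a\<close> further steps does not resolve.\<close>

lemma norm1_T_pow_U_pow:
  assumes a: "0 < a" and d: "0 \<le> d" "d \<le> 1" "real n * d = real s"
  shows "norm1 (\<lambda>x. (T ^^ (a + s)) f x - (T ^^ a) ((U d ^^ n) f) x) \<le> norm1 f * sqrt (s / (c * a))"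
proof -
  have "norm1 (\<lambda>x. (T ^^ (a + s)) f x - (T ^^ a) ((U d ^^ n) f) x)
    = norm1 (\<lambda>x. bernstein_sum n d (\<lambda>k. (T ^^ (a + s)) f x - (T ^^ (a + k)) f x))"
  proof (rule norm1_cong)
    fix x
    show "(T ^^ (a + s)) f x - (T ^^ a) ((U d ^^ n) f) x
      = bernstein_sum n d (\<lambda>k. (T ^^ (a + s)) f x - (T ^^ (a + k)) f x)"
      using bernstein_sum_linear[of n d 1 "\<lambda>k. (T ^^ (a + s)) f x" "-1" "\<lambda>k. (T ^^ (a + k)) f x"]
      by (simp add: T_pow_U_pow_eq bernstein_sum_const)
  qed
  also have "\<dots> \<le> bernstein_sum n d (\<lambda>k. norm1 (\<lambda>x. (T ^^ (a + s)) f x - (T ^^ (a + k)) f x))"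
    by (rule norm1_bernstein_sum[OF d(1,2)])
  also have "\<dots> \<le> bernstein_sum n d (\<lambda>k. (norm1 f / sqrt (c * a)) * \<bar>real k - n * d\<bar>)"
  proof (intro bernstein_sum_mono d)
    fix k
    have "norm1 (\<lambda>x. (T ^^ (a + s)) f x - (T ^^ (a + k)) f x) \<le> \<bar>real s - real k\<bar> * (norm1 f / sqrt (c * a))"
      by (rule norm1_T_pow_diff[OF a])
    then show "norm1 (\<lambda>x. (T ^^ (a + s)) f x - (T ^^ (a + k)) f x)
      \<le> (norm1 f / sqrt (c * a)) * \<bar>real k - n * d\<bar>"
      unfolding d(3) by (simp add: abs_minus_commute mult.commute)
  qed
  also have "\<dots> = norm1 f / sqrt (c * a) * bernstein_sum n d (\<lambda>k. \<bar>real k - n * d\<bar>)"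
    by (rule bernstein_sum_cmult)
  also have "\<dots> \<le> norm1 f / sqrt (c * a) * sqrt (n * d * (1 - d))"
    using norm1_nonneg c by (intro mult_left_mono bernstein_sum_abs_deviation d) auto
  also have "\<dots> \<le> norm1 f / sqrt (c * a) * sqrt s"
    using norm1_nonneg c d by (intro mult_left_mono real_sqrt_le_mono) (auto intro: mult_left_le)
  finally show ?thesis by (simp add: real_sqrt_divide)
qed

end

section \<open>Mixing from the modified log-Sobolev inequality\<close>

text \<open>This is \<open>ln t \<le> t - 1\<close> at \<open>t = b / a\<close>. The remainder has
  only the old value \<open>a\<close> in its denominator, so a lower bound on \<open>a\<close> alone
  controls it.\<close>

lemma x_ln_x_le_taylor:
  fixes a b :: real
  assumes "0 < a" "0 < b"
  shows "b * ln b \<le> a * ln a + (b - a) * (ln a + 1) + (b - a)\<^sup>2 / a"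
proof -
  have "b * ln (b / a) \<le> b * (b / a - 1)"
    using assms ln_le_minus_one[of "b / a"] by (intro mult_left_mono) auto
  moreover have "b * (b / a - 1) = (b - a) + (b - a)\<^sup>2 / a"
    using assms by (simp add: field_simps power2_eq_square)
  moreover have "b * ln (b / a) = b * ln b - b * ln a" using assms by (simp add: ln_div algebra_simps)
  ultimately show ?thesis by (simp add: algebra_simps)
qed

text \<open>With \<open>y = sqrt h\<close> this is \<open>ln y \<ge> 1 - 1 / y\<close> multiplied by
  \<open>2 * y^2\<close>.\<close>

lemma hellinger_le_entropy:
  fixes h :: real
  assumes "0 < h"
  shows "(sqrt h - 1)\<^sup>2 \<le> h * ln h - h + 1"
proof -
  define y where "y = sqrt h"
  have y: "0 < y" "h = y\<^sup>2" using assms by (auto simp: y_def)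
  from y have "2 * y\<^sup>2 * (1 - 1 / y) \<le> 2 * y\<^sup>2 * ln y"
    using one_minus_inverse_le_ln[of y] by (intro mult_left_mono) auto
  also have "2 * y\<^sup>2 * (1 - 1 / y) = 2 * y\<^sup>2 - 2 * y" using y by (simp add: field_simps power2_eq_square)
  finally have "2 * y\<^sup>2 - 2 * y \<le> 2 * y\<^sup>2 * ln y" .
  moreover have "h * ln h = 2 * y\<^sup>2 * ln y" using y by (simp add: ln_realpow)
  moreover have "(y - 1)\<^sup>2 = y\<^sup>2 - 2 * y + 1" by (simp add: power2_eq_square algebra_simps)
  ultimately show ?thesis unfolding y_def[symmetric] using y(2) by linarith
qed

section \<open>Entropy decay for small steps and its consequence for mixing\<close>

context lazy_reversible_chain
begin

definition ent :: "('s \<Rightarrow> real) \<Rightarrow> real" where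
  "ent f = (\<Sum>x\<in>X. m x * (f x * ln (f x)))"

lemma U_mass: "(\<Sum>x\<in>X. m x * U d f x) = (\<Sum>x\<in>X. m x * f x)"
proof -
  have "(\<Sum>x\<in>X. m x * U d f x) = (1 - d) * (\<Sum>x\<in>X. m x * f x) + d * (\<Sum>x\<in>X. m x * T f x)"
    by (simp add: U_def algebra_simps sum.distrib sum_distrib_left sum_subtractf)
  then show ?thesis by (simp add: T_mass algebra_simps)
qed

lemma U_bounds:
  assumes d: "0 \<le> d" "d \<le> 1" and f: "\<And>x. x \<in> X \<Longrightarrow> \<eta> \<le> f x" "\<And>x. x \<in> X \<Longrightarrow> f x \<le> F" and x: "x \<in> X"
  shows "\<eta> \<le> U d f x" "U d f x \<le> F"
proof -
  have T: "\<eta> \<le> T f x" "T f x \<le> F"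
    using T_mono[of "\<lambda>_. \<eta>" f x] T_mono[of f "\<lambda>_. F" x] f x by (simp_all add: T_const)
  have "(1 - d) * \<eta> + d * \<eta> \<le> U d f x" "U d f x \<le> (1 - d) * F + d * F"
    unfolding U_def using T f[OF x] d by (auto intro!: add_mono mult_left_mono)
  then show "\<eta> \<le> U d f x" "U d f x \<le> F" by (simp_all add: algebra_simps)
qed

text \<open>The first-order term in \<open>d\<close> is minus the Dirichlet form, as
  self-adjointness moves \<open>T\<close> from \<open>ln f\<close> to \<open>f\<close>. The bounds
  on \<open>f\<close> serve only the remainder of order \<open>d^2\<close>.\<close>

lemma ent_U_le:
  assumes d: "0 \<le> d" "d \<le> 1" and \<eta>: "0 < \<eta>"
    and f: "\<And>x. x \<in> X \<Longrightarrow> \<eta> \<le> f x" "\<And>x. x \<in> X \<Longrightarrow> f x \<le> F" "(\<Sum>x\<in>X. m x * f x) = 1"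
    and mls: "modified_log_sobolev \<mu> P \<rho>"
  shows "ent (U d f) \<le> (1 - d * \<rho>) * ent f + d\<^sup>2 * (F\<^sup>2 / \<eta>)"
proof -
  have f0: "0 < f x" if "x \<in> X" for x using f(1)[OF that] \<eta> by simp
  have e: "measure_pmf.expectation \<mu> g = (\<Sum>x\<in>X. m x * g x)" for g :: "'s \<Rightarrow> real"
    by (rule expectation_eq_sum[OF fin])
  have "\<rho> * Ent \<mu> f \<le> dirichlet_form \<mu> P f (\<lambda>x. ln (f x))"
    using mls f0 by (auto simp: modified_log_sobolev_def)
  moreover have "Ent \<mu> f = ent f" unfolding Ent_def e f(3) by (simp add: ent_def)
  moreover have "dirichlet_form \<mu> P f (\<lambda>x. ln (f x)) = (\<Sum>x\<in>X. m x * (f x * ln (f x))) - (\<Sum>x\<in>X. m x * (f x * T (\<lambda>x. ln (f x)) x))"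
    unfolding dirichlet_form_def sum_subtractf[symmetric]
    by (intro sum.cong refl) (simp add: expectation_P algebra_simps)
  ultimately have D: "\<rho> * ent f \<le> (\<Sum>x\<in>X. m x * (f x * ln (f x))) - (\<Sum>x\<in>X. m x * (T f x * ln (f x)))"
    by (simp add: T_self_adjoint)
  have "ent (U d f) \<le> (\<Sum>x\<in>X. m x * (f x * ln (f x) + (U d f x - f x) * (ln (f x) + 1) + d\<^sup>2 * (F\<^sup>2 / \<eta>)))"
    unfolding ent_def
  proof (intro sum_mono mult_left_mono)
    fix x assume x: "x \<in> X"
    have "0 < U d f x" using U_bounds(1)[of d \<eta> f F x] d f(1,2) x \<eta> by fastforce
    from x_ln_x_le_taylor[OF f0[OF x] this]
    have "U d f x * ln (U d f x) \<le> f x * ln (f x) + (U d f x - f x) * (ln (f x) + 1) + (U d f x - f x)\<^sup>2 / f x" .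
    also have "(U d f x - f x)\<^sup>2 / f x \<le> d\<^sup>2 * (F\<^sup>2 / \<eta>)"
    proof -
      have "\<eta> \<le> T f x" "T f x \<le> F"
        using T_mono[of "\<lambda>_. \<eta>" f x] T_mono[of f "\<lambda>_. F" x] f x by (simp_all add: T_const)
      then have "\<bar>T f x - f x\<bar> \<le> F" using f(1,2)[OF x] \<eta> by linarith
      then have "(T f x - f x)\<^sup>2 \<le> F\<^sup>2" by (metis abs_le_square_iff abs_of_nonneg abs_ge_zero order_trans)
      then have "(T f x - f x)\<^sup>2 / f x \<le> F\<^sup>2 / \<eta>"
        using f(1)[OF x] \<eta> by (intro frac_le) auto
      then have "d\<^sup>2 * ((T f x - f x)\<^sup>2 / f x) \<le> d\<^sup>2 * (F\<^sup>2 / \<eta>)" by (rule mult_left_mono) simp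
      moreover have "U d f x - f x = d * (T f x - f x)" by (simp add: U_def algebra_simps)
      ultimately show ?thesis by (simp add: power_mult_distrib)
    qed
    finally show "U d f x * ln (U d f x) \<le> f x * ln (f x) + (U d f x - f x) * (ln (f x) + 1) + d\<^sup>2 * (F\<^sup>2 / \<eta>)"
      by simp
  qed simp
  also have "\<dots> = (\<Sum>x\<in>X. m x * (f x * ln (f x))
      + (d * (m x * (T f x * ln (f x))) - d * (m x * (f x * ln (f x))))
      + (m x * U d f x - m x * f x) + d\<^sup>2 * (F\<^sup>2 / \<eta>) * m x)"
    by (intro sum.cong refl) (simp add: U_def algebra_simps)
  also have "\<dots> = ent f + d * ((\<Sum>x\<in>X. m x * (T f x * ln (f x))) - (\<Sum>x\<in>X. m x * (f x * ln (f x))))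
      + d\<^sup>2 * (F\<^sup>2 / \<eta>)"
    by (simp only: sum.distrib sum_subtractf sum_distrib_left[symmetric] U_mass sum_m ent_def
        right_diff_distrib)
  also have "\<dots> \<le> ent f + d * (- (\<rho> * ent f)) + d\<^sup>2 * (F\<^sup>2 / \<eta>)"
    using D d by (intro add_mono mult_left_mono) auto
  finally show ?thesis by (simp add: algebra_simps)
qed

lemma U_pow_bounds:
  assumes d: "0 \<le> d" "d \<le> 1" and f: "\<And>x. x \<in> X \<Longrightarrow> \<eta> \<le> f x" "\<And>x. x \<in> X \<Longrightarrow> f x \<le> F"
    "(\<Sum>x\<in>X. m x * f x) = 1"
  shows "(\<forall>x\<in>X. \<eta> \<le> (U d ^^ k) f x \<and> (U d ^^ k) f x \<le> F) \<and> (\<Sum>x\<in>X. m x * (U d ^^ k) f x) = 1"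
proof (induction k)
  case 0
  then show ?case using f by simp
next
  case (Suc k)
  then show ?case using U_bounds[OF d, of \<eta> "(U d ^^ k) f" F] by (simp add: U_mass)
qed

text \<open>The errors of order \<open>d^2\<close> add up to a geometric series of ratio
  \<open>1 - d * \<rho>\<close>, which leaves one factor \<open>d\<close>; the accumulated error
  vanishes as \<open>d\<close> tends to 0.\<close>

lemma ent_U_pow_le:
  assumes d: "0 < d" "d \<le> 1" "d * \<rho> \<le> 1" and \<rho>: "0 < \<rho>" and \<eta>: "0 < \<eta>"
    and f: "\<And>x. x \<in> X \<Longrightarrow> \<eta> \<le> f x" "\<And>x. x \<in> X \<Longrightarrow> f x \<le> F" "(\<Sum>x\<in>X. m x * f x) = 1"
    and mls: "modified_log_sobolev \<mu> P \<rho>"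
  shows "ent ((U d ^^ k) f) \<le> (1 - d * \<rho>) ^ k * ent f + d * (F\<^sup>2 / (\<eta> * \<rho>))"
proof (induction k)
  case 0
  then show ?case using d \<rho> \<eta> by simp
next
  case (Suc k)
  have "ent (U d ((U d ^^ k) f)) \<le> (1 - d * \<rho>) * ent ((U d ^^ k) f) + d\<^sup>2 * (F\<^sup>2 / \<eta>)"
    using U_pow_bounds[of d \<eta> f F k] d \<eta> f mls by (intro ent_U_le) auto
  also have "\<dots> \<le> (1 - d * \<rho>) * ((1 - d * \<rho>) ^ k * ent f + d * (F\<^sup>2 / (\<eta> * \<rho>))) + d\<^sup>2 * (F\<^sup>2 / \<eta>)"
    using Suc d by (intro add_right_mono mult_left_mono) auto
  also have "\<dots> = (1 - d * \<rho>) ^ Suc k * ent f + d * (F\<^sup>2 / (\<eta> * \<rho>))"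
    using \<rho> \<eta> by (simp add: field_simps power2_eq_square)
  finally show ?case by simp
qed

text \<open>A Pinsker-type bound by Cauchy-Schwarz on \<open>(sqrt f - 1) * (sqrt f + 1)\<close>:
  the squared norm of the first factor is at most the entropy, that of the second at most 4.\<close>

lemma norm1_le_entropy:
  assumes f: "\<And>x. x \<in> X \<Longrightarrow> 0 < f x" "(\<Sum>x\<in>X. m x * f x) = 1"
  shows "norm1 (\<lambda>x. f x - 1) \<le> 2 * sqrt (ent f)"
proof -
  have h: "(\<Sum>x\<in>X. m x * (sqrt (f x) - 1)\<^sup>2) \<le> ent f"
  proof -
    have "(\<Sum>x\<in>X. m x * (sqrt (f x) - 1)\<^sup>2) \<le> (\<Sum>x\<in>X. m x * (f x * ln (f x) - f x + 1))"
      using f(1) by (intro sum_mono mult_left_mono hellinger_le_entropy) auto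
    also have "\<dots> = ent f - (\<Sum>x\<in>X. m x * f x) + (\<Sum>x\<in>X. m x)"
      by (simp add: ent_def algebra_simps sum.distrib sum_subtractf)
    finally show ?thesis by (simp add: f(2) sum_m)
  qed
  have "0 \<le> (\<Sum>x\<in>X. m x * (sqrt (f x) - 1)\<^sup>2)" by (intro sum_nonneg) auto
  then have ent0: "0 \<le> ent f" using h by linarith
  have p: "(\<Sum>x\<in>X. m x * (sqrt (f x) + 1)\<^sup>2) \<le> 4"
  proof -
    have "(\<Sum>x\<in>X. m x * (sqrt (f x) + 1)\<^sup>2) \<le> (\<Sum>x\<in>X. m x * (2 * f x + 2))"
    proof (intro sum_mono mult_left_mono)
      fix x assume "x \<in> X"
      then have "(sqrt (f x))\<^sup>2 = f x" using f(1) by (simp add: less_imp_le)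
      moreover have "0 \<le> (sqrt (f x) - 1)\<^sup>2" by simp
      ultimately show "(sqrt (f x) + 1)\<^sup>2 \<le> 2 * f x + 2" by (simp add: power2_eq_square algebra_simps)
    qed simp
    also have "\<dots> = 2 * (\<Sum>x\<in>X. m x * f x) + 2 * (\<Sum>x\<in>X. m x)"
      by (simp add: algebra_simps sum.distrib sum_distrib_left)
    finally show ?thesis by (simp add: f(2) sum_m)
  qed
  have "norm1 (\<lambda>x. f x - 1) = (\<Sum>x\<in>X. \<bar>sqrt (m x) * (sqrt (f x) - 1)\<bar> * \<bar>sqrt (m x) * (sqrt (f x) + 1)\<bar>)"
    unfolding norm1_def
  proof (rule sum.cong[OF refl])
    fix x assume "x \<in> X"
    then have "f x - 1 = (sqrt (f x) - 1) * (sqrt (f x) + 1)" using f(1)[of x] by (simp add: algebra_simps)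
    moreover have "m x = sqrt (m x) * sqrt (m x)" by simp
    ultimately show "m x * \<bar>f x - 1\<bar> = \<bar>sqrt (m x) * (sqrt (f x) - 1)\<bar> * \<bar>sqrt (m x) * (sqrt (f x) + 1)\<bar>"
      by (simp only: abs_mult) (simp add: mult_ac)
  qed
  also have "\<dots> \<le> L2_set (\<lambda>x. sqrt (m x) * (sqrt (f x) - 1)) X * L2_set (\<lambda>x. sqrt (m x) * (sqrt (f x) + 1)) X"
    by (rule L2_set_mult_ineq)
  also have "\<dots> \<le> sqrt (ent f) * sqrt 4"
    unfolding L2_set_def using h p ent0
    by (intro mult_mono real_sqrt_le_mono) (auto simp: power_mult_distrib intro!: sum_nonneg)
  finally show ?thesis by (simp add: mult.commute)
qed

text \<open>Reversibility turns the evolution of the law into the action of \<open>T\<close> on its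
  density, started at the density \<open>h\<close> of the point mass.\<close>

lemma chain_power_density:
  assumes x: "x \<in> X"
  defines "h \<equiv> \<lambda>y. if y = x then 1 / m x else 0"
  shows "set_pmf (chain_power P t x) \<subseteq> X \<and> (\<forall>y\<in>X. pmf (chain_power P t x) y = m y * (T ^^ t) h y)"
proof (induction t)
  case 0
  then show ?case using x m_pos[OF x] by (simp add: chain_power_def h_def)
next
  case (Suc t)
  have s: "chain_power P (Suc t) x = bind_pmf (chain_power P t x) P" by (simp add: chain_power_def)
  have "pmf (chain_power P (Suc t) x) y = m y * (T ^^ Suc t) h y" if y: "y \<in> X" for y
  proof -
    have "pmf (chain_power P (Suc t) x) y = (\<Sum>z\<in>X. pmf (P z) y * pmf (chain_power P t x) z)"
      unfolding s pmf_bind using fin Suc by (intro integral_measure_pmf_real) auto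
    also have "\<dots> = (\<Sum>z\<in>X. m y * (pmf (P y) z * (T ^^ t) h z))"
      using Suc y reversible by (intro sum.cong) auto
    finally show ?thesis by (simp add: T_def[of "(T ^^ t) h"] sum_distrib_left)
  qed
  then show ?case unfolding s using Suc closed by auto
qed

lemma tv_dist_le_norm1:
  assumes x: "x \<in> X"
  defines "h \<equiv> \<lambda>y. if y = x then 1 / m x else 0"
  shows "tv_dist (chain_power P t x) \<mu> \<le> norm1 (\<lambda>y. (T ^^ t) h y - 1)"
  unfolding tv_dist_def
proof (rule cSUP_least)
  fix A :: "'s set"
  have *: "measure_pmf.prob \<nu> A = (\<Sum>y\<in>X \<inter> A. pmf \<nu> y)" if "set_pmf \<nu> \<subseteq> X" for \<nu>
  proof -
    have "measure_pmf.prob \<nu> A = measure_pmf.prob \<nu> (X \<inter> A)"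
      using that by (intro measure_pmf.finite_measure_eq_AE) (auto simp: AE_measure_pmf_iff)
    then show ?thesis using fin by (simp add: measure_measure_pmf_finite)
  qed
  define \<nu> where "\<nu> = chain_power P t x"
  have \<nu>: "set_pmf \<nu> \<subseteq> X" "\<And>y. y \<in> X \<Longrightarrow> pmf \<nu> y = m y * (T ^^ t) h y"
    using chain_power_density[OF x, of t] unfolding \<nu>_def h_def by auto
  have "\<bar>measure_pmf.prob \<nu> A - measure_pmf.prob \<mu> A\<bar> = \<bar>\<Sum>y\<in>X \<inter> A. m y * ((T ^^ t) h y - 1)\<bar>"
    unfolding *[OF \<nu>(1)] *[OF order_refl] sum_subtractf[symmetric]
    by (intro arg_cong[where f = abs] sum.cong) (auto simp: \<nu>(2) algebra_simps)
  also have "\<dots> \<le> (\<Sum>y\<in>X \<inter> A. m y * \<bar>(T ^^ t) h y - 1\<bar>)"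
    by (rule order_trans[OF sum_abs]) (simp add: abs_mult)
  also have "\<dots> \<le> norm1 (\<lambda>y. (T ^^ t) h y - 1)"
    unfolding norm1_def using fin by (intro sum_mono2) auto
  finally show "\<bar>measure_pmf.prob \<nu> A - measure_pmf.prob \<mu> A\<bar> \<le> norm1 (\<lambda>y. (T ^^ t) h y - 1)" .
qed simp

text \<open>A binomial number of steps of mean \<open>s\<close> brings the entropy down from at most
  \<open>L\<close> by about \<open>exp (- \<rho> * s)\<close>; \<open>K * s\<close> further steps
  make this number indistinguishable from \<open>s\<close> itself.\<close>

lemma tv_dist_le_quarter:
  assumes mls: "modified_log_sobolev \<mu> P \<rho>" and \<rho>: "0 < \<rho>"
    and x: "x \<in> X" and L: "0 < L" "ln (1 / m x) \<le> L"
    and s: "0 < s" "(ln L + 8) / \<rho> \<le> real s" and K: "64 / c \<le> real K" "0 < K"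
  shows "tv_dist (chain_power P (K * s + s) x) \<mu> \<le> 1 / 4"
proof -
  define h where "h = (\<lambda>y. if y = x then 1 / m x else 0)"
  \<comment> \<open>Mixing the point mass with equilibrium bounds the density below by 1/2, as the
    entropy estimate for \<open>U\<close> requires.\<close>
  define f where "f = (\<lambda>y. 1 / 2 * h y + 1 / 2 * 1)"
  define F where "F = 1 / m x"
  have mx: "0 < m x" "m x \<le> 1" using m_pos[OF x] by (auto simp: pmf_le_1)
  have h_mass: "(\<Sum>y\<in>X. m y * h y) = 1"
  proof -
    have "(\<Sum>y\<in>X. m y * h y) = (\<Sum>y\<in>X. if y = x then 1 else 0)"
      using mx by (intro sum.cong) (auto simp: h_def)
    then show ?thesis using fin x by simp
  qed
  have h0: "0 \<le> h y" for y by (simp add: h_def)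
  then have h_norm: "norm1 h = 1" using h_mass by (simp add: norm1_def)
  have f_mass: "(\<Sum>y\<in>X. m y * f y) = 1"
    using h_mass sum_m
    by (simp add: f_def distrib_left sum.distrib sum_divide_distrib[symmetric])
  have f_lo: "1 / 2 \<le> f y" for y using h0[of y] by (simp add: f_def)
  have f_hi: "f y \<le> F" for y using mx by (auto simp: f_def h_def F_def field_simps)
  have ent_f: "ent f \<le> L"
  proof -
    have "ent f \<le> (\<Sum>y\<in>X. m y * (f y * ln F))"
      unfolding ent_def
    proof (intro sum_mono mult_left_mono)
      fix y
      have "0 < f y" using f_lo[of y] by simp
      then show "ln (f y) \<le> ln F" "0 \<le> f y" using f_hi[of y] by auto
    qed simp
    also have "\<dots> = (\<Sum>y\<in>X. m y * f y) * ln F" by (simp add: sum_distrib_right mult.assoc)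
    finally show ?thesis using L by (simp add: f_mass F_def)
  qed
  \<comment> \<open>Chosen so that \<open>d = 1 / l\<close> satisfies \<open>d \<le> 1\<close>,
    \<open>d * \<rho> \<le> 1\<close> and keeps the accumulated error below 1/2048. Although
    \<open>l\<close> depends on the mass of \<open>x\<close>, only \<open>n * d = s\<close> enters
    the time.\<close>
  define B where "B = 1 + \<rho> + 2048 * (F\<^sup>2 / (1 / 2 * \<rho>))"
  define l where "l = nat \<lceil>B\<rceil>"
  have B: "1 \<le> B" using \<rho> by (simp add: B_def)
  then have lB: "B \<le> real l" unfolding l_def by linarith
  have l: "0 < real l" using B lB by linarith
  define d where "d = 1 / real l"
  define n where "n = l * s"
  have d0: "0 < d" using l by (simp add: d_def)
  have "1 \<le> real l" "\<rho> \<le> real l" "2048 * (F\<^sup>2 / (1 / 2 * \<rho>)) \<le> real l"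
  proof -
    have "0 \<le> 2048 * (F\<^sup>2 / (1 / 2 * \<rho>))" using \<rho> by simp
    then show "1 \<le> real l" "\<rho> \<le> real l" "2048 * (F\<^sup>2 / (1 / 2 * \<rho>)) \<le> real l"
      using lB \<rho> unfolding B_def by linarith+
  qed
  moreover have "1 / real l * Y \<le> 1 / 2048" if "2048 * Y \<le> real l" for Y
    using that l by (simp add: field_simps)
  ultimately have d1: "d \<le> 1" and d2: "d * \<rho> \<le> 1" and d3: "d * (F\<^sup>2 / (1 / 2 * \<rho>)) \<le> 1 / 2048"
  proof -
    assume *: "1 \<le> real l" "\<rho> \<le> real l" "2048 * (F\<^sup>2 / (1 / 2 * \<rho>)) \<le> real l"
      "\<And>Y. 2048 * Y \<le> real l \<Longrightarrow> 1 / real l * Y \<le> 1 / 2048"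
    show "d \<le> 1" "d * \<rho> \<le> 1" using * l by (simp_all add: d_def)
    show "d * (F\<^sup>2 / (1 / 2 * \<rho>)) \<le> 1 / 2048" unfolding d_def by (rule *(4)[OF *(3)])
  qed
  have nd: "real n * d = real s" using l by (simp add: n_def d_def)
  have ent: "ent ((U d ^^ n) f) \<le> 1 / 1024"
  proof -
    have "ent ((U d ^^ n) f) \<le> (1 - d * \<rho>) ^ n * ent f + d * (F\<^sup>2 / (1 / 2 * \<rho>))"
      using f_lo f_hi f_mass mls \<rho> d0 d1 d2 by (intro ent_U_pow_le) auto
    also have "(1 - d * \<rho>) ^ n * ent f \<le> (1 - d * \<rho>) ^ n * L"
      using d2 ent_f by (intro mult_left_mono) auto
    also have "\<dots> \<le> exp (- (d * \<rho>)) ^ n * L"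
      using d2 L exp_ge_add_one_self[of "- (d * \<rho>)"] by (intro mult_right_mono power_mono) auto
    also have "exp (- (d * \<rho>)) ^ n * L = exp (ln L - \<rho> * s)"
    proof -
      have "exp (- (d * \<rho>)) ^ n = exp (real n * (- (d * \<rho>)))" by (rule exp_of_nat_mult[symmetric])
      also have "real n * (- (d * \<rho>)) = - (\<rho> * s)" unfolding nd[symmetric] by simp
      finally show ?thesis using L by (simp add: exp_diff exp_minus field_simps)
    qed
    also have "\<dots> \<le> exp (- 8)"
      using s \<rho> by (simp add: field_simps)
    \<comment> \<open>The number \<open>13 / 8 = 1 + 1 / 2 + 1 / 8\<close> is the quadratic Taylor
      bound for \<open>exp (1 / 2)\<close>, and its 16th power exceeds 2048.\<close>
    also have "exp (- 8 :: real) \<le> 1 / 2048"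
    proof -
      have "13 / 8 \<le> exp (1 / 2 :: real)"
        using exp_lower_Taylor_quadratic[of "1 / 2"] by (simp add: power2_eq_square)
      then have "(13 / 8 :: real) ^ 16 \<le> exp (1 / 2) ^ 16" by (intro power_mono) auto
      moreover have "2048 \<le> (13 / 8 :: real) ^ 16" by (simp add: power_divide)
      moreover have "exp (1 / 2 :: real) ^ 16 = exp 8" by (simp flip: exp_of_nat_mult)
      ultimately have "2048 \<le> exp (8 :: real)" by linarith
      then show ?thesis by (simp add: exp_minus field_simps)
    qed
    finally show ?thesis using d3 by simp
  qed
  \<comment> \<open>Each part gets 1/8: the smoothing error is \<open>sqrt (1 / (c * K))\<close>
    with \<open>c * K \<ge> 64\<close>, the entropy part is
    \<open>4 * sqrt (1 / 1024)\<close>.\<close>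
  have "norm1 (\<lambda>y. (T ^^ (K * s + s)) h y - 1)
    \<le> norm1 (\<lambda>y. (T ^^ (K * s + s)) h y - (T ^^ (K * s)) ((U d ^^ n) h) y)
      + norm1 (\<lambda>y. (T ^^ (K * s)) ((U d ^^ n) h) y - 1)"
    by (rule norm1_triangle)
  also have "norm1 (\<lambda>y. (T ^^ (K * s + s)) h y - (T ^^ (K * s)) ((U d ^^ n) h) y) \<le> 1 / 8"
  proof -
    have "norm1 (\<lambda>y. (T ^^ (K * s + s)) h y - (T ^^ (K * s)) ((U d ^^ n) h) y)
      \<le> norm1 h * sqrt (s / (c * (K * s)))"
      using K s d0 d1 nd by (intro norm1_T_pow_U_pow) auto
    also have "\<dots> \<le> sqrt (1 / 64)"
      unfolding h_norm using s K c by (simp add: field_simps)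
    also have "sqrt (1 / 64 :: real) = 1 / 8" by (rule real_sqrt_unique) (auto simp: power2_eq_square)
    finally show ?thesis .
  qed
  also have "norm1 (\<lambda>y. (T ^^ (K * s)) ((U d ^^ n) h) y - 1) \<le> 1 / 8"
  proof -
    define u where "u = (U d ^^ n) f"
    have one: "x \<in> X \<Longrightarrow> (T ^^ a) (\<lambda>_. 1) x = 1" for a x
    proof (induction a arbitrary: x)
      case (Suc a)
      have "T ((T ^^ a) (\<lambda>_. 1)) x = T (\<lambda>_. 1) x" using Suc by (intro T_cong) auto
      then show ?case using Suc.prems by (simp add: T_const)
    qed simp
    \<comment> \<open>Constants are fixed by \<open>U d\<close> and \<open>h = 2 * f - 1\<close>, so
      the deviation of \<open>h\<close> from 1 is twice that of \<open>f\<close>.\<close>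
    have Uh: "(U d ^^ n) h y = 2 * u y - 1" if "y \<in> X" for y
    proof -
      have "u y = bernstein_sum n d (\<lambda>k. 1 / 2 * (T ^^ k) h y + 1 / 2 * (T ^^ k) (\<lambda>_. 1) y)"
        unfolding u_def U_pow_eq f_def T_pow_linear ..
      also have "\<dots> = 1 / 2 * (U d ^^ n) h y + 1 / 2"
        unfolding bernstein_sum_linear U_pow_eq[symmetric] using one[OF that]
        by (simp add: U_pow_eq bernstein_sum_const)
      finally show ?thesis by simp
    qed
    have cong: "(\<And>y. y \<in> X \<Longrightarrow> f y = g y) \<Longrightarrow> y \<in> X \<Longrightarrow> (T ^^ a) f y = (T ^^ a) g y" for a f g y
      by (induction a arbitrary: y) (auto intro: T_cong)
    have "norm1 (\<lambda>y. (T ^^ (K * s)) ((U d ^^ n) h) y - 1) = norm1 ((T ^^ (K * s)) (\<lambda>y. 2 * (u y - 1)))"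
    proof (rule norm1_cong)
      fix y assume y: "y \<in> X"
      have "(T ^^ (K * s)) (\<lambda>y. 2 * (u y - 1)) y = (T ^^ (K * s)) (\<lambda>y. 1 * (U d ^^ n) h y + (-1) * 1) y"
        by (rule cong[OF _ y]) (simp add: Uh)
      then show "(T ^^ (K * s)) ((U d ^^ n) h) y - 1 = (T ^^ (K * s)) (\<lambda>y. 2 * (u y - 1)) y"
        unfolding T_pow_linear by (simp add: one[OF y])
    qed
    also have "\<dots> \<le> norm1 (\<lambda>y. 2 * (u y - 1))" by (rule norm1_T_pow)
    also have "\<dots> = 2 * norm1 (\<lambda>y. u y - 1)" unfolding norm1_scale by simp
    also have "\<dots> \<le> 2 * (2 * sqrt (ent u))"
    proof -
      have "(\<forall>y\<in>X. 1 / 2 \<le> u y \<and> u y \<le> F) \<and> (\<Sum>y\<in>X. m y * u y) = 1"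
        unfolding u_def using f_lo f_hi f_mass d0 d1 by (intro U_pow_bounds) auto
      then show ?thesis by (intro mult_left_mono norm1_le_entropy) auto
    qed
    also have "\<dots> \<le> 2 * (2 * sqrt (1 / 1024))"
      using ent unfolding u_def by (intro mult_left_mono real_sqrt_le_mono) auto
    also have "sqrt (1 / 1024 :: real) = 1 / 32" by (rule real_sqrt_unique) (auto simp: power2_eq_square)
    finally show ?thesis by simp
  qed
  finally show ?thesis using tv_dist_le_norm1[OF x, of "K * s + s"] unfolding h_def by linarith
qed

lemma mixing_time_le:
  assumes mls: "modified_log_sobolev \<mu> P \<rho>" and \<rho>: "0 < \<rho>"
    and L: "0 < L" "\<And>x. x \<in> X \<Longrightarrow> ln (1 / m x) \<le> L"
    and s: "0 < s" "(ln L + 8) / \<rho> \<le> real s" and K: "64 / c \<le> real K" "0 < K"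
  shows "mixing_time \<mu> P \<le> enat (K * s + s)"
  unfolding mixing_time_def
proof (rule SUP_least)
  fix x assume x: "x \<in> X"
  have "tv_dist (chain_power P (K * s + s) x) \<mu> \<le> 1 / 4"
    using assms x by (intro tv_dist_le_quarter[where \<rho> = \<rho> and L = L]) auto
  then show "(INF t\<in>{t. tv_dist (chain_power P t x) \<mu> \<le> 1 / 4}. enat t) \<le> enat (K * s + s)"
    by (intro INF_lower) simp
qed

end

section \<open>Mixing times\<close>

lemma (in lazy_reversible_chain) mixing_time_le_real:
  assumes mls: "modified_log_sobolev \<mu> P \<rho>" and \<rho>: "0 < \<rho>"
    and L: "1 \<le> L" "\<And>x. x \<in> X \<Longrightarrow> ln (1 / m x) \<le> L"
  shows "ereal_of_enat (mixing_time \<mu> P) \<le> ereal ((real (nat \<lceil>64 / c\<rceil>) + 2) * ((ln L + 8) / \<rho> + 2))"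
proof -
  define K where "K = nat \<lceil>64 / c\<rceil> + 1"
  define s where "s = nat \<lceil>(ln L + 8) / \<rho>\<rceil> + 1"
  have L0: "0 \<le> (ln L + 8) / \<rho>" using L \<rho> by simp
  have K: "64 / c \<le> real K" unfolding K_def by linarith
  have s: "(ln L + 8) / \<rho> \<le> real s" "real s \<le> (ln L + 8) / \<rho> + 2"
    unfolding s_def using L0 by linarith+
  have "mixing_time \<mu> P \<le> enat (K * s + s)"
    using L s K by (intro mixing_time_le[OF mls \<rho>, of L]) (auto simp: s_def K_def)
  then have "ereal_of_enat (mixing_time \<mu> P) \<le> ereal_of_enat (enat (K * s + s))"
    by (simp only: ereal_of_enat_le_iff)
  also have "\<dots> = ereal ((real (nat \<lceil>64 / c\<rceil>) + 2) * real s)"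
    by (simp add: K_def algebra_simps)
  also have "\<dots> \<le> ereal ((real (nat \<lceil>64 / c\<rceil>) + 2) * ((ln L + 8) / \<rho> + 2))"
    using s by (simp add: mult_left_mono)
  finally show ?thesis .
qed

section \<open>Holding probability and smallest mass of the Glauber dynamics\<close>

context glauber_dynamics
begin

lemma set_pmf_glauber:
  assumes S: "S \<in> X" shows "set_pmf (glauber E \<mu> S) \<subseteq> X"
  unfolding glauber_def using E X S down[OF S] by (auto simp: Let_def insert_absorb split: if_splits)

lemma pmf_eq_expectation: "pmf p x = measure_pmf.expectation p (indicator {x})"
  by (simp add: measure_pmf_single)

text \<open>The edge form of the Dirichlet form is symmetric in its arguments; at indicators of two
  states it reads off the transition probability.\<close>

lemma glauber_reversible:
  assumes S: "S \<in> X" "R \<in> X"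
  shows "pmf \<mu> S * pmf (glauber E \<mu> S) R = pmf \<mu> R * pmf (glauber E \<mu> R) S"
proof -
  have d: "dirichlet_form \<mu> (glauber E \<mu>) (indicator {S}) (indicator {R})
      = pmf \<mu> S * (indicator {R} S - pmf (glauber E \<mu> S) R)" if "S \<in> X" for S R
  proof -
    have "dirichlet_form \<mu> (glauber E \<mu>) (indicator {S}) (indicator {R})
      = (\<Sum>A\<in>X. if A = S then pmf \<mu> S * (indicator {R} S - pmf (glauber E \<mu> S) R) else 0)"
      unfolding dirichlet_form_def X(1) by (intro sum.cong) (auto simp: pmf_eq_expectation)
    then show ?thesis using that finite_X by simp
  qed
  have "dirichlet_form \<mu> (glauber E \<mu>) (indicator {S}) (indicator {R})
    = dirichlet_form \<mu> (glauber E \<mu>) (indicator {R}) (indicator {S})"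
    unfolding dirichlet_form_glauber by (simp add: mult_ac)
  then show ?thesis
    unfolding d[OF S(1)] d[OF S(2)] by (cases "S = R") auto
qed

text \<open>Whichever coordinate is chosen, the current value is redrawn with probability at least
  \<open>1 / (1 + k)\<close>. The bound does not involve the size of \<open>E\<close>, so smoothing
  costs a constant factor.\<close>

lemma lazy_reversible_chain_glauber:
  assumes k: "0 < k" and up: "\<And>S i. S \<in> X \<Longrightarrow> i \<in> E - S \<Longrightarrow> insert i S \<in> X \<Longrightarrow> pmf \<mu> (insert i S) \<le> k * pmf \<mu> S"
    and down': "\<And>S i. S \<in> X \<Longrightarrow> i \<in> E - S \<Longrightarrow> insert i S \<in> X \<Longrightarrow> pmf \<mu> S \<le> k * pmf \<mu> (insert i S)"
  shows "lazy_reversible_chain \<mu> (glauber E \<mu>) (1 / (1 + k))"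
proof
  show "finite (set_pmf \<mu>)" using finite_X X by simp
  show "set_pmf (glauber E \<mu> S) \<subseteq> set_pmf \<mu>" if "S \<in> set_pmf \<mu>" for S
    using set_pmf_glauber that X by simp
  show "pmf \<mu> S * pmf (glauber E \<mu> S) R = pmf \<mu> R * pmf (glauber E \<mu> R) S"
    if "S \<in> set_pmf \<mu>" "R \<in> set_pmf \<mu>" for S R
    using glauber_reversible that X by simp
  show "0 < 1 / (1 + k)" "1 / (1 + k) < 1" using k by auto
  fix S assume "S \<in> set_pmf \<mu>"
  then have S: "S \<in> X" using X by simp
  have ratio: "1 / (1 + k) \<le> a / (b + a)" if "0 < a" "0 < b" "b \<le> k * a" for a b :: real
    using that k by (simp add: divide_simps) (simp add: algebra_simps)
  have "1 / (1 + k) \<le> resample i (indicator {S}) S" if i: "i \<in> E" for i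
  proof (cases "insert i S \<in> X")
    case True
    show ?thesis
    proof (cases "i \<in> S")
      case i': True
      then have e: "insert i (S - {i}) = S" "insert i S = S" "S - {i} \<noteq> S" by auto
      have "pmf \<mu> (S - {i}) \<le> k * pmf \<mu> S"
        using down'[OF down[OF S], of i i] i S by (simp add: e)
      then show ?thesis
        using ratio[of "pmf \<mu> S" "pmf \<mu> (S - {i})"] pmf_pos S down[OF S, of i] e(2,3)
        by (simp add: resample_def indicator_def)
    next
      case i': False
      then have e: "S - {i} = S" "insert i S \<noteq> S" by auto
      have "pmf \<mu> (insert i S) \<le> k * pmf \<mu> S" using up[OF S _ True] i i' by simp
      then show ?thesis
        using ratio[of "pmf \<mu> S" "pmf \<mu> (insert i S)"] pmf_pos S True e
        by (simp add: resample_def indicator_def add.commute)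
    qed
  next
    case False
    then show ?thesis using k by (simp add: resample_def)
  qed
  then have "(\<Sum>i\<in>E. 1 / (1 + k)) / card E \<le> (\<Sum>i\<in>E. resample i (indicator {S}) S) / card E"
    by (intro divide_right_mono sum_mono) auto
  then show "1 / (1 + k) \<le> pmf (glauber E \<mu> S) S"
    using E unfolding pmf_eq_expectation[of "glauber E \<mu> S"] expectation_glauber[OF S] by simp
qed

text \<open>Deleting elements one by one costs a factor \<open>k\<close> each, so every mass is
  within \<open>k ^ r\<close> of that of the empty set. Comparing any two states costs
  \<open>k ^ r\<close> twice, and at most \<open>N ^ r\<close> states share total mass 1.\<close>

lemma ln_inverse_pmf_le:
  assumes k: "1 \<le> k" and up: "\<And>S i. S \<in> X \<Longrightarrow> i \<in> E - S \<Longrightarrow> insert i S \<in> X \<Longrightarrow> pmf \<mu> (insert i S) \<le> k * pmf \<mu> S"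
    and down': "\<And>S i. S \<in> X \<Longrightarrow> i \<in> E - S \<Longrightarrow> insert i S \<in> X \<Longrightarrow> pmf \<mu> S \<le> k * pmf \<mu> (insert i S)"
    and r: "\<And>S. S \<in> X \<Longrightarrow> card S \<le> r" and N: "real (card X) \<le> N ^ r" "0 < N" and S: "S \<in> X"
  shows "ln (1 / pmf \<mu> S) \<le> r * (ln N + 2 * ln k)"
proof -
  have *: "pmf \<mu> S \<le> k ^ card S * pmf \<mu> {} \<and> pmf \<mu> {} \<le> k ^ card S * pmf \<mu> S" if "S \<in> X" for S
  proof -
    have "finite S" using that X finite_subset[OF _ E(1), of S] by auto
    then show ?thesis using that
    proof (induction S)
      case (insert i S)
      have S: "S \<in> X" using down[OF insert.prems, of i] insert.hyps by simp
      have i: "i \<in> E - S" using insert X by auto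
      have IH: "pmf \<mu> S \<le> k ^ card S * pmf \<mu> {}" "pmf \<mu> {} \<le> k ^ card S * pmf \<mu> S"
        using insert.IH[OF S] by auto
      have "pmf \<mu> (insert i S) \<le> k * (k ^ card S * pmf \<mu> {})"
        using up[OF S i insert.prems] mult_left_mono[OF IH(1), of k] k by linarith
      moreover have "pmf \<mu> {} \<le> k ^ card S * (k * pmf \<mu> (insert i S))"
      proof (rule order_trans[OF IH(2) mult_left_mono])
        show "pmf \<mu> S \<le> k * pmf \<mu> (insert i S)" by (rule down'[OF S i insert.prems])
      qed (use k in auto)
      ultimately show ?case using insert.hyps by (simp add: mult_ac)
    qed simp
  qed
  have kr: "k ^ card S \<le> k ^ r" if "S \<in> X" for S using r[OF that] k by (rule power_increasing)
  have "1 = (\<Sum>S\<in>X. pmf \<mu> S)" using sum_pmf_eq_1[OF finite_X, of \<mu>] X by simp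
  also have "\<dots> \<le> (\<Sum>S\<in>X. k ^ r * pmf \<mu> {})"
    using * kr by (intro sum_mono) (meson mult_right_mono order_trans pmf_nonneg)
  also have "\<dots> = card X * (k ^ r * pmf \<mu> {})" by simp
  also have "\<dots> \<le> N ^ r * (k ^ r * (k ^ r * pmf \<mu> S))"
  proof (intro mult_mono)
    have "pmf \<mu> {} \<le> k ^ card S * pmf \<mu> S" using *[OF S] by simp
    also have "\<dots> \<le> k ^ r * pmf \<mu> S" using kr[OF S] by (intro mult_right_mono) auto
    finally show "pmf \<mu> {} \<le> k ^ r * pmf \<mu> S" .
  qed (use N k in auto)
  finally have "1 / pmf \<mu> S \<le> N ^ r * (k ^ r * k ^ r)"
    using pmf_pos[OF S] by (simp add: divide_simps mult_ac)
  then have "ln (1 / pmf \<mu> S) \<le> ln (N ^ r * (k ^ r * k ^ r))"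
    using pmf_pos[OF S] by (intro ln_mono) auto
  also have "\<dots> = r * (ln N + 2 * ln k)"
    using N k by (simp add: ln_mult_pos ln_realpow algebra_simps)
  finally show ?thesis .
qed

end

text \<open>The counts by size are compared term by term with the binomial expansion of
  \<open>(card E + 1) ^ r\<close>.\<close>

lemma card_subsets_le_power:
  assumes E: "finite E" and X: "X \<subseteq> {S. S \<subseteq> E \<and> card S \<le> r}"
  shows "card X \<le> (card E + 1) ^ r"
proof -
  have "{S. S \<subseteq> E \<and> card S \<le> r} = (\<Union>k\<in>{..r}. {S. S \<subseteq> E \<and> card S = k})" by auto
  then have "card X \<le> card (\<Union>k\<in>{..r}. {S. S \<subseteq> E \<and> card S = k})"
    using X E by (intro card_mono) auto
  also have "\<dots> \<le> (\<Sum>k\<le>r. card {S. S \<subseteq> E \<and> card S = k})" by (rule card_UN_le) simp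
  also have "\<dots> = (\<Sum>k\<le>r. card E choose k)" using E by (simp add: n_subsets)
  also have "\<dots> \<le> (\<Sum>k\<le>r. (r choose k) * card E ^ k)"
  proof (rule sum_mono)
    fix k assume "k \<in> {..r}"
    then have "1 \<le> r choose k" by (simp add: Suc_leI)
    moreover have "card E choose k \<le> card E ^ k"
      by (cases "k \<le> card E") (auto simp: binomial_le_pow binomial_eq_0)
    ultimately show "card E choose k \<le> (r choose k) * card E ^ k" using mult_le_mono by fastforce
  qed
  also have "\<dots> = (card E + 1) ^ r" using binomial_ring[of "card E" 1 r] by simp
  finally show ?thesis .
qed

lemma random_cluster_eq:
  "random_cluster E \<I> q lam = weighted_pmf (Pow E) (rc_weight q lam (\<lambda>S. int (matroid_rank \<I> S)))"
  by (simp add: random_cluster_def rc_weight_def[abs_def])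

lemma (in rank_function) mixing_time_random_cluster:
  assumes q: "0 < q" "q \<le> 1" and lam: "0 < lam" and card_E: "2 \<le> card E"
    and k: "1 \<le> k" "inverse q * lam \<le> k" "inverse lam \<le> k"
  defines "\<mu> \<equiv> weighted_pmf (Pow E) (rc_weight q lam rk)"
    and "\<rho> \<equiv> max (1 / (1 + inverse q * lam)) (1 / (1 + inverse lam))"
  shows "ereal_of_enat (mixing_time \<mu> (glauber E \<mu>))
    \<le> ereal ((real (nat \<lceil>64 / (1 / (1 + k))\<rceil>) + 2) * ((1 + 2 * (ln (1 + 2 * ln k) + 8)) / \<rho> + 2)
        * (card E * ln (card E)))"
proof -
  define w where "w = rc_weight q lam rk"
  have w: "0 < w S" for S unfolding w_def by (rule rc_weight_pos[OF q(1) lam])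
  have fin: "finite (Pow E)" "Pow E \<noteq> {}" using fin_E by auto
  have Z: "0 < sum w (Pow E)" using fin w by (intro sum_pos) auto
  have pmf: "pmf \<mu> S = w S / sum w (Pow E)" if "S \<subseteq> E" for S
    using that w pmf_weighted_pmf[OF fin, of w S] by (simp add: \<mu>_def w_def)
  have E0: "E \<noteq> {}" using card_E by auto
  interpret glauber_dynamics E \<mu> "Pow E"
  proof
    show "set_pmf \<mu> = Pow E"
      unfolding \<mu>_def using w fin by (intro set_pmf_weighted_pmf) (auto simp: w_def)
  qed (use fin_E E0 in auto)
  have up: "pmf \<mu> (insert i S) \<le> k * pmf \<mu> S" and down: "pmf \<mu> S \<le> k * pmf \<mu> (insert i S)"
    if "S \<in> Pow E" "i \<in> E - S" "insert i S \<in> Pow E" for S i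
  proof -
    have "w (insert i S) \<le> inverse q * lam * w S" "w S \<le> inverse lam * w (insert i S)"
      using rc_weight_insert[OF q lam, of S i] that by (auto simp: w_def)
    moreover have "inverse q * lam * w S \<le> k * w S" "inverse lam * w (insert i S) \<le> k * w (insert i S)"
      using k w by (auto intro!: mult_right_mono simp: less_imp_le)
    ultimately have "w (insert i S) \<le> k * w S" "w S \<le> k * w (insert i S)" by linarith+
    then show "pmf \<mu> (insert i S) \<le> k * pmf \<mu> S" "pmf \<mu> S \<le> k * pmf \<mu> (insert i S)"
      using that Z by (simp_all add: pmf divide_right_mono)
  qed
  interpret lazy_reversible_chain \<mu> "glauber E \<mu>" "1 / (1 + k)"
    using k up down by (intro lazy_reversible_chain_glauber) auto
  define n where "n = real (card E)"
  have n: "2 \<le> n" using card_E by (simp add: n_def)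
  have \<rho>: "0 < \<rho>" using q lam by (simp add: \<rho>_def less_max_iff_disj add_pos_pos)
  \<comment> \<open>The 1 stands for \<open>ln 2\<close>, from the \<open>2 ^ card E\<close>
    states.\<close>
  define B where "B = 1 + 2 * ln k"
  have B: "1 \<le> B" using k by (simp add: B_def)
  have "ereal_of_enat (mixing_time \<mu> (glauber E \<mu>))
    \<le> ereal ((real (nat \<lceil>64 / (1 / (1 + k))\<rceil>) + 2) * ((ln (n * B) + 8) / (1 / n * \<rho>) + 2))"
  proof (rule mixing_time_le_real)
    show "modified_log_sobolev \<mu> (glauber E \<mu>) (1 / n * \<rho>)"
      unfolding \<mu>_def \<rho>_def n_def by (rule modified_log_sobolev_random_cluster[OF q lam E0])
    show "0 < 1 / n * \<rho>" using n \<rho> by simp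
    show "1 \<le> n * B" using n B mult_mono[of 1 n 1 B] by simp
    fix S assume "S \<in> set_pmf \<mu>"
    then have S: "S \<in> Pow E" using X by simp
    have "ln (1 / pmf \<mu> S) \<le> card E * (ln 2 + 2 * ln k)"
      using k up down S fin_E by (intro ln_inverse_pmf_le) (auto simp: card_mono card_Pow)
    also have "\<dots> \<le> n * B"
      unfolding n_def B_def using ln_2_less_1 by (intro mult_left_mono) auto
    finally show "ln (1 / pmf \<mu> S) \<le> n * B" .
  qed
  also have "\<dots> \<le> ereal ((real (nat \<lceil>64 / (1 / (1 + k))\<rceil>) + 2) * (((1 + 2 * (ln B + 8)) / \<rho> + 2) * (n * ln n)))"
    unfolding ereal_less_eq(3)
  proof (rule mult_left_mono)
    \<comment> \<open>With \<open>ln n\<close> bounded below, additive constants are absorbed into a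
      multiple of \<open>ln n\<close>.\<close>
    have ln2: "1 / 2 \<le> ln n"
    proof -
      have "1 - 1 / 2 \<le> ln (2 :: real)" by (rule one_minus_inverse_le_ln) simp
      also have "\<dots> \<le> ln n" using n by simp
      finally show ?thesis by simp
    qed
    have lB: "0 \<le> ln B" using B by simp
    have "(ln (n * B) + 8) / (1 / n * \<rho>) = n * (ln n + (ln B + 8)) / \<rho>"
      using n B \<rho> by (simp add: ln_mult_pos field_simps)
    also have "\<dots> \<le> n * (ln n * (1 + 2 * (ln B + 8))) / \<rho>"
    proof (intro divide_right_mono mult_left_mono)
      have "1 / 2 * (2 * (ln B + 8)) \<le> ln n * (2 * (ln B + 8))"
        using ln2 lB by (intro mult_right_mono) auto
      then show "ln n + (ln B + 8) \<le> ln n * (1 + 2 * (ln B + 8))" by (simp add: distrib_left)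
    qed (use n \<rho> in auto)
    finally have "(ln (n * B) + 8) / (1 / n * \<rho>) \<le> (1 + 2 * (ln B + 8)) / \<rho> * (n * ln n)"
      by (simp add: mult_ac)
    moreover have "1 \<le> n * ln n" using mult_mono[OF n ln2] n by simp
    ultimately show "(ln (n * B) + 8) / (1 / n * \<rho>) + 2 \<le> ((1 + 2 * (ln B + 8)) / \<rho> + 2) * (n * ln n)"
      by (simp add: distrib_right)
  qed simp
  finally show ?thesis by (simp add: n_def B_def mult.assoc)
qed

lemma (in matroid) mixing_time_weighted_indep:
  assumes lam: "0 < lam" and card_E: "3 \<le> card E" and k: "1 \<le> k" "lam \<le> k" "inverse lam \<le> k"
  defines "\<mu> \<equiv> weighted_indep \<I> lam"
  shows "ereal_of_enat (mixing_time \<mu> (glauber E \<mu>))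
    \<le> ereal ((real (nat \<lceil>64 / (1 / (1 + k))\<rceil>) + 2)
        * ((1 + (ln (2 + 2 * ln k) + 8) / ln (ln 3)) * (1 + lam) + 2 / ln (ln 3))
        * (card E * (ln (matroid_rank \<I> E) + ln (ln (card E)))))"
proof -
  have ne: "\<I> \<noteq> {}" using empty_indep by auto
  define Z where "Z = (\<Sum>S\<in>\<I>. lam ^ card S)"
  have Z: "0 < Z" unfolding Z_def using finite_indep_family ne lam by (intro sum_pos) auto
  have pmf: "pmf \<mu> S = lam ^ card S / Z" if "S \<in> \<I>" for S
    using that lam pmf_weighted_pmf[OF finite_indep_family ne, of "\<lambda>S. lam ^ card S" S]
    by (simp add: \<mu>_def weighted_indep_def Z_def)
  have E0: "E \<noteq> {}" using card_E by auto
  interpret glauber_dynamics E \<mu> \<I>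
  proof
    show "set_pmf \<mu> = \<I>"
      unfolding \<mu>_def weighted_indep_def using lam ne finite_indep_family
      by (intro set_pmf_weighted_pmf) auto
    show "S - {i} \<in> \<I>" if "S \<in> \<I>" for S i using indep_down[OF that] by auto
  qed (use finite_ground indep_subset E0 in auto)
  have up: "pmf \<mu> (insert i S) \<le> k * pmf \<mu> S" and down: "pmf \<mu> S \<le> k * pmf \<mu> (insert i S)"
    if S: "S \<in> \<I>" "i \<in> E - S" "insert i S \<in> \<I>" for S i
  proof -
    have e: "pmf \<mu> (insert i S) = lam * pmf \<mu> S" using S finite_indep by (simp add: pmf)
    show "pmf \<mu> (insert i S) \<le> k * pmf \<mu> S" unfolding e using k by (simp add: mult_right_mono)
    have "1 \<le> k * lam" using k lam by (simp add: field_simps)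
    then show "pmf \<mu> S \<le> k * pmf \<mu> (insert i S)"
      unfolding e using mult_right_mono[of 1 "k * lam" "pmf \<mu> S"] by (simp add: mult_ac)
  qed
  interpret lazy_reversible_chain \<mu> "glauber E \<mu>" "1 / (1 + k)"
    using k up down by (intro lazy_reversible_chain_glauber) auto
  define r where "r = matroid_rank \<I> E"
  \<comment> \<open>At rank 0 the entropy bound \<open>M\<close> must still be at least 1. Replacing
    the rank by 1 does not change its logarithm, because \<open>ln 0 = 0\<close>.\<close>
  define r' where "r' = max 1 (real r)"
  define n where "n = real (card E)"
  have n: "3 \<le> n" using card_E by (simp add: n_def)
  have ln3: "1 < ln (3 :: real)"
  proof -
    have "exp 1 < (3 :: real)" using e_less_272 by simp
    then show ?thesis by (metis exp_less_cancel_iff exp_ln zero_less_numeral)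
  qed
  have lnn: "ln 3 \<le> ln n" using n by simp
  \<comment> \<open>The first 2 comes from \<open>ln (n + 1) \<le> 2 * ln n\<close>; the term
    \<open>2 * ln k\<close> may be multiplied by \<open>ln n > 1\<close>.\<close>
  define B where "B = 2 + 2 * ln k"
  have B: "2 \<le> B" using k by (simp add: B_def)
  have r': "1 \<le> r'" "ln r' = ln r" by (cases "r = 0"; simp add: r'_def max_def)+
  define M where "M = r' * ln n * B"
  have M: "1 \<le> M"
  proof -
    have "1 * 1 * 1 \<le> r' * ln n * B" using r' lnn ln3 B by (intro mult_mono) auto
    then show ?thesis by (simp add: M_def)
  qed
  have "ereal_of_enat (mixing_time \<mu> (glauber E \<mu>))
    \<le> ereal ((real (nat \<lceil>64 / (1 / (1 + k))\<rceil>) + 2) * ((ln M + 8) / (1 / n * (1 / (1 + lam))) + 2))"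
  proof (rule mixing_time_le_real)
    show "modified_log_sobolev \<mu> (glauber E \<mu>) (1 / n * (1 / (1 + lam)))"
      unfolding \<mu>_def n_def by (rule modified_log_sobolev_weighted_indep[OF lam E0])
    show "0 < 1 / n * (1 / (1 + lam))" using n lam by simp
    show "1 \<le> M" by (rule M)
    fix S assume "S \<in> set_pmf \<mu>"
    then have S: "S \<in> \<I>" using X by simp
    have c: "card S \<le> r" if "S \<in> \<I>" for S
      unfolding r_def using that indep_subset by (intro card_le_rank) auto
    have "ln (1 / pmf \<mu> S) \<le> r * (ln (n + 1) + 2 * ln k)"
    proof (rule ln_inverse_pmf_le[OF k(1) up down c _ _ S])
      have "card \<I> \<le> (card E + 1) ^ r"
        using c indep_subset by (intro card_subsets_le_power finite_ground) auto
      then have "real (card \<I>) \<le> real ((card E + 1) ^ r)" by (simp only: of_nat_le_iff)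
      then show "real (card \<I>) \<le> (n + 1) ^ r" by (simp add: n_def add.commute)
    qed (use n in auto)
    also have "\<dots> \<le> r' * (ln n * B)"
    proof (rule mult_mono)
      have "ln (n + 1) \<le> ln (n ^ 2)"
      proof (rule ln_mono)
        have "3 * n \<le> n * n" using n by (intro mult_right_mono) auto
        then show "n + 1 \<le> n ^ 2" using n unfolding power2_eq_square by linarith
      qed (use n in auto)
      also have "\<dots> = 2 * ln n" using n by (simp add: ln_realpow)
      finally have "ln (n + 1) \<le> 2 * ln n" .
      moreover have "1 * (2 * ln k) \<le> ln n * (2 * ln k)"
        using lnn ln3 k by (intro mult_right_mono) auto
      ultimately show "ln (n + 1) + 2 * ln k \<le> ln n * B" by (simp add: B_def algebra_simps)
    qed (use n k in \<open>auto simp: r'_def\<close>)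
    finally show "ln (1 / pmf \<mu> S) \<le> M" by (simp add: M_def mult.assoc)
  qed
  also have "\<dots> \<le> ereal ((real (nat \<lceil>64 / (1 / (1 + k))\<rceil>) + 2)
      * (((1 + (ln B + 8) / ln (ln 3)) * (1 + lam) + 2 / ln (ln 3)) * (n * (ln r + ln (ln n)))))"
    unfolding ereal_less_eq(3)
  proof (rule mult_left_mono)
    \<comment> \<open>A positive lower bound for \<open>ln (ln n)\<close>, available from
      \<open>n = 3\<close> on, against which all additive constants are traded.\<close>
    define \<delta> where "\<delta> = ln (ln (3 :: real))"
    define H where "H = ln r + ln (ln n)"
    have \<delta>: "0 < \<delta>" using ln3 by (simp add: \<delta>_def)
    have H: "\<delta> \<le> H"
    proof -
      have "\<delta> \<le> ln (ln n)" unfolding \<delta>_def using ln3 lnn n by (intro ln_mono) auto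
      moreover have "0 \<le> ln r'" using r'(1) by simp
      ultimately show ?thesis by (simp add: H_def r'(2))
    qed
    have lB: "0 \<le> ln B" using B by simp
    have "ln M = H + ln B"
      unfolding M_def H_def r'(2)[symmetric] using r' lnn ln3 B by (simp add: ln_mult_pos)
    then have "(ln M + 8) / (1 / n * (1 / (1 + lam))) = n * (H + (ln B + 8)) * (1 + lam)"
      by simp
    also have "\<dots> \<le> n * (H * (1 + (ln B + 8) / \<delta>)) * (1 + lam)"
    proof (intro mult_right_mono mult_left_mono)
      have "\<delta> * ((ln B + 8) / \<delta>) \<le> H * ((ln B + 8) / \<delta>)"
        using H lB \<delta> by (intro mult_right_mono) auto
      moreover have "\<delta> * ((ln B + 8) / \<delta>) = ln B + 8" using \<delta> by simp
      ultimately show "H + (ln B + 8) \<le> H * (1 + (ln B + 8) / \<delta>)"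
        unfolding distrib_left mult_1_right by (simp only: add_le_cancel_left)
    qed (use n lam in auto)
    finally have "(ln M + 8) / (1 / n * (1 / (1 + lam))) \<le> (1 + (ln B + 8) / \<delta>) * (1 + lam) * (n * H)"
      by (simp add: mult_ac)
    moreover have "2 \<le> 2 / \<delta> * (n * H)"
    proof -
      have "1 * \<delta> \<le> n * H" using n H \<delta> by (intro mult_mono) auto
      then have "2 / \<delta> * (1 * \<delta>) \<le> 2 / \<delta> * (n * H)" using \<delta> by (intro mult_left_mono) auto
      then show ?thesis using \<delta> by simp
    qed
    ultimately have "(ln M + 8) / (1 / n * (1 / (1 + lam))) + 2
      \<le> ((1 + (ln B + 8) / \<delta>) * (1 + lam) + 2 / \<delta>) * (n * H)"
      unfolding distrib_right[of "(1 + (ln B + 8) / \<delta>) * (1 + lam)"] by (rule add_mono)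
    then show "(ln M + 8) / (1 / n * (1 / (1 + lam))) + 2
      \<le> ((1 + (ln B + 8) / ln (ln 3)) * (1 + lam) + 2 / ln (ln 3)) * (n * (ln r + ln (ln n)))"
      by (simp only: \<delta>_def H_def)
  qed simp
  finally show ?thesis by (simp add: n_def B_def r_def mult.assoc)
qed

text \<open>The asymptotic bounds are expressed by a \<open>C\<close> chosen before \<open>n\<close>
  and the matroid. They start at \<open>n = 2\<close> and \<open>n = 3\<close>, from where
  \<open>ln n\<close> and \<open>ln (ln n)\<close> are positive; at rank 0 the convention
  \<open>ln 0 = 0\<close> leaves the bound \<open>n * ln (ln n)\<close>.\<close>

theorem theorem5p1:
  shows
    "(\<forall>q lam :: real. 0 < q \<and> q \<le> 1 \<and> 0 < lam \<longrightarrow>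
        (\<forall>(n::nat) \<I>. 1 \<le> n \<and> matroid {1..n} \<I> \<longrightarrow>
           modified_log_sobolev (random_cluster {1..n} \<I> q lam)
             (glauber {1..n} (random_cluster {1..n} \<I> q lam))
             (1 / real n * max (1 / (1 + inverse q * lam)) (1 / (1 + inverse lam))))
      \<and> (\<exists>C::real. \<forall>(n::nat) \<I>. 2 \<le> n \<and> matroid {1..n} \<I> \<longrightarrow>
           ereal_of_enat (mixing_time (random_cluster {1..n} \<I> q lam)
             (glauber {1..n} (random_cluster {1..n} \<I> q lam)))
           \<le> ereal (C * (real n * ln (real n)))))
   \<and> (\<forall>lam :: real. 0 < lam \<longrightarrow>
        (\<forall>(n::nat) \<I>. 1 \<le> n \<and> matroid {1..n} \<I> \<longrightarrow>
           modified_log_sobolev (weighted_indep \<I> lam)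
             (glauber {1..n} (weighted_indep \<I> lam))
             (1 / (real n * (1 + lam))))
      \<and> (\<exists>C::real. \<forall>(n::nat) \<I>. 3 \<le> n \<and> matroid {1..n} \<I> \<longrightarrow>
           ereal_of_enat (mixing_time (weighted_indep \<I> lam)
             (glauber {1..n} (weighted_indep \<I> lam)))
           \<le> ereal (C * (real n * (ln (real (matroid_rank \<I> {1..n})) + ln (ln (real n)))))))"
proof (intro conjI allI impI)
  fix q lam :: real and n :: nat and \<I> :: "nat set set"
  assume q: "0 < q \<and> q \<le> 1 \<and> 0 < lam" and n: "1 \<le> n \<and> matroid {1..n} \<I>"
  then interpret matroid "{1..n}" \<I> by simp
  interpret rank_function "{1..n}" "\<lambda>S. int (matroid_rank \<I> S)" by (rule rank_function)
  show "modified_log_sobolev (random_cluster {1..n} \<I> q lam)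
             (glauber {1..n} (random_cluster {1..n} \<I> q lam))
             (1 / real n * max (1 / (1 + inverse q * lam)) (1 / (1 + inverse lam)))"
    using modified_log_sobolev_random_cluster[of q lam] q n by (simp add: random_cluster_eq)
next
  fix q lam :: real
  assume q: "0 < q \<and> q \<le> 1 \<and> 0 < lam"
  define k where "k = max 1 (max (inverse q * lam) (inverse lam))"
  show "\<exists>C::real. \<forall>(n::nat) \<I>. 2 \<le> n \<and> matroid {1..n} \<I> \<longrightarrow>
           ereal_of_enat (mixing_time (random_cluster {1..n} \<I> q lam)
             (glauber {1..n} (random_cluster {1..n} \<I> q lam)))
           \<le> ereal (C * (real n * ln (real n)))"
  proof (intro exI allI impI)
    fix n :: nat and \<I> :: "nat set set"
    assume n: "2 \<le> n \<and> matroid {1..n} \<I>"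
    then interpret matroid "{1..n}" \<I> by simp
    interpret rank_function "{1..n}" "\<lambda>S. int (matroid_rank \<I> S)" by (rule rank_function)
    show "ereal_of_enat (mixing_time (random_cluster {1..n} \<I> q lam)
             (glauber {1..n} (random_cluster {1..n} \<I> q lam)))
           \<le> ereal ((real (nat \<lceil>64 / (1 / (1 + k))\<rceil>) + 2) * ((1 + 2 * (ln (1 + 2 * ln k) + 8))
               / max (1 / (1 + inverse q * lam)) (1 / (1 + inverse lam)) + 2) * (real n * ln (real n)))"
      using mixing_time_random_cluster[of q lam k] q n unfolding random_cluster_eq
      by (simp add: k_def)
  qed
next
  fix lam :: real and n :: nat and \<I> :: "nat set set"
  assume lam: "0 < lam" and n: "1 \<le> n \<and> matroid {1..n} \<I>"
  then interpret matroid "{1..n}" \<I> by simp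
  show "modified_log_sobolev (weighted_indep \<I> lam) (glauber {1..n} (weighted_indep \<I> lam))
             (1 / (real n * (1 + lam)))"
    using modified_log_sobolev_weighted_indep[OF lam] n by simp
next
  fix lam :: real
  assume lam: "0 < lam"
  define k where "k = max 1 (max lam (inverse lam))"
  show "\<exists>C::real. \<forall>(n::nat) \<I>. 3 \<le> n \<and> matroid {1..n} \<I> \<longrightarrow>
           ereal_of_enat (mixing_time (weighted_indep \<I> lam)
             (glauber {1..n} (weighted_indep \<I> lam)))
           \<le> ereal (C * (real n * (ln (real (matroid_rank \<I> {1..n})) + ln (ln (real n)))))"
  proof (intro exI allI impI)
    fix n :: nat and \<I> :: "nat set set"
    assume n: "3 \<le> n \<and> matroid {1..n} \<I>"
    then interpret matroid "{1..n}" \<I> by simp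
    show "ereal_of_enat (mixing_time (weighted_indep \<I> lam) (glauber {1..n} (weighted_indep \<I> lam)))
           \<le> ereal ((real (nat \<lceil>64 / (1 / (1 + k))\<rceil>) + 2)
        * ((1 + (ln (2 + 2 * ln k) + 8) / ln (ln 3)) * (1 + lam) + 2 / ln (ln 3))
        * (real n * (ln (real (matroid_rank \<I> {1..n})) + ln (ln (real n)))))"
      using mixing_time_weighted_indep[of lam k] lam n by (simp add: k_def)
  qed
qed

end
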